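(* Let $G$ be a subcubic graph (i.e. $\Delta(G)\le 3$). \begin{enumerate} \item If $G$ has girth at least $9$ and $\mathrm{mad}(G) < 2 + \frac{2}{23}$, then $\chi_{\ell,s}'(G) \leq 5$. \item If $G$ is planar and has girth at least $41$, then $\chi_{\ell,s}'(G) \leq 5$. \end{enumerate}
   Context: All graphs are simple and finite. A strong edge-coloring of $G$ is an assignment of colors to the edges such that any two edges at distance at most two (i.e. two distinct edges that share an endpoint or are joined by an edge) receive distinct colors. The strong list chromatic index $\chi_{\ell,s}'(G)$ is the least integer $k$ such that for every assignment of lists $L(e)$ of at least $k$ colors to the edges $e$ of $G$, there is a strong edge-coloring $c$ of $G$ with $c(e)\in L(e)$ for every edge $e$. The maximum average degree $\mathrm{mad}(G)$ is the maximum of $2|E(H)|/|V(H)|$ over all (nonempty) subgraphs $H$ of $G$. The girth is the length of a shortest cycle. *)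

theory Defs
  imports "HOL-Analysis.Analysis" "HOL-Library.Extended_Nat"
begin

text \<open>A finite simple graph is given by its vertex set \<open>V\<close> and its edge set \<open>E\<close>; edges are
  two-element sets of vertices.\<close>

definition simple_graph :: "'a set \<Rightarrow> 'a set set \<Rightarrow> bool" where
  "simple_graph V E \<longleftrightarrow> finite V \<and> (\<forall>e\<in>E. e \<subseteq> V \<and> card e = 2)"

definition degree :: "'a set set \<Rightarrow> 'a \<Rightarrow> nat" where
  "degree E v = card {e \<in> E. v \<in> e}"

text \<open>The inserted \<open>0\<close> only matters for the graph without vertices.\<close>

definition max_degree :: "'a set \<Rightarrow> 'a set set \<Rightarrow> nat" where
  "max_degree V E = Max (insert 0 (degree E ` V))"

definition subgraph :: "'a set \<Rightarrow> 'a set set \<Rightarrow> 'a set \<Rightarrow> 'a set set \<Rightarrow> bool" where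
  "subgraph W F V E \<longleftrightarrow> simple_graph W F \<and> W \<subseteq> V \<and> F \<subseteq> E"

definition mad :: "'a set \<Rightarrow> 'a set set \<Rightarrow> real" where
  "mad V E = Max {2 * real (card F) / real (card W) | W F. subgraph W F V E \<and> W \<noteq> {}}"

definition is_cycle :: "'a set set \<Rightarrow> 'a list \<Rightarrow> bool" where
  "is_cycle E vs \<longleftrightarrow> 3 \<le> length vs \<and> distinct vs \<and>
     (\<forall>i<length vs. {vs ! i, vs ! (Suc i mod length vs)} \<in> E)"

text \<open>The girth of a forest is \<open>\<infinity>\<close>, the infimum of the empty set.\<close>

definition girth :: "'a set set \<Rightarrow> enat" where
  "girth E = (INF vs\<in>{vs. is_cycle E vs}. enat (length vs))"

text \<open>Topological planarity, with the plane represented by \<^typ>\<open>complex\<close>: \<open>p\<close> places the vertices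
  and \<open>\<gamma> e\<close> is the Jordan arc drawn for the edge \<open>e\<close>. An arc contains no vertices other than its
  two ends, and two arcs meet only in common ends.\<close>

definition planar_drawing ::
    "'a set \<Rightarrow> 'a set set \<Rightarrow> ('a \<Rightarrow> complex) \<Rightarrow> ('a set \<Rightarrow> real \<Rightarrow> complex) \<Rightarrow> bool" where
  "planar_drawing V E p \<gamma> \<longleftrightarrow>
     inj_on p V \<and>
     (\<forall>e\<in>E. arc (\<gamma> e) \<and> {pathstart (\<gamma> e), pathfinish (\<gamma> e)} = p ` e \<and>
             path_image (\<gamma> e) \<inter> p ` V = p ` e) \<and>
     (\<forall>e\<in>E. \<forall>f\<in>E. e \<noteq> f \<longrightarrow> path_image (\<gamma> e) \<inter> path_image (\<gamma> f) = p ` (e \<inter> f))"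

definition planar :: "'a set \<Rightarrow> 'a set set \<Rightarrow> bool" where
  "planar V E \<longleftrightarrow> (\<exists>p \<gamma>. planar_drawing V E p \<gamma>)"

definition within_distance_two :: "'a set set \<Rightarrow> 'a set \<Rightarrow> 'a set \<Rightarrow> bool" where
  "within_distance_two E e f \<longleftrightarrow>
     e \<noteq> f \<and> (e \<inter> f \<noteq> {} \<or> (\<exists>u\<in>e. \<exists>v\<in>f. {u, v} \<in> E))"

definition strong_edge_coloring :: "'a set set \<Rightarrow> ('a set \<Rightarrow> 'c) \<Rightarrow> bool" where
  "strong_edge_coloring E c \<longleftrightarrow>
     (\<forall>e\<in>E. \<forall>f\<in>E. within_distance_two E e f \<longrightarrow> c e \<noteq> c f)"

text \<open>Colors are natural numbers, which is no restriction for finite graphs. Since \<open>card\<close> is \<open>0\<close> on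
  infinite sets, infinite lists are admitted explicitly.\<close>

definition strongly_edge_choosable :: "'a set set \<Rightarrow> nat \<Rightarrow> bool" where
  "strongly_edge_choosable E k \<longleftrightarrow>
     (\<forall>L :: 'a set \<Rightarrow> nat set. (\<forall>e\<in>E. infinite (L e) \<or> k \<le> card (L e)) \<longrightarrow>
        (\<exists>c. strong_edge_coloring E c \<and> (\<forall>e\<in>E. c e \<in> L e)))"

definition strong_list_chromatic_index :: "'a set set \<Rightarrow> nat" where
  "strong_list_chromatic_index E = (LEAST k. strongly_edge_choosable E k)"

text \<open>The minimum exists for finite graphs, since \<open>card E\<close> colors per edge always suffice.\<close>

lemma finite_edges: "simple_graph V E \<Longrightarrow> finite E"
  by (rule finite_subset[of _ "Pow V"]) (auto simp: simple_graph_def)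

lemma distinct_choice:
  fixes L :: "'e \<Rightarrow> nat set"
  assumes "finite A" "\<forall>e\<in>A. infinite (L e) \<or> card A \<le> card (L e)"
  shows "\<exists>c. inj_on c A \<and> (\<forall>e\<in>A. c e \<in> L e)"
  using assms
proof (induction A rule: finite_induct)
  case empty
  then show ?case by simp
next
  case (insert a A)
  have "\<forall>e\<in>A. infinite (L e) \<or> card A \<le> card (L e)"
    using insert.prems insert.hyps by (simp add: Suc_le_eq) (meson less_imp_le)
  with insert.IH obtain c where c: "inj_on c A" "\<forall>e\<in>A. c e \<in> L e"
    by blast
  have "\<not> L a \<subseteq> c ` A"
  proof
    assume sub: "L a \<subseteq> c ` A"
    then have "finite (L a)"
      using insert.hyps(1) finite_subset by blast
    moreover have "card (L a) \<le> card A"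
      using card_mono[OF finite_imageI[OF insert.hyps(1)] sub] card_image_le[OF insert.hyps(1), of c]
      by linarith
    ultimately show False
      using insert.prems insert.hyps by auto
  qed
  then obtain x where x: "x \<in> L a" "x \<notin> c ` A"
    by blast
  have "inj_on (c(a := x)) (insert a A)"
    using c(1) x(2) insert.hyps(2) by (auto simp: inj_on_def image_iff)
  moreover have "\<forall>e\<in>insert a A. (c(a := x)) e \<in> L e"
    using c(2) x(1) by auto
  ultimately show ?case by blast
qed

lemma strongly_edge_choosable_card:
  assumes "finite E"
  shows "strongly_edge_choosable E (card E)"
  unfolding strongly_edge_choosable_def
proof (intro allI impI)
  fix L :: "'a set \<Rightarrow> nat set"
  assume "\<forall>e\<in>E. infinite (L e) \<or> card E \<le> card (L e)"
  then obtain c where "inj_on c E" "\<forall>e\<in>E. c e \<in> L e"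
    using distinct_choice[OF assms] by blast
  then show "\<exists>c. strong_edge_coloring E c \<and> (\<forall>e\<in>E. c e \<in> L e)"
    unfolding strong_edge_coloring_def within_distance_two_def
    by (intro exI[of _ c]) (simp add: inj_on_eq_iff)
qed

lemma strong_list_chromatic_index_le_iff:
  assumes "finite E"
  shows "strong_list_chromatic_index E \<le> k \<longleftrightarrow> strongly_edge_choosable E k"
proof
  assume le: "strong_list_chromatic_index E \<le> k"
  have "strongly_edge_choosable E (strong_list_chromatic_index E)"
    unfolding strong_list_chromatic_index_def
    using strongly_edge_choosable_card[OF assms] by (rule LeastI)
  with le show "strongly_edge_choosable E k"
    unfolding strongly_edge_choosable_def using le_trans by fast
next
  assume "strongly_edge_choosable E k"
  then show "strong_list_chromatic_index E \<le> k"
    unfolding strong_list_chromatic_index_def by (rule Least_le)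
qed

text \<open>The maximum defining \<open>mad\<close> is over a finite set, which is nonempty if \<open>V\<close> is.\<close>

lemma finite_subgraph_densities:
  assumes "simple_graph V E"
  shows "finite {2 * real (card F) / real (card W) | W F. subgraph W F V E \<and> W \<noteq> {}}"
proof (rule finite_subset)
  show "{2 * real (card F) / real (card W) | W F. subgraph W F V E \<and> W \<noteq> {}}
    \<subseteq> (\<lambda>(W, F). 2 * real (card F) / real (card W)) ` (Pow V \<times> Pow E)"
    by (auto simp: subgraph_def)
  show "finite ((\<lambda>(W, F). 2 * real (card F) / real (card W)) ` (Pow V \<times> Pow E))"
    using assms finite_edges[OF assms] by (simp add: simple_graph_def)
qed

end

theory Submission
  imports Defs
begin

text \<open>A pendant edge with at most four conflicts can be colored last, so in a minimal counterexample the
  graph \<open>G\<close> without its pendant edges has minimum degree at least 2. A path \<open>v\<^sub>0, \<dots>, v\<^sub>9\<close> in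
  this core whose inner vertices have degree 2 there is reducible as well: uncolor the edges at
  \<open>v\<^sub>1, \<dots>, v\<^sub>8\<close> except the two outermost spine edges. The (at most) 15 uncolored edges keep
  lists of sizes 2, 2, 4, 4, 5, 5, 5, 5, 5, 5, 5, 4, 4, 2, 2, and the corresponding coefficient
  of the graph polynomial of their conflict graph is 2, so the Combinatorial Nullstellensatz
  extends the coloring.

  Without such a path, walking along threads from the vertices of degree 3 shows that the core has
  average degree at least \<open>2 + 2 / 23\<close>. If the girth is at least 41, every cycle of the core
  contains at least 6 vertices of degree 3. For a plane cubic graph this is a discrete form of
  nonpositive curvature: on either side of a cycle, the outward edges exceed the inward ones by at
  least 6, which is impossible for both sides at once. The counting only uses the splitting of a
  Jordan domain by an arc, so Euler's formula is not needed.\<close>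

section \<open>A Combinatorial Nullstellensatz for graph polynomials\<close>

text \<open>The thread length comes from a degree count. With \<open>n\<close> inner vertices, all
  carrying leaves, 2n - 1 edges are uncolored; they form 7n - 12 conflicting pairs, and their list
  sizes minus one add up to 8n - 20. A monomial of the graph polynomial has degree equal to the
  number of conflicts, so the lists leave enough room only for n \<ge> 8, and at n = 8 both numbers
  are 44. The other constants follow. Girth 9 makes the vertices of the thread distinct, except that
  \<open>v\<^sub>0 = v\<^sub>9\<close> remains possible. Each of the three darts leaving a vertex of
  degree 3 accounts for at most 7 darts with head of degree 2; hence 2a \<le> 21b for the numbers a,
  b of vertices of degree 2 and 3, and the average degree 2 + b / (a + b) is at least 2 + 2 / 23.
  Eight consecutive vertices of a cycle include one of degree 3, so 5 * 8 + 1 = 41 vertices include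
  six. The curvature argument needs every path that enters a side of a cycle to be continued back to
  the cycle. Bridges are the obstacle, which is why it runs in a bridgeless piece with a few marked
  vertices of degree 2.\<close>

definition lagrange_sum :: "real set \<Rightarrow> nat \<Rightarrow> real" where
  "lagrange_sum A k = (\<Sum>a\<in>A. a ^ k / (\<Prod>b\<in>A - {a}. a - b))"

text \<open>\<open>lagrange_sum A k\<close> is the divided difference of x^k at the nodes
  \<open>A\<close>. Since x^(k+1) - c x^k = x^k (x - c), the term of the node \<open>c\<close>
  vanishes and in every other term the factor a - c of the denominator cancels.\<close>

lemma lagrange_sum_remove:
  assumes "finite A" "c \<in> A"
  shows "lagrange_sum A (Suc k) = c * lagrange_sum A k + lagrange_sum (A - {c}) k"
proof -
  have eq: "a ^ Suc k / (\<Prod>b\<in>A - {a}. a - b) - c * (a ^ k / (\<Prod>b\<in>A - {a}. a - b))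
      = a ^ k / (\<Prod>b\<in>A - {c} - {a}. a - b)" if "a \<in> A - {c}" for a
  proof -
    have "(\<Prod>b\<in>A - {a}. a - b) = (a - c) * (\<Prod>b\<in>A - {a} - {c}. a - b)"
      using assms that by (intro prod.remove) auto
    moreover have "A - {a} - {c} = A - {c} - {a}" by auto
    moreover have "(\<Prod>b\<in>A - {c} - {a}. a - b) \<noteq> 0"
      using assms by auto
    ultimately show ?thesis using that
      by (simp add: divide_simps) (simp add: algebra_simps)
  qed
  have "lagrange_sum A (Suc k) - c * lagrange_sum A k
      = (\<Sum>a\<in>A. a ^ Suc k / (\<Prod>b\<in>A - {a}. a - b) - c * (a ^ k / (\<Prod>b\<in>A - {a}. a - b)))"
    by (simp add: lagrange_sum_def sum_subtractf sum_distrib_left)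
  also have "\<dots> = (\<Sum>a\<in>A - {c}. a ^ Suc k / (\<Prod>b\<in>A - {a}. a - b) - c * (a ^ k / (\<Prod>b\<in>A - {a}. a - b)))"
    using assms by (subst sum.remove[of _ c]) auto
  also have "\<dots> = lagrange_sum (A - {c}) k"
    unfolding lagrange_sum_def by (rule sum.cong[OF refl eq])
  finally show ?thesis by simp
qed

text \<open>A divided difference of order \<open>d\<close> kills the powers below \<open>d\<close>
  and sends x^d to 1. For k = 0, removing either of two nodes \<open>c\<close>, \<open>c'\<close>
  leaves the same remainder, so c S = c' S and S = 0; the higher powers follow from the recursion at
  the node \<open>c\<close>.\<close>

lemma lagrange_sum_eq:
  assumes "finite A" "card A = Suc d" "k \<le> d"
  shows "lagrange_sum A k = (if k = d then 1 else 0)"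
  using assms
proof (induction d arbitrary: A k)
  case 0
  then obtain c where "A = {c}" by (auto simp: card_Suc_eq)
  with 0 show ?case by (simp add: lagrange_sum_def)
next
  case (Suc d)
  then obtain c c' where c: "c \<in> A" "c' \<in> A" "c \<noteq> c'"
    by (metis card_Suc_eq insertCI nat.distinct(1) singletonD)
  have IH: "lagrange_sum (A - {x}) j = (if j = d then 1 else 0)" if "j \<le> d" "x \<in> A" for x j
    using Suc that by (intro Suc.IH) auto
  have "c * lagrange_sum A 0 = c' * lagrange_sum A 0"
    using lagrange_sum_remove[OF Suc.prems(1) c(1), of 0] lagrange_sum_remove[OF Suc.prems(1) c(2), of 0]
      IH[of 0 c] IH[of 0 c'] c by simp
  then have z: "lagrange_sum A 0 = 0" using c(3) by simp
  show ?case using Suc.prems(3)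
  proof (induction k)
    case 0
    then show ?case using z by simp
  next
    case (Suc k)
    then show ?case using lagrange_sum_remove[OF \<open>finite A\<close> c(1), of k] IH[of k c] c by auto
  qed
qed

text \<open>\<open>graph_coeff k es m\<close> is the coefficient of \<open>x\<^sup>k\<close> in \<open>x\<^sup>m\<close> times the product of all
  \<open>x\<^sub>i - x\<^sub>j\<close> with \<open>(i, j)\<close> in \<open>es\<close>.\<close>

fun graph_coeff :: "nat list \<Rightarrow> (nat \<times> nat) list \<Rightarrow> nat list \<Rightarrow> int" where
  "graph_coeff k [] m = (if m = k then 1 else 0)"
| "graph_coeff k ((i, j) # es) m =
     graph_coeff k es (m[i := Suc (m ! i)]) - graph_coeff k es (m[j := Suc (m ! j)])"

text \<open>A linear functional on polynomials: summation over the grid with Lagrange weights. On a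
  monomial it is a product of one-variable divided differences.\<close>

definition weighted_sum :: "(nat \<Rightarrow> real set) \<Rightarrow> (nat \<times> nat) list \<Rightarrow> nat list \<Rightarrow> real" where
  "weighted_sum A es m = (\<Sum>a\<in>PiE {..<length m} A.
     (\<Prod>i<length m. a i ^ (m ! i) / (\<Prod>b\<in>A i - {a i}. a i - b)) *
     (\<Prod>(i, j)\<leftarrow>es. a i - a j))"

lemma weighted_sum_Cons:
  assumes "i < length m" "j < length m"
  shows "weighted_sum A ((i, j) # es) m =
    weighted_sum A es (m[i := Suc (m ! i)]) - weighted_sum A es (m[j := Suc (m ! j)])"
proof -
  have raise: "(\<Prod>t<length m. a t ^ (m[i := Suc (m ! i)] ! t) / (\<Prod>b\<in>A t - {a t}. a t - b))
      = a i * (\<Prod>t<length m. a t ^ (m ! t) / (\<Prod>b\<in>A t - {a t}. a t - b))"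
    if "i < length m" for a and i
  proof -
    have "(\<Prod>t\<in>{..<length m} - {i}. a t ^ (m[i := Suc (m ! i)] ! t) / (\<Prod>b\<in>A t - {a t}. a t - b))
      = (\<Prod>t\<in>{..<length m} - {i}. a t ^ (m ! t) / (\<Prod>b\<in>A t - {a t}. a t - b))"
      by (rule prod.cong) auto
    then show ?thesis
      using that by (simp add: prod.remove[of "{..<length m}" i])
  qed
  show ?thesis
    unfolding weighted_sum_def length_list_update raise[OF assms(1)] raise[OF assms(2)]
    by (simp add: algebra_simps sum_subtractf)
qed

text \<open>Expanding the factors keeps the total degree at \<open>sum_list k\<close>. A resulting
  monomial other than the target therefore has an exponent below its target, and the divided
  difference of that coordinate vanishes, however large the other exponents are.\<close>

lemma weighted_sum_eq_graph_coeff: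
  assumes "\<And>i. i < length k \<Longrightarrow> finite (A i) \<and> card (A i) = Suc (k ! i)"
    and "length m = length k" "\<forall>(i, j)\<in>set es. i < length k \<and> j < length k"
    and "length es + sum_list m = sum_list k"
  shows "weighted_sum A es m = of_int (graph_coeff k es m)"
  using assms(2-)
proof (induction es arbitrary: m)
  case Nil
  have prod: "weighted_sum A [] m = (\<Prod>i<length m. lagrange_sum (A i) (m ! i))"
    unfolding weighted_sum_def lagrange_sum_def using assms(1) Nil.prems(1)
    by (subst prod_sum_PiE) auto
  show ?case
  proof (cases "m = k")
    case True
    then show ?thesis
      using prod assms(1) by (simp add: lagrange_sum_eq)
  next
    case False
    have "\<exists>i<length k. m ! i < k ! i"
    proof (rule ccontr)
      assume "\<not> ?thesis"
      then have le: "\<And>i. i < length k \<Longrightarrow> k ! i \<le> m ! i" using leI by blast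
      have "\<exists>i<length k. k ! i \<noteq> m ! i"
        using False Nil.prems(1) by (auto simp: list_eq_iff_nth_eq)
      then have "(\<Sum>i<length k. k ! i) < (\<Sum>i<length k. m ! i)"
        using le by (intro sum_strict_mono_ex1) (auto simp: le_less)
      then show False
        using Nil.prems by (simp add: sum_list_sum_nth atLeast0LessThan)
    qed
    then obtain i where i: "i < length k" "m ! i < k ! i" by blast
    then have "lagrange_sum (A i) (m ! i) = 0"
      using assms(1)[OF i(1)] by (subst lagrange_sum_eq[where d = "k ! i"]) auto
    then show ?thesis
      using False i Nil.prems(1) prod by auto
  qed
next
  case (Cons e es)
  obtain i j where e: "e = (i, j)" by (cases e)
  have sum: "sum_list (m[i := Suc (m ! i)]) = Suc (sum_list m)" if "i < length m" for i
    using that member_le_sum_list[of "m ! i" m] by (simp add: sum_list_update)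
  show ?case
    using Cons.prems unfolding e
    by (subst weighted_sum_Cons) (auto simp: Cons.IH sum)
qed

text \<open>The coefficient is a weighted sum over the grid of lists, so if it is nonzero, the graph
  polynomial does not vanish at some grid point, which is a proper coloring. The colors are embedded
  into the reals because the weights need a field.\<close>

theorem graph_nullstellensatz:
  fixes A :: "nat \<Rightarrow> nat set"
  assumes card: "\<And>i. i < length k \<Longrightarrow> finite (A i) \<and> card (A i) = Suc (k ! i)"
    and es: "\<forall>(i, j)\<in>set es. i < length k \<and> j < length k"
    and len: "length es = sum_list k"
    and nz: "graph_coeff k es (replicate (length k) 0) \<noteq> 0"
  shows "\<exists>c. (\<forall>i<length k. c i \<in> A i) \<and> (\<forall>(i, j)\<in>set es. c i \<noteq> c j)"
proof -
  define A' where "A' i = real ` A i" for i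
  have "weighted_sum A' es (replicate (length k) 0)
      = of_int (graph_coeff k es (replicate (length k) 0))"
    using card es len
    by (intro weighted_sum_eq_graph_coeff) (auto simp: A'_def card_image sum_list_replicate)
  then have "weighted_sum A' es (replicate (length k) 0) \<noteq> 0" using nz by simp
  then obtain a where a: "a \<in> PiE {..<length k} A'"
      and "(\<Prod>(i, j)\<leftarrow>es. a i - a j) \<noteq> 0"
    unfolding weighted_sum_def
    by (metis (no_types, lifting) length_replicate mult_zero_right sum.neutral)
  then have ne: "a i \<noteq> a j" if "(i, j) \<in> set es" for i j
    using that unfolding prod_list_zero_iff set_map by force
  define c where "c i = (SOME x. x \<in> A i \<and> real x = a i)" for i
  have c: "c i \<in> A i \<and> real (c i) = a i" if "i < length k" for i
  proof -
    have "\<exists>x. x \<in> A i \<and> real x = a i"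
      using a that unfolding A'_def by (fastforce simp: PiE_def Pi_def)
    then show ?thesis unfolding c_def by (rule someI_ex)
  qed
  show ?thesis
  proof (intro exI[of _ c] conjI ballI allI impI)
    fix e assume e: "e \<in> set es"
    obtain i j where ij: "e = (i, j)" by (cases e)
    then have "c i \<noteq> c j"
      using c[of i] c[of j] ne[of i j] es e by auto
    then show "case e of (i, j) \<Rightarrow> c i \<noteq> c j" using ij by simp
  qed (use c in blast)
qed

text \<open>Computing \<^const>\<open>graph_coeff\<close> by its defining equations takes exponential time. Equal monomials
  are therefore collected after each factor, and monomials that cannot reach \<open>x\<^sup>k\<close> are dropped.\<close>

fun add_term :: "int \<times> nat list \<Rightarrow> (int \<times> nat list) list \<Rightarrow> (int \<times> nat list) list" where
  "add_term t [] = [t]"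
| "add_term (c, m) ((d, m') # S) = (if m = m' then (c + d, m) # S else (d, m') # add_term (c, m) S)"

definition live_term :: "nat list \<Rightarrow> (nat \<times> nat) list \<Rightarrow> nat \<Rightarrow> nat list \<Rightarrow> bool" where
  "live_term k es i m \<longleftrightarrow> m ! i \<le> k ! i \<and>
     (m ! i = k ! i \<or> list_ex (\<lambda>(a, b). a = i \<or> b = i) es)"

definition expand_terms :: "nat \<Rightarrow> nat \<Rightarrow> (int \<times> nat list) list \<Rightarrow> (int \<times> nat list) list" where
  "expand_terms i j S = foldr (\<lambda>(c, m) T.
     add_term (c, m[i := Suc (m ! i)]) (add_term (- c, m[j := Suc (m ! j)]) T)) S []"

fun collected_coeff :: "nat list \<Rightarrow> (nat \<times> nat) list \<Rightarrow> (int \<times> nat list) list \<Rightarrow> int" where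
  "collected_coeff k [] S = (\<Sum>(c, m)\<leftarrow>S. if m = k then c else 0)"
| "collected_coeff k ((i, j) # es) S = collected_coeff k es
     (filter (\<lambda>(c, m). c \<noteq> 0 \<and> live_term k es i m \<and> live_term k es j m) (expand_terms i j S))"

lemma sum_add_term:
  "(\<Sum>(c, m)\<leftarrow>add_term t S. c * f m) = fst t * f (snd t) + (\<Sum>(c, m)\<leftarrow>S. c * f m)" for f :: "_ \<Rightarrow> int"
  by (induction t S rule: add_term.induct) (auto simp: algebra_simps)

lemma sum_expand_terms:
  "(\<Sum>(c, m)\<leftarrow>expand_terms i j S. c * f m) =
     (\<Sum>(c, m)\<leftarrow>S. c * (f (m[i := Suc (m ! i)]) - f (m[j := Suc (m ! j)])))" for f :: "_ \<Rightarrow> int"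
  unfolding expand_terms_def by (induction S) (auto simp: sum_add_term algebra_simps)

text \<open>An exponent above its target never decreases, and one below its target needs a remaining
  factor with that variable. After a factor is processed, only its own two variables can have
  changed status, so \<open>collected_coeff\<close> tests just these.\<close>

lemma graph_coeff_nonzero_imp_live:
  "graph_coeff k es m \<noteq> 0 \<Longrightarrow> live_term k es i m"
proof (induction es arbitrary: m)
  case Nil
  then show ?case by (auto simp: live_term_def split: if_splits)
next
  case (Cons e es)
  obtain a b where e: "e = (a, b)" by (cases e)
  from Cons.prems have "graph_coeff k es (m[a := Suc (m ! a)]) \<noteq> 0 \<or> graph_coeff k es (m[b := Suc (m ! b)]) \<noteq> 0"
    by (auto simp: e)
  then obtain x where x: "x = a \<or> x = b" "live_term k es i (m[x := Suc (m ! x)])"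
    using Cons.IH by blast
  show ?case
  proof (cases "i < length m")
    case True
    with x show ?thesis by (cases "x = i") (auto simp: live_term_def e nth_list_update)
  next
    case False
    then have "m[x := Suc (m ! x)] ! i = m ! i" by (cases "x = i") (auto simp: list_update_beyond)
    with x show ?thesis by (auto simp: live_term_def e)
  qed
qed

lemma sum_filter_eq:
  "(\<And>c m. \<not> P (c, m) \<Longrightarrow> c * f m = 0) \<Longrightarrow>
     (\<Sum>(c, m)\<leftarrow>filter P S. c * f m) = (\<Sum>(c, m)\<leftarrow>S. c * f m)" for f :: "_ \<Rightarrow> int"
  by (induction S) auto

lemma collected_coeff_eq: "collected_coeff k es S = (\<Sum>(c, m)\<leftarrow>S. c * graph_coeff k es m)"
proof (induction es arbitrary: S)
  case Nil
  show ?case by (induction S) auto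
next
  case (Cons e es)
  obtain i j where e: "e = (i, j)" by (cases e)
  have "collected_coeff k (e # es) S = (\<Sum>(c, m)\<leftarrow>expand_terms i j S. c * graph_coeff k es m)"
    unfolding e collected_coeff.simps Cons.IH
    by (rule sum_filter_eq) (use graph_coeff_nonzero_imp_live in auto)
  also have "\<dots> = (\<Sum>(c, m)\<leftarrow>S. c * graph_coeff k (e # es) m)"
    by (simp add: sum_expand_terms e)
  finally show ?case .
qed

section \<open>The conflict graph of a caterpillar\<close>

definition caterpillar_exponents :: "nat list" where
  "caterpillar_exponents = [1, 1, 3, 3, 4, 4, 4, 4, 4, 4, 4, 3, 3, 1, 1]"

text \<open>Leaf edges have even and spine edges odd numbers. Edges at most 3 apart in this order
  conflict; of the pairs 4 apart, two spine edges are joined by the spine edge between them, while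
  two leaf edges are too far from each other. This gives 14 + 13 + 12 + 5 = 44 pairs, exactly the
  sum of the exponents.\<close>

definition caterpillar_edges :: "(nat \<times> nat) list" where
  "caterpillar_edges = [(i, j). i \<leftarrow> [0..<15], j \<leftarrow> [Suc i..<15], j < i + 4 \<or> (odd i \<and> j = i + 4)]"

lemma caterpillar_coeff: "collected_coeff caterpillar_exponents caterpillar_edges [(1, replicate 15 0)] = 2"
  by code_simp

lemma caterpillar_choosable:
  fixes A :: "nat \<Rightarrow> nat set"
  assumes "\<And>i. i < 15 \<Longrightarrow> finite (A i) \<and> card (A i) = Suc (caterpillar_exponents ! i)"
  shows "\<exists>c. (\<forall>i<15. c i \<in> A i) \<and>
    (\<forall>i j. i < j \<and> j < 15 \<and> (j < i + 4 \<or> odd i \<and> j = i + 4) \<longrightarrow> c i \<noteq> c j)"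
proof -
  have len: "length caterpillar_exponents = 15" by (simp add: caterpillar_exponents_def)
  have set: "set caterpillar_edges = {(i, j). i < j \<and> j < 15 \<and> (j < i + 4 \<or> odd i \<and> j = i + 4)}"
    by (auto simp: caterpillar_edges_def)
  have "length caterpillar_edges = sum_list caterpillar_exponents"
    by code_simp
  moreover have "graph_coeff caterpillar_exponents caterpillar_edges (replicate 15 0) \<noteq> 0"
    using caterpillar_coeff by (simp add: collected_coeff_eq)
  ultimately show ?thesis
    using graph_nullstellensatz[of caterpillar_exponents A caterpillar_edges] assms
    unfolding len set by auto
qed

section \<open>Reducible configurations\<close>

text \<open>Distances are measured inside \<open>F\<close>, so deleting edges might also delete
  conflicts between the remaining ones. Each extension of a coloring below has to exclude
  this.\<close>

definition strong_list_colorable :: "'a set set \<Rightarrow> ('a set \<Rightarrow> nat set) \<Rightarrow> bool" where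
  "strong_list_colorable F L \<longleftrightarrow> (\<exists>c. strong_edge_coloring F c \<and> (\<forall>e\<in>F. c e \<in> L e))"

lemma within_distance_two_sym: "within_distance_two F e f \<Longrightarrow> within_distance_two F f e"
  unfolding within_distance_two_def by (metis inf_commute insert_commute)

lemma subset_of_large:
  assumes "infinite A \<or> n \<le> card A"
  obtains B where "B \<subseteq> A" "finite B" "card B = n"
  using assms infinite_arbitrarily_large obtain_subset_with_card_n by metis

lemma large_Diff:
  assumes "infinite A \<or> n \<le> card A" "finite B" "card B + m \<le> n"
  shows "infinite (A - B) \<or> m \<le> card (A - B)"
proof (cases "finite A")
  case True
  then show ?thesis using assms diff_card_le_card_Diff[of B A] by linarith
qed (use assms in auto)

lemma two_edges_at:
  assumes "card e = 2" "x \<in> e"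
  obtains y where "e = {x, y}" "y \<noteq> x"
  using assms by (auto simp: card_2_iff insert_commute)

text \<open>Five colors exceed four conflicts. The pendant edge joins no two other edges, since no
  other edge contains \<open>u\<close>, so the conflicts of the rest are the same with and without
  it.\<close>

lemma extend_to_pendant_edge:
  assumes "finite F" and e: "{u, v} \<in> F" and u: "{f \<in> F. u \<in> f} = {{u, v}}"
    and few: "card {f \<in> F. within_distance_two F {u, v} f} \<le> 4"
    and L: "infinite (L {u, v}) \<or> 5 \<le> card (L {u, v})"
    and "strong_list_colorable (F - {{u, v}}) L"
  shows "strong_list_colorable F L"
proof -
  let ?e = "{u, v}" and ?C = "{f \<in> F. within_distance_two F {u, v} f}"
  obtain c where c: "strong_edge_coloring (F - {?e}) c" "\<forall>f\<in>F - {?e}. c f \<in> L f"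
    using assms(6) unfolding strong_list_colorable_def by blast
  have "infinite (L ?e - c ` ?C) \<or> 1 \<le> card (L ?e - c ` ?C)"
    using L few card_image_le[of ?C c] \<open>finite F\<close> by (intro large_Diff[where n = 5]) auto
  then have "L ?e - c ` ?C \<noteq> {}" by (metis card.empty finite.emptyI not_one_le_zero)
  then obtain x where x: "x \<in> L ?e" "x \<notin> c ` ?C" by blast
  have within: "within_distance_two (F - {?e}) f g"
    if "f \<in> F - {?e}" "g \<in> F - {?e}" "within_distance_two F f g" for f g
  proof -
    have "u \<notin> f" "u \<notin> g" using that u by blast+
    then show ?thesis
      using that unfolding within_distance_two_def by (auto simp: doubleton_eq_iff)
  qed
  have "strong_edge_coloring F (c(?e := x))"
    unfolding strong_edge_coloring_def
  proof (intro ballI impI)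
    fix f g assume fg: "f \<in> F" "g \<in> F" "within_distance_two F f g"
    then have "f \<noteq> g" by (auto simp: within_distance_two_def)
    consider "f = ?e" "g \<noteq> ?e" | "g = ?e" "f \<noteq> ?e" | "f \<noteq> ?e" "g \<noteq> ?e"
      using \<open>f \<noteq> g\<close> by blast
    then show "(c(?e := x)) f \<noteq> (c(?e := x)) g"
    proof cases
      case 1
      then show ?thesis using x fg by auto
    next
      case 2
      then have "f \<in> ?C" using fg within_distance_two_sym[OF fg(3)] by simp
      then have "c f \<noteq> x" using x by blast
      then show ?thesis using 2 by auto
    next
      case 3
      then show ?thesis
        using c(1) within fg unfolding strong_edge_coloring_def by auto
    qed
  qed
  then show ?thesis
    unfolding strong_list_colorable_def using c(2) x(1) by (intro exI[of _ "c(?e := x)"]) auto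
qed

section \<open>Recoloring along a thread\<close>

text \<open>\<open>I\<close> is the set of inner positions that carry a pendant edge, with leaf
  \<open>u i\<close>. Injectivity is required on \<open>{0..8}\<close> and on \<open>{1..9}\<close>
  separately, because girth 9 still allows \<open>v 0 = v 9\<close>.\<close>

locale leafy_thread =
  fixes F :: "'a set set" and v u :: "nat \<Rightarrow> 'a" and I :: "nat set"
  assumes inj_left: "inj_on v {0..8}" and inj_right: "inj_on v {1..9}"
    and spine: "\<And>i. i \<le> 8 \<Longrightarrow> {v i, v (Suc i)} \<in> F"
    and edges_at: "\<And>i. 1 \<le> i \<Longrightarrow> i \<le> 8 \<Longrightarrow>
      {e \<in> F. v i \<in> e} = {{v (i - 1), v i}, {v i, v (Suc i)}} \<union> (if i \<in> I then {{v i, u i}} else {})"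
    and leaf: "\<And>i. i \<in> I \<Longrightarrow> {e \<in> F. u i \<in> e} = {{v i, u i}}"
    and leaf_range: "\<And>i. i \<in> I \<Longrightarrow> 1 \<le> i \<and> i \<le> 8 \<and> u i \<notin> v ` {0..9}"
    and finite: "finite F"
    and ends: "degree F (v 0) \<le> 3" "degree F (v 9) \<le> 3"
begin

text \<open>The edges to be recolored, in the order in which \<open>caterpillar_choosable\<close> lists them: leaf
  edges have even and spine edges odd numbers.\<close>

definition ed :: "nat \<Rightarrow> 'a set" where
  "ed k = (if odd k then {v ((k + 1) div 2), v ((k + 3) div 2)} else {v (k div 2 + 1), u (k div 2 + 1)})"

definition K :: "nat set" where
  "K = {k. k < 15 \<and> (odd k \<or> k div 2 + 1 \<in> I)}"

lemma ed_odd: "k < 15 \<Longrightarrow> odd k \<Longrightarrow> \<exists>i. 1 \<le> i \<and> i \<le> 7 \<and> k = 2 * i - 1 \<and> ed k = {v i, v (Suc i)}"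
  by (intro exI[of _ "(k + 1) div 2"]) (auto simp: ed_def elim!: oddE)

lemma ed_even: "k < 15 \<Longrightarrow> even k \<Longrightarrow> \<exists>i. 1 \<le> i \<and> i \<le> 8 \<and> k = 2 * i - 2 \<and> ed k = {v i, u i}"
  by (intro exI[of _ "k div 2 + 1"]) (auto simp: ed_def elim!: evenE)

lemma ed_spine: "1 \<le> i \<Longrightarrow> i \<le> 7 \<Longrightarrow> ed (2 * i - 1) = {v i, v (Suc i)} \<and> 2 * i - 1 \<in> K"
  by (cases i) (auto simp: ed_def K_def)

lemma ed_leaf: "i \<in> I \<Longrightarrow> ed (2 * i - 2) = {v i, u i} \<and> 2 * i - 2 \<in> K"
  using leaf_range[of i] by (cases i) (auto simp: ed_def K_def)

lemma K_cases:
  assumes "k \<in> K"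
  obtains (spine) i where "1 \<le> i" "i \<le> 7" "k = 2 * i - 1" "ed k = {v i, v (Suc i)}"
    | (leaf) i where "i \<in> I" "1 \<le> i" "i \<le> 8" "k = 2 * i - 2" "ed k = {v i, u i}"
proof (cases "odd k")
  case True
  then show ?thesis using ed_odd[of k] assms spine by (auto simp: K_def)
next
  case False
  then obtain i where i: "1 \<le> i" "i \<le> 8" "k = 2 * i - 2" "ed k = {v i, u i}"
    using ed_even[of k] assms by (auto simp: K_def)
  moreover have "k div 2 + 1 = i" using i by auto
  ultimately show ?thesis using leaf[of i] assms False by (auto simp: K_def)
qed

lemma ed_in: "k \<in> K \<Longrightarrow> ed k \<in> F"
proof (erule K_cases)
  fix i assume "i \<in> I" "ed k = {v i, u i}"
  then show "ed k \<in> F" using leaf[of i] by auto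
qed (use spine in auto)

lemma v_eq_iff: "i \<le> 8 \<Longrightarrow> j \<le> 8 \<Longrightarrow> v i = v j \<longleftrightarrow> i = j"
  using inj_left by (auto simp: inj_on_eq_iff)

lemma v9_neq: "1 \<le> i \<Longrightarrow> i \<le> 8 \<Longrightarrow> v 9 \<noteq> v i"
  using inj_onD[OF inj_right, of 9 i] by auto

lemma u_neq: "i \<in> I \<Longrightarrow> j \<le> 9 \<Longrightarrow> u i \<noteq> v j"
  using leaf_range[of i] by auto

text \<open>The edges at \<open>v s\<close> carry the numbers 2s - 3, 2s - 2 and 2s - 1; two of the
  equations are additive because subtraction of naturals truncates. In particular, the uncolored
  edges avoid both ends of the thread.\<close>

lemma v_in_ed:
  assumes "k \<in> K" "v s \<in> ed k" "s \<le> 9"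
  shows "1 \<le> s \<and> s \<le> 8 \<and> (k = 2 * s - 1 \<or> k + 3 = 2 * s \<or> k + 2 = 2 * s)"
  using assms(1)
proof (cases rule: K_cases)
  case (spine i)
  have "v s = v i \<or> v s = v (Suc i)" using assms(2) spine by auto
  then have "s = i \<or> s = Suc i"
    using v_eq_iff[of s i] v_eq_iff[of s "Suc i"] v9_neq[of i] v9_neq[of "Suc i"] spine assms(3)
    by (cases "s = 9") auto
  then show ?thesis using spine by auto
next
  case (leaf i)
  have "v s = v i" using assms leaf u_neq[of i s] by auto
  then have "s = i"
    using v_eq_iff[of s i] v9_neq[of i] leaf assms(3) by (cases "s = 9") auto
  then show ?thesis using leaf by auto
qed

lemma edge_at_cases:
  assumes "f \<in> F" "v s \<in> f" "1 \<le> s" "s \<le> 8" "f \<notin> ed ` K"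
  shows "s = 1 \<and> f = {v 0, v 1} \<or> s = 8 \<and> f = {v 8, v 9}"
proof -
  have sp: "{v i, v (Suc i)} \<in> ed ` K" if "1 \<le> i" "i \<le> 7" for i
    using ed_spine[OF that] by blast
  have lf: "{v i, u i} \<in> ed ` K" if "i \<in> I" for i
    using ed_leaf[OF that] by blast
  have "f \<in> {{v (s - 1), v s}, {v s, v (Suc s)}} \<union> (if s \<in> I then {{v s, u s}} else {})"
    using assms(1,2) edges_at[OF assms(3,4)] by blast
  then consider "f = {v (s - 1), v s}" | "f = {v s, v (Suc s)}" | "s \<in> I" "f = {v s, u s}"
    by (auto split: if_splits)
  then show ?thesis
  proof cases
    case 1
    then show ?thesis using sp[of "s - 1"] assms by (cases "s = 1") auto
  next
    case 2
    then show ?thesis using sp[of s] assms by (cases "s = 8") auto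
  next
    case 3
    then show ?thesis using lf assms by auto
  qed
qed

text \<open>A leaf has no second edge, so every conflict of an uncolored edge passes through the
  spine, by a common vertex or one spine step. This turns conflicts into inequalities between
  indices.\<close>

lemma conflict_via_spine:
  assumes "k \<in> K" "f \<in> F" "within_distance_two F (ed k) f"
  obtains s t where "1 \<le> s" "s \<le> 8" "v s \<in> ed k" "v t \<in> f" "t = s \<or> Suc t = s \<or> t = Suc s"
proof -
  obtain x where x: "x \<in> ed k" "x \<in> f \<or> (\<exists>y\<in>f. {x, y} \<in> F)"
    using assms(3) unfolding within_distance_two_def by blast
  have ne: "f \<noteq> ed k" using assms(3) unfolding within_distance_two_def by blast
  have "(\<exists>s. 1 \<le> s \<and> s \<le> 8 \<and> x = v s) \<or> (\<exists>i\<in>I. x = u i \<and> ed k = {v i, u i})"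
    using assms(1)
  proof (cases rule: K_cases)
    case (spine i)
    then have "x = v i \<or> x = v (Suc i)" using x(1) by auto
    then show ?thesis
    proof
      assume "x = v i"
      then show ?thesis using spine by (intro disjI1 exI[of _ i]) auto
    next
      assume "x = v (Suc i)"
      then show ?thesis using spine by (intro disjI1 exI[of _ "Suc i"]) auto
    qed
  next
    case (leaf i)
    then show ?thesis using x(1) by auto
  qed
  then show thesis
  proof (elim disjE exE bexE conjE)
    fix s assume s: "1 \<le> s" "s \<le> 8" "x = v s"
    show thesis
    proof (cases "x \<in> f")
      case True
      then show thesis using that[of s s] s x by auto
    next
      case False
      then obtain y where y: "y \<in> f" "{v s, y} \<in> F" using x s by blast
      have "{v s, y} \<in> {e \<in> F. v s \<in> e}" using y by simp
      then consider "{v s, y} = {v (s - 1), v s}" | "{v s, y} = {v s, v (Suc s)}"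
        | "s \<in> I" "{v s, y} = {v s, u s}"
        unfolding edges_at[OF s(1,2)] by (cases "s \<in> I") auto
      then consider "y = v (s - 1)" | "y = v (Suc s)" | "s \<in> I" "y = u s"
        by cases (auto simp: doubleton_eq_iff)
      then show thesis
      proof cases
        case 1
        then show thesis using that[of s "s - 1"] s x y by auto
      next
        case 2
        then show thesis using that[of s "Suc s"] s x y by auto
      next
        case 3
        then have "f = {v s, u s}" using leaf[of s] y assms(2) by blast
        then show thesis using that[of s s] s x by auto
      qed
    qed
  next
    fix i assume i: "i \<in> I" "x = u i" "ed k = {v i, u i}"
    have "x \<notin> f" using leaf[OF i(1)] i ne assms(2) by blast
    then obtain y where y: "y \<in> f" "{u i, y} \<in> F" using x i by blast
    then have "{u i, y} \<in> {e \<in> F. u i \<in> e}" by simp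
    then have "{u i, y} = {v i, u i}" unfolding leaf[OF i(1)] by simp
    then have "y = v i" by (auto simp: doubleton_eq_iff)
    then show thesis using that[of i i] i y leaf_range[OF i(1)] by auto
  qed
qed

text \<open>From 2s \<le> j + 3, t \<le> s + 1 and k + 1 \<le> 2t follows k \<le> j + 4, and
  equality forces j = 2s - 3, a spine edge.\<close>

lemma inner_conflict:
  assumes "j \<in> K" "k \<in> K" "j < k" "within_distance_two F (ed j) (ed k)"
  shows "k < j + 4 \<or> odd j \<and> k = j + 4"
proof -
  obtain s t where st: "1 \<le> s" "s \<le> 8" "v s \<in> ed j" "v t \<in> ed k" "t = s \<or> Suc t = s \<or> t = Suc s"
    using conflict_via_spine[OF assms(1) ed_in[OF assms(2)] assms(4)] by blast
  have "1 \<le> t \<and> t \<le> 8 \<and> (k = 2 * t - 1 \<or> k + 3 = 2 * t \<or> k + 2 = 2 * t)"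
    using st by (intro v_in_ed[OF assms(2)]) auto
  then have k: "k + 1 \<le> 2 * t" by auto
  have "j = 2 * s - 1 \<or> j + 3 = 2 * s \<or> j + 2 = 2 * s"
    using v_in_ed[OF assms(1) st(3)] st(2) by linarith
  then have j: "2 * s \<le> j + 3" by auto
  have t: "t \<le> s + 1" using st(5) by linarith
  have "k \<le> j + 4" using k j t by linarith
  moreover have "odd j" if "k = j + 4"
  proof -
    have "2 * s = j + 3" using k j t that by linarith
    then show ?thesis by presburger
  qed
  ultimately show ?thesis by linarith
qed

text \<open>Only the first and last four positions see colored edges: the two nearest to an end see
  all edges at that end, the next two see just the outermost spine edge.\<close>

lemma outer_conflict:
  assumes "k \<in> K" "f \<in> F - ed ` K" "within_distance_two F (ed k) f"
  shows "k \<le> 1 \<and> v 0 \<in> f \<or> k \<le> 3 \<and> f = {v 0, v 1} \<or> 13 \<le> k \<and> v 9 \<in> f \<or> 11 \<le> k \<and> f = {v 8, v 9}"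
proof -
  obtain s t where st: "1 \<le> s" "s \<le> 8" "v s \<in> ed k" "v t \<in> f" "t = s \<or> Suc t = s \<or> t = Suc s"
    using conflict_via_spine[OF assms(1) _ assms(3)] assms(2) by blast
  have k: "k = 2 * s - 1 \<or> k + 3 = 2 * s \<or> k + 2 = 2 * s" "k < 15"
    using v_in_ed[OF assms(1) st(3)] st assms(1) by (auto simp: K_def)
  consider "t = 0" | "t = 9" | "1 \<le> t" "t \<le> 8" using st by linarith
  then show ?thesis
  proof cases
    case 1
    then have "s = 1" using st by linarith
    then show ?thesis using k st 1 by auto
  next
    case 2
    then have "s = 8" using st by linarith
    then show ?thesis using k st 2 by auto
  next
    case 3
    then have "t = 1 \<and> f = {v 0, v 1} \<or> t = 8 \<and> f = {v 8, v 9}"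
      using edge_at_cases[of f t] assms(2) st(4) by blast
    then show ?thesis
    proof
      assume t: "t = 1 \<and> f = {v 0, v 1}"
      then have "k \<le> 3" using st k by auto
      then show ?thesis using t by blast
    next
      assume t: "t = 8 \<and> f = {v 8, v 9}"
      then have "11 \<le> k" using st k by auto
      then show ?thesis using t by blast
    qed
  qed
qed

text \<open>The counts of colored conflicts are at most 3, 3, 1, 1 from either end and 0 in the
  middle, the outermost spine edge being one of the at most three edges at its end. Subtracting from
  5 gives the list sizes, one more than \<open>caterpillar_exponents\<close>.\<close>

lemma card_outer_conflicts:
  assumes "k \<in> K"
  shows "card {f \<in> F - ed ` K. within_distance_two F (ed k) f} + Suc (caterpillar_exponents ! k) \<le> 5"
proof -
  let ?N = "{f \<in> F - ed ` K. within_distance_two F (ed k) f}"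
  have k: "k < 15" using assms by (simp add: K_def)
  have N: "\<And>f. f \<in> ?N \<Longrightarrow> f \<in> F \<and> (k \<le> 1 \<and> v 0 \<in> f \<or> k \<le> 3 \<and> f = {v 0, v 1} \<or> 13 \<le> k \<and> v 9 \<in> f \<or> 11 \<le> k \<and> f = {v 8, v 9})"
    using outer_conflict[OF assms] by blast
  consider "k \<le> 1" | "2 \<le> k" "k \<le> 3" | "4 \<le> k" "k \<le> 10" | "11 \<le> k" "k \<le> 12" | "13 \<le> k" by linarith
  then show ?thesis
  proof cases
    case 1
    have "?N \<subseteq> {f \<in> F. v 0 \<in> f}"
    proof
      fix f assume "f \<in> ?N"
      from N[OF this] 1 have "f \<in> F" "v 0 \<in> f \<or> f = {v 0, v 1}" by auto
      then show "f \<in> {f \<in> F. v 0 \<in> f}" by blast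
    qed
    then have "card ?N \<le> degree F (v 0)"
      unfolding degree_def by (rule card_mono[rotated]) (simp add: finite)
    then have "card ?N \<le> 3" using ends(1) by simp
    moreover have "caterpillar_exponents ! k = 1" using 1 by (auto simp: caterpillar_exponents_def le_Suc_eq)
    ultimately show ?thesis by simp
  next
    case 2
    have "?N \<subseteq> {{v 0, v 1}}"
    proof
      fix f assume "f \<in> ?N"
      from N[OF this] 2 show "f \<in> {{v 0, v 1}}" by auto
    qed
    then have "card ?N \<le> 1" using card_mono[of "{{v 0, v 1}}" ?N] by simp
    moreover have "k = 2 \<or> k = 3" using 2 by auto
    then have "caterpillar_exponents ! k = 3" by (auto simp: caterpillar_exponents_def)
    ultimately show ?thesis by simp
  next
    case 3
    have "?N = {}"
    proof (rule equals0I)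
      fix f assume "f \<in> ?N"
      from N[OF this] 3 show False by auto
    qed
    then have "card ?N = 0" by (metis card.empty)
    moreover have "k = 4 \<or> k = 5 \<or> k = 6 \<or> k = 7 \<or> k = 8 \<or> k = 9 \<or> k = 10" using 3 by auto
    then have "caterpillar_exponents ! k = 4" by (auto simp: caterpillar_exponents_def)
    ultimately show ?thesis by linarith
  next
    case 4
    have "?N \<subseteq> {{v 8, v 9}}"
    proof
      fix f assume "f \<in> ?N"
      from N[OF this] 4 show "f \<in> {{v 8, v 9}}" by auto
    qed
    then have "card ?N \<le> 1" using card_mono[of "{{v 8, v 9}}" ?N] by simp
    moreover have "k = 11 \<or> k = 12" using 4 by auto
    then have "caterpillar_exponents ! k = 3" by (auto simp: caterpillar_exponents_def)
    ultimately show ?thesis by simp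
  next
    case 5
    have "?N \<subseteq> {f \<in> F. v 9 \<in> f}"
    proof
      fix f assume "f \<in> ?N"
      from N[OF this] 5 have "f \<in> F" "v 9 \<in> f \<or> f = {v 8, v 9}" by auto
      then show "f \<in> {f \<in> F. v 9 \<in> f}" by blast
    qed
    then have "card ?N \<le> degree F (v 9)"
      unfolding degree_def by (rule card_mono[rotated]) (simp add: finite)
    then have "card ?N \<le> 3" using ends(2) by simp
    moreover have "k = 13 \<or> k = 14" using 5 k by auto
    then have "caterpillar_exponents ! k = 1" by (auto simp: caterpillar_exponents_def)
    ultimately show ?thesis by simp
  qed
qed

text \<open>Uncoloring creates no new freedom among the colored edges. A colored edge meets the
  inner vertices only in \<open>v 1\<close> or \<open>v 8\<close>, so a removed spine edge cannot
  join two of them; a removed leaf edge cannot because of its leaf.\<close>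

lemma within_distance_two_rest:
  assumes f: "f \<in> F - ed ` K" and g: "g \<in> F - ed ` K" and "within_distance_two F f g"
  shows "within_distance_two (F - ed ` K) f g"
proof (rule ccontr)
  assume "\<not> ?thesis"
  then obtain x y where xy: "x \<in> f" "y \<in> g" "{x, y} \<in> ed ` K"
    using assms(3) unfolding within_distance_two_def by blast
  then obtain k where k: "k \<in> K" "ed k = {x, y}" by auto
  have no: "\<not> (v i \<in> h \<and> v (Suc i) \<in> h')" if "1 \<le> i" "i \<le> 7" "h \<in> F - ed ` K" "h' \<in> F - ed ` K" for i h h'
    using edge_at_cases[of h i] edge_at_cases[of h' "Suc i"] that by auto
  from k(1) show False
  proof (cases rule: K_cases)
    case (spine i)
    then have "{x, y} = {v i, v (Suc i)}" using k by simp
    then show False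
      using no[OF spine(1,2) f g] no[OF spine(1,2) g f] xy by (auto simp: doubleton_eq_iff)
  next
    case (leaf i)
    then have "{x, y} = {v i, u i}" using k by simp
    then have "u i \<in> f \<or> u i \<in> g" using xy by (auto simp: doubleton_eq_iff)
    then have "{v i, u i} \<in> F - ed ` K"
      using f g leafy_thread.leaf[OF leafy_thread_axioms leaf(1)] by blast
    then show False using leaf k by auto
  qed
qed

lemma extend_coloring:
  assumes L: "\<forall>e\<in>F. infinite (L e) \<or> 5 \<le> card (L e)"
    and "strong_list_colorable (F - ed ` K) L"
  shows "strong_list_colorable F L"
proof -
  obtain c where c: "strong_edge_coloring (F - ed ` K) c" "\<forall>f\<in>F - ed ` K. c f \<in> L f"
    using assms(2) unfolding strong_list_colorable_def by blast
  define N where "N k = {f \<in> F - ed ` K. within_distance_two F (ed k) f}" for k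
  have "\<exists>B. finite B \<and> card B = Suc (caterpillar_exponents ! k) \<and> (k \<in> K \<longrightarrow> B \<subseteq> L (ed k) - c ` N k)" for k
  proof (cases "k \<in> K")
    case True
    have "finite (N k)" using finite by (simp add: N_def)
    then have "infinite (L (ed k) - c ` N k) \<or> Suc (caterpillar_exponents ! k) \<le> card (L (ed k) - c ` N k)"
      using L ed_in[OF True] card_outer_conflicts[OF True] card_image_le[of "N k" c]
      by (intro large_Diff[where n = 5]) (auto simp: N_def)
    then show ?thesis using subset_of_large by metis
  next
    case False
    \<comment> \<open>A missing leaf becomes a dummy vertex with an arbitrary list of the right
      size. Thus a single coefficient serves all patterns of leaves.\<close>
    then show ?thesis by (intro exI[of _ "{..caterpillar_exponents ! k}"]) simp
  qed
  then obtain A where A: "\<And>k. finite (A k) \<and> card (A k) = Suc (caterpillar_exponents ! k)"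
    "\<And>k. k \<in> K \<Longrightarrow> A k \<subseteq> L (ed k) - c ` N k"
    by metis
  obtain d where d: "\<forall>k<15. d k \<in> A k"
      "\<forall>i j. i < j \<and> j < 15 \<and> (j < i + 4 \<or> odd i \<and> j = i + 4) \<longrightarrow> d i \<noteq> d j"
    using caterpillar_choosable[of A, OF A(1)] by (elim exE conjE)
  define num where "num = inv_into K ed"
  have num: "num e \<in> K" "ed (num e) = e" if "e \<in> ed ` K" for e
    using that unfolding num_def by (auto simp: inv_into_into f_inv_into_f)
  have K15: "k < 15" if "k \<in> K" for k using that by (simp add: K_def)
  have dK: "d k \<in> L (ed k) - c ` N k" if "k \<in> K" for k
    using d(1) A(2)[OF that] K15[OF that] by blast
  define c' where "c' e = (if e \<in> ed ` K then d (num e) else c e)" for e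
  have inner: "d j \<noteq> d k" if "j \<in> K" "k \<in> K" "within_distance_two F (ed j) (ed k)" for j k
  proof (cases j k rule: linorder_cases)
    case less
    then show ?thesis using d(2) less K15[OF that(2)] inner_conflict[OF that(1,2) less that(3)] by blast
  next
    case equal
    then show ?thesis using that(3) by (simp add: within_distance_two_def)
  next
    case greater
    then show ?thesis
      using d(2) greater K15[OF that(1)]
        inner_conflict[OF that(2,1) greater within_distance_two_sym[OF that(3)]] by metis
  qed
  have outer: "d k \<noteq> c f" if "k \<in> K" "f \<in> F - ed ` K" "within_distance_two F (ed k) f" for k f
  proof -
    have "c f \<in> c ` N k" using that unfolding N_def by blast
    then show ?thesis using dK[OF that(1)] by auto
  qed
  have "strong_edge_coloring F c'"
    unfolding strong_edge_coloring_def
  proof (intro ballI impI)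
    fix f g assume fg: "f \<in> F" "g \<in> F" "within_distance_two F f g"
    show "c' f \<noteq> c' g"
    proof (cases "f \<in> ed ` K"; cases "g \<in> ed ` K")
      assume "f \<in> ed ` K" "g \<in> ed ` K"
      then show ?thesis using inner[of "num f" "num g"] num fg by (simp add: c'_def)
    next
      assume "f \<in> ed ` K" "g \<notin> ed ` K"
      then show ?thesis using outer[of "num f" g] num fg by (simp add: c'_def)
    next
      assume "f \<notin> ed ` K" "g \<in> ed ` K"
      then show ?thesis
        using outer[of "num g" f] num fg within_distance_two_sym[OF fg(3)] by (simp add: c'_def)
    next
      assume "f \<notin> ed ` K" "g \<notin> ed ` K"
      then show ?thesis
        using c(1) within_distance_two_rest[of f g] fg unfolding strong_edge_coloring_def
        by (simp add: c'_def)
    qed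
  qed
  moreover have "\<forall>e\<in>F. c' e \<in> L e"
    using c(2) dK num unfolding c'_def by (metis DiffD1 DiffI)
  ultimately show ?thesis unfolding strong_list_colorable_def by blast
qed

end

section \<open>Threads and minimal uncolorable graphs\<close>

lemma edges_at_eq_image:
  assumes "\<forall>e\<in>F. card e = 2"
  shows "{e \<in> F. x \<in> e} = (\<lambda>y. {x, y}) ` {y. {x, y} \<in> F}"
proof (intro set_eqI iffI)
  fix e assume e: "e \<in> {e \<in> F. x \<in> e}"
  then have "card e = 2" "x \<in> e" using assms by auto
  then obtain y where "e = {x, y}" by (rule two_edges_at)
  then show "e \<in> (\<lambda>y. {x, y}) ` {y. {x, y} \<in> F}" using e by auto
qed auto

lemma degree_eq_card_neighbors:
  assumes "\<forall>e\<in>F. card e = 2"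
  shows "degree F x = card {y. {x, y} \<in> F}"
  unfolding degree_def edges_at_eq_image[OF assms]
  by (rule card_image) (auto simp: inj_on_def doubleton_eq_iff)

lemma finite_neighbors:
  assumes "finite F" shows "finite {y. {x, y} \<in> F}"
proof -
  have "{y. {x, y} \<in> F} = (\<lambda>y. {x, y}) -` F \<inter> UNIV" by auto
  moreover have "inj_on (\<lambda>y. {x, y}) UNIV" by (auto simp: inj_on_def doubleton_eq_iff)
  ultimately show ?thesis using finite_vimage_IntI[OF assms] by metis
qed

lemma degree_mono: "finite E \<Longrightarrow> F \<subseteq> E \<Longrightarrow> degree F x \<le> degree E x"
  unfolding degree_def by (rule card_mono) auto

lemma degree_pos: "finite F \<Longrightarrow> e \<in> F \<Longrightarrow> x \<in> e \<Longrightarrow> degree F x \<noteq> 0"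
  unfolding degree_def by auto

lemma degree_1_edge: "degree F x = 1 \<Longrightarrow> e \<in> F \<Longrightarrow> x \<in> e \<Longrightarrow> {f \<in> F. x \<in> f} = {e}"
  unfolding degree_def by (erule card_1_singletonE) (metis (mono_tags, lifting) mem_Collect_eq singletonD)

definition nb_walk :: "'a set set \<Rightarrow> (nat \<Rightarrow> 'a) \<Rightarrow> nat \<Rightarrow> bool" where
  "nb_walk F v n \<longleftrightarrow> (\<forall>i<n. {v i, v (Suc i)} \<in> F) \<and> (\<forall>i. Suc i < n \<longrightarrow> v i \<noteq> v (Suc (Suc i)))"

text \<open>A walk without immediate reversal, whose vertices may repeat: this also covers short
  cycles of vertices of degree 2, so that threads can be found without any girth condition.
  Distinctness is recovered from the girth when the thread is used.\<close>

definition has_thread :: "'a set set \<Rightarrow> bool" where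
  "has_thread F \<longleftrightarrow> (\<exists>v. nb_walk F v 9 \<and> (\<forall>i\<in>{1..8}. degree F (v i) = 2))"

text \<open>Shrinking to an innermost coincidence leaves a closed segment with no other repetition.
  It has at least three edges: one edge would be a loop, and two would be an immediate
  reversal.\<close>

lemma nb_walk_cycle:
  assumes F: "\<forall>e\<in>F. card e = 2" and w: "nb_walk F v n" and "i < j" "j \<le> n" "v i = v j"
  shows "\<exists>vs. is_cycle F vs \<and> length vs \<le> j - i"
  using assms(3-)
proof (induction "j - i" arbitrary: i j rule: less_induct)
  case less
  have edge: "{v k, v (Suc k)} \<in> F" if "k < n" for k
    using w that by (simp add: nb_walk_def)
  have nb: "v k \<noteq> v (Suc (Suc k))" if "Suc k < n" for k
    using w that by (simp add: nb_walk_def)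
  show ?case
  proof (cases "\<exists>a b. i \<le> a \<and> a < b \<and> b \<le> j \<and> (a, b) \<noteq> (i, j) \<and> v a = v b")
    case True
    then obtain a b where ab: "i \<le> a" "a < b" "b \<le> j" "(a, b) \<noteq> (i, j)" "v a = v b" by blast
    then have "b - a < j - i" by auto
    with less.hyps[of b a] ab less.prems obtain vs where "is_cycle F vs" "length vs \<le> b - a"
      by auto
    then show ?thesis using \<open>b - a < j - i\<close> by (intro exI[of _ vs]) auto
  next
    case False
    have inj: "inj_on v {i..<j}"
    proof (rule linorder_inj_onI)
      fix a b assume "a < b" "a \<in> {i..<j}" "b \<in> {i..<j}"
      moreover have "\<not> (i \<le> a \<and> a < b \<and> b \<le> j \<and> (a, b) \<noteq> (i, j) \<and> v a = v b)"
        using False by blast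
      ultimately show "v a \<noteq> v b" by auto
    qed auto
    have "j \<noteq> Suc i"
    proof
      assume "j = Suc i"
      then have "card {v i, v (Suc i)} = 2" using edge[of i] F less.prems by auto
      then show False using less.prems \<open>j = Suc i\<close> by simp
    qed
    moreover have "j \<noteq> Suc (Suc i)" using nb[of i] less.prems by auto
    ultimately have len: "3 \<le> j - i" using less.prems by linarith
    have "is_cycle F (map v [i..<j])"
      unfolding is_cycle_def
    proof (intro conjI allI impI)
      show "3 \<le> length (map v [i..<j])" using len by simp
      show "distinct (map v [i..<j])" using inj by (simp add: distinct_map)
      fix k assume k: "k < length (map v [i..<j])"
      have "v (i + Suc k mod (j - i)) = v (Suc (i + k))"
      proof (cases "Suc k = j - i")
        case True
        then have "Suc (i + k) = j" by linarith
        then show ?thesis using True less.prems by simp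
      next
        case False
        then show ?thesis using k by simp
      qed
      moreover have "Suc k mod (j - i) < j - i" using len by simp
      then have "i + Suc k mod (j - i) < j" by linarith
      ultimately show "{map v [i..<j] ! k, map v [i..<j] ! (Suc k mod length (map v [i..<j]))} \<in> F"
        using edge[of "i + k"] k less.prems len by simp
    qed
    then show ?thesis by (intro exI[of _ "map v [i..<j]"]) simp
  qed
qed

lemma is_cycle_mono: "is_cycle F vs \<Longrightarrow> F \<subseteq> E \<Longrightarrow> is_cycle E vs"
  unfolding is_cycle_def by blast

text \<open>By minimality the pendant edge has at least 5 conflicts. All of them contain a neighbor
  of \<open>v\<close> other than \<open>u\<close>; there are at most two such neighbors, of degree
  at most 3 each, so there are exactly two and their degrees sum to at least 5.\<close>

lemma pendant_neighbor:
  assumes F: "\<forall>e\<in>F. card e = 2" "finite F" "\<forall>x. degree F x \<le> 3"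
    and L: "\<forall>e\<in>F. infinite (L e) \<or> 5 \<le> card (L e)"
    and not: "\<not> strong_list_colorable F L"
    and sub: "\<And>F'. F' \<subset> F \<Longrightarrow> strong_list_colorable F' L"
    and uv: "{u, v} \<in> F" "degree F u = 1"
  shows "\<exists>a b. a \<noteq> b \<and> a \<noteq> u \<and> b \<noteq> u \<and> {f \<in> F. v \<in> f} = {{v, u}, {v, a}, {v, b}} \<and>
    2 \<le> degree F a \<and> 2 \<le> degree F b"
proof -
  define W where "W = {w. {v, w} \<in> F} - {u}"
  let ?C = "{f \<in> F. within_distance_two F {u, v} f}"
  have finW: "finite W" unfolding W_def using finite_neighbors[OF F(2)] by blast
  have u: "{f \<in> F. u \<in> f} = {{u, v}}" using degree_1_edge[OF uv(2,1)] by simp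
  have cardC: "5 \<le> card ?C"
  proof (rule ccontr)
    assume "\<not> ?thesis"
    then have "card ?C \<le> 4" by simp
    then have "strong_list_colorable F L"
      using uv(1) L sub[of "F - {{u, v}}"]
      by (intro extend_to_pendant_edge[OF F(2) uv(1) u]) auto
    then show False using not by simp
  qed
  have "?C \<subseteq> (\<Union>w\<in>W. {f \<in> F. w \<in> f})"
  proof
    fix f assume f: "f \<in> ?C"
    then have ne: "f \<noteq> {u, v}" and fF: "f \<in> F" by (auto simp: within_distance_two_def)
    have uf: "u \<notin> f" using u ne fF by blast
    obtain x y where xy: "x \<in> {u, v}" "y \<in> f" "x = y \<or> {x, y} \<in> F"
      using f unfolding within_distance_two_def by blast
    have via_v: "\<exists>w\<in>W. w \<in> f" if vf: "v \<in> f"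
    proof -
      obtain w where "f = {v, w}" "w \<noteq> v" using two_edges_at[of f v] F(1) fF vf by blast
      then show ?thesis using uf fF unfolding W_def by auto
    qed
    show "f \<in> (\<Union>w\<in>W. {f \<in> F. w \<in> f})"
    proof (cases "v \<in> f")
      case True
      then show ?thesis using via_v fF by blast
    next
      case False
      then have nxy: "x \<noteq> y" using xy uf by blast
      then have xyF: "{x, y} \<in> F" using xy by blast
      have "x \<noteq> u"
      proof
        assume "x = u"
        then have "{u, y} \<in> {f \<in> F. u \<in> f}" using xyF by simp
        then have "{u, y} = {u, v}" unfolding u by simp
        then show False using False xy \<open>x = u\<close> nxy by (auto simp: doubleton_eq_iff)
      qed
      then have "y \<in> W" using xy xyF uf unfolding W_def by auto
      then show ?thesis using xy fF by blast
    qed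
  qed
  then have "card ?C \<le> card (\<Union>w\<in>W. {f \<in> F. w \<in> f})"
    using finW F(2) by (intro card_mono) auto
  also have "\<dots> \<le> (\<Sum>w\<in>W. degree F w)"
    unfolding degree_def using finW by (rule card_UN_le)
  finally have sum: "5 \<le> (\<Sum>w\<in>W. degree F w)" using cardC by linarith
  have mem: "u \<in> {w. {v, w} \<in> F}" using uv(1) by (simp add: insert_commute)
  have "card W = degree F v - 1"
    unfolding W_def degree_eq_card_neighbors[OF F(1)]
    using mem finite_neighbors[OF F(2)] by simp
  then have "card W \<le> 2" using F(3)[rule_format, of v] by linarith
  moreover have "card W \<noteq> 0" using sum finW by auto
  moreover have "card W \<noteq> 1"
  proof
    assume "card W = 1"
    then obtain w where "W = {w}" by (auto simp: card_1_singleton_iff)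
    then show False using sum F(3)[rule_format, of w] by simp
  qed
  ultimately have "card W = 2" by linarith
  then obtain a b where ab: "W = {a, b}" "a \<noteq> b" by (auto simp: card_2_iff)
  have "degree F a + degree F b \<ge> 5" using sum ab by simp
  then have "2 \<le> degree F a" "2 \<le> degree F b"
    using F(3)[rule_format, of a] F(3)[rule_format, of b] by linarith+
  moreover have "{w. {v, w} \<in> F} = {u, a, b}" using mem ab(1) unfolding W_def by auto
  then have "{f \<in> F. v \<in> f} = {{v, u}, {v, a}, {v, b}}"
    unfolding edges_at_eq_image[OF F(1)] by simp
  moreover have "a \<noteq> u" "b \<noteq> u" using ab(1) unfolding W_def by auto
  ultimately show ?thesis using ab(2) by blast
qed

section \<open>Minimal uncolorable graphs and their cores\<close>

definition graph_core :: "'a set set \<Rightarrow> 'a set set" where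
  "graph_core F = {e \<in> F. \<forall>x\<in>e. degree F x \<noteq> 1}"

locale minimal_uncolorable =
  fixes F :: "'a set set" and L :: "'a set \<Rightarrow> nat set"
  assumes card2: "\<forall>e\<in>F. card e = 2" and fin: "finite F" and deg3: "\<forall>x. degree F x \<le> 3"
    and lists: "\<forall>e\<in>F. infinite (L e) \<or> 5 \<le> card (L e)"
    and not_colorable: "\<not> strong_list_colorable F L"
    and sub_colorable: "\<And>F'. F' \<subset> F \<Longrightarrow> strong_list_colorable F' L"
begin

lemma pendant:
  assumes "{u, v} \<in> F" "degree F u = 1"
  obtains a b where "a \<noteq> b" "{f \<in> F. v \<in> f} = insert {v, u} {{v, a}, {v, b}}"
    "{{v, a}, {v, b}} = {f \<in> graph_core F. v \<in> f}"
proof -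
  obtain a b where ab: "a \<noteq> b" "a \<noteq> u" "b \<noteq> u" "{f \<in> F. v \<in> f} = {{v, u}, {v, a}, {v, b}}"
      "2 \<le> degree F a" "2 \<le> degree F b"
    using pendant_neighbor[OF card2 fin deg3 lists not_colorable sub_colorable assms] by blast
  have "degree F v = 3" unfolding degree_def ab(4) using ab(1-3) by (auto simp: card_insert_if doubleton_eq_iff)
  then have "{{v, a}, {v, b}} \<subseteq> graph_core F"
    using ab(4-) unfolding graph_core_def by auto
  moreover have "{v, u} \<notin> graph_core F" using assms by (auto simp: graph_core_def)
  moreover have "graph_core F \<subseteq> F" by (auto simp: graph_core_def)
  ultimately have eq: "{{v, a}, {v, b}} = {f \<in> graph_core F. v \<in> f}"
  proof (intro equalityI subsetI)
    fix f assume f: "f \<in> {f \<in> graph_core F. v \<in> f}"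
    then have "f \<in> {f \<in> F. v \<in> f}" using \<open>graph_core F \<subseteq> F\<close> by auto
    then show "f \<in> {{v, a}, {v, b}}" unfolding ab(4) using f \<open>{v, u} \<notin> graph_core F\<close> by auto
  qed auto
  show thesis by (rule that[OF ab(1) ab(4) eq])
qed

lemma F_nonempty: "F \<noteq> {}"
proof
  assume "F = {}"
  then have "strong_list_colorable F L"
    unfolding strong_list_colorable_def strong_edge_coloring_def by simp
  then show False using not_colorable by simp
qed

lemma core_nonempty: "graph_core F \<noteq> {}"
proof (cases "\<exists>e\<in>F. \<exists>x\<in>e. degree F x = 1")
  case True
  then obtain e u where e: "e \<in> F" "u \<in> e" "degree F u = 1" by blast
  then obtain v where "e = {u, v}" using two_edges_at[of e u] card2 by blast
  then have "{u, v} \<in> F" using e by simp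
  then obtain a b where "{{v, a}, {v, b}} = {f \<in> graph_core F. v \<in> f}"
    using e(3) by (rule pendant)
  then have "{v, a} \<in> {f \<in> graph_core F. v \<in> f}" by blast
  then show ?thesis by auto
next
  case False
  then show ?thesis using F_nonempty by (auto simp: graph_core_def)
qed

text \<open>Deleting all pendant edges creates no new ones: by \<open>pendant\<close>, a vertex that
  loses an edge loses only this one and keeps exactly two. The second claim supplies the single leaf
  per inner vertex required by \<open>leafy_thread\<close>.\<close>

lemma core_edges_at:
  assumes "x \<in> \<Union> (graph_core F)"
  shows "2 \<le> degree (graph_core F) x"
    and "{e \<in> F. x \<in> e} = {e \<in> graph_core F. x \<in> e} \<or>
      (\<exists>u. degree F u = 1 \<and> {e \<in> F. x \<in> e} = insert {x, u} {e \<in> graph_core F. x \<in> e})"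
proof -
  obtain e where e: "e \<in> graph_core F" "x \<in> e" using assms by blast
  then have d1: "degree F x \<noteq> 1" by (auto simp: graph_core_def)
  have d0: "degree F x \<noteq> 0" using e degree_pos[OF fin] by (auto simp: graph_core_def)
  have "2 \<le> degree (graph_core F) x \<and> ({e \<in> F. x \<in> e} = {e \<in> graph_core F. x \<in> e} \<or>
      (\<exists>u. degree F u = 1 \<and> {e \<in> F. x \<in> e} = insert {x, u} {e \<in> graph_core F. x \<in> e}))"
  proof (cases "\<exists>u. {x, u} \<in> F \<and> degree F u = 1")
    case True
    then obtain u where u: "{u, x} \<in> F" "degree F u = 1" by (auto simp: insert_commute)
    then obtain a b where ab: "a \<noteq> b" "{f \<in> F. x \<in> f} = insert {x, u} {{x, a}, {x, b}}"
        "{{x, a}, {x, b}} = {f \<in> graph_core F. x \<in> f}"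
      by (rule pendant)
    have "degree (graph_core F) x = 2"
      unfolding degree_def ab(3)[symmetric] using ab(1) by (auto simp: card_insert_if doubleton_eq_iff)
    then show ?thesis using u(2) ab(2,3) by auto
  next
    case False
    have eq: "{e \<in> F. x \<in> e} = {e \<in> graph_core F. x \<in> e}"
    proof (intro set_eqI iffI)
      fix f assume f: "f \<in> {e \<in> F. x \<in> e}"
      then obtain y where y: "f = {x, y}" using two_edges_at[of f x] card2 by blast
      then show "f \<in> {e \<in> graph_core F. x \<in> e}" using f False d1 by (auto simp: graph_core_def)
    qed (auto simp: graph_core_def)
    then have "degree (graph_core F) x = degree F x" by (simp add: degree_def)
    then show ?thesis using eq d0 d1 by linarith
  qed
  then show "2 \<le> degree (graph_core F) x"
    and "{e \<in> F. x \<in> e} = {e \<in> graph_core F. x \<in> e} \<or>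
      (\<exists>u. degree F u = 1 \<and> {e \<in> F. x \<in> e} = insert {x, u} {e \<in> graph_core F. x \<in> e})"
    by blast+
qed

lemma no_thread_in_core:
  assumes girth: "\<And>vs. is_cycle (graph_core F) vs \<Longrightarrow> 9 \<le> length vs"
  shows "\<not> has_thread (graph_core F)"
proof
  let ?G = "graph_core F"
  assume "has_thread ?G"
  then obtain v where w: "nb_walk ?G v 9" and d2: "\<forall>i\<in>{1..8}. degree ?G (v i) = 2"
    unfolding has_thread_def by blast
  have sub: "?G \<subseteq> F" by (auto simp: graph_core_def)
  then have finG: "finite ?G" and card2G: "\<forall>e\<in>?G. card e = 2"
    using fin card2 finite_subset by blast+
  have edge: "{v i, v (Suc i)} \<in> ?G" if "i \<le> 8" for i using w that by (simp add: nb_walk_def)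
  have nb: "v i \<noteq> v (Suc (Suc i))" if "i \<le> 7" for i using w that by (simp add: nb_walk_def)
  \<comment> \<open>A coincidence would close a cycle of length at most j - i < 9. The pair (0, 9)
    is left out.\<close>
  have dist: "v i \<noteq> v j" if "i < j" "j \<le> 9" "j < i + 9" for i j
    using nb_walk_cycle[OF card2G w that(1,2)] girth that by fastforce
  have inG: "v i \<in> \<Union> ?G" if "i \<le> 9" for i
  proof (cases "i = 9")
    case True
    then show ?thesis using edge[of 8] by auto
  next
    case False
    then show ?thesis using edge[of i] that by auto
  qed
  have degv: "degree F (v i) \<noteq> 1" if "i \<le> 9" for i
    using inG[OF that] by (auto simp: graph_core_def)
  define I where "I = {i \<in> {1..8}. \<exists>u. degree F u = 1 \<and>
    {e \<in> F. v i \<in> e} = insert {v i, u} {e \<in> ?G. v i \<in> e}}"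
  have "\<forall>i\<in>I. \<exists>u. degree F u = 1 \<and> {e \<in> F. v i \<in> e} = insert {v i, u} {e \<in> ?G. v i \<in> e}"
    by (auto simp: I_def)
  then obtain u where u: "\<forall>i\<in>I. degree F (u i) = 1 \<and>
      {e \<in> F. v i \<in> e} = insert {v i, u i} {e \<in> ?G. v i \<in> e}"
    by metis
  have core_at: "{e \<in> ?G. v i \<in> e} = {{v (i - 1), v i}, {v i, v (Suc i)}}" if "1 \<le> i" "i \<le> 8" for i
  proof (rule sym, rule card_seteq)
    show "finite {e \<in> ?G. v i \<in> e}" using finG by simp
    show "{{v (i - 1), v i}, {v i, v (Suc i)}} \<subseteq> {e \<in> ?G. v i \<in> e}"
      using edge[of "i - 1"] edge[of i] that by auto
    have "v (i - 1) \<noteq> v (Suc i)" using nb[of "i - 1"] that by simp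
    then have "card {{v (i - 1), v i}, {v i, v (Suc i)}} = 2"
      by (auto simp: card_insert_if doubleton_eq_iff)
    then show "card {e \<in> ?G. v i \<in> e} \<le> card {{v (i - 1), v i}, {v i, v (Suc i)}}"
      using d2 that by (simp add: degree_def)
  qed
  interpret leafy_thread F v u I
  proof
    show "inj_on v {0..8}"
      by (rule linorder_inj_onI) (use dist in auto)
    show "inj_on v {1..9}"
      by (rule linorder_inj_onI) (use dist in auto)
    show "{v i, v (Suc i)} \<in> F" if "i \<le> 8" for i using edge[OF that] sub by blast
    show "{e \<in> F. v i \<in> e} = {{v (i - 1), v i}, {v i, v (Suc i)}} \<union> (if i \<in> I then {{v i, u i}} else {})"
      if "1 \<le> i" "i \<le> 8" for i
    proof (cases "i \<in> I")
      case True
      then show ?thesis using u core_at[OF that] by auto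
    next
      case False
      have "{e \<in> F. v i \<in> e} = {e \<in> ?G. v i \<in> e}"
        using core_edges_at(2)[OF inG[of i]] False that unfolding I_def by auto
      then show ?thesis using False core_at[OF that] by simp
    qed
    show "{e \<in> F. u i \<in> e} = {{v i, u i}}" if "i \<in> I" for i
    proof -
      have "{v i, u i} \<in> {e \<in> F. v i \<in> e}" using u that by blast
      then show ?thesis using u that by (intro degree_1_edge) auto
    qed
    show "1 \<le> i \<and> i \<le> 8 \<and> u i \<notin> v ` {0..9}" if "i \<in> I" for i
    proof (intro conjI notI)
      show "1 \<le> i" "i \<le> 8" using that by (auto simp: I_def)
      assume "u i \<in> v ` {0..9}"
      then obtain j where "u i = v j" "j \<le> 9" by auto
      then show False using u that degv[of j] by auto
    qed
    show "finite F" by (rule fin)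
    show "degree F (v 0) \<le> 3" "degree F (v 9) \<le> 3" using deg3 by auto
  qed
  have "1 \<in> K" by (simp add: K_def)
  then have "F - ed ` K \<subset> F" using ed_in[of 1] by blast
  then have "strong_list_colorable F L"
    by (intro extend_coloring lists sub_colorable)
  then show False using not_colorable by simp
qed

end

text \<open>The common frame of both parts of the theorem, which differ only in how a thread is
  found. All edge subsets of \<open>E\<close> are treated by induction with the lists fixed; a
  smallest uncolorable subset would have a nonempty core with degrees 2 and 3, and the thread in it
  is reducible.\<close>

theorem strong_list_colorable_if_threads:
  assumes E: "\<forall>e\<in>E. card e = 2" "finite E" "\<forall>x. degree E x \<le> 3"
    and girth: "\<And>vs. is_cycle E vs \<Longrightarrow> 9 \<le> length vs"
    and threads: "\<And>G. G \<subseteq> E \<Longrightarrow> G \<noteq> {} \<Longrightarrow> \<forall>x\<in>\<Union> G. degree G x \<in> {2, 3} \<Longrightarrow> has_thread G"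
    and L: "\<forall>e\<in>E. infinite (L e) \<or> 5 \<le> card (L e)"
  shows "strong_list_colorable E L"
proof -
  have "strong_list_colorable F L" if "F \<subseteq> E" for F
    using that
  proof (induction "card F" arbitrary: F rule: less_induct)
    case less
    have fin: "finite F" using less.prems E(2) finite_subset by blast
    show ?case
    proof (rule ccontr)
      assume not: "\<not> ?case"
      interpret minimal_uncolorable F L
      proof
        show "\<forall>e\<in>F. card e = 2" "\<forall>e\<in>F. infinite (L e) \<or> 5 \<le> card (L e)"
          using E(1) L less.prems by auto
        show "\<forall>x. degree F x \<le> 3" using degree_mono[OF E(2) less.prems] E(3) le_trans by blast
        show "strong_list_colorable F' L" if "F' \<subset> F" for F'
          using that less.prems fin by (intro less.hyps) (auto simp: psubset_card_mono)
      qed (use fin not in auto)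
      have sub: "graph_core F \<subseteq> F" by (auto simp: graph_core_def)
      have "degree (graph_core F) x \<in> {2, 3}" if "x \<in> \<Union> (graph_core F)" for x
        using core_edges_at(1)[OF that] degree_mono[OF fin sub, of x] deg3[rule_format, of x] by auto
      then have "has_thread (graph_core F)"
        using sub less.prems core_nonempty by (intro threads) auto
      moreover have "\<not> has_thread (graph_core F)"
        using girth is_cycle_mono sub less.prems by (intro no_thread_in_core) blast
      ultimately show False by simp
    qed
  qed
  then show ?thesis by simp
qed

section \<open>Sparse graphs contain long threads\<close>

lemma card_darts:
  assumes F: "\<forall>e\<in>F. card e = 2" "finite F" and "finite S"
  shows "card {(x, y). {x, y} \<in> F \<and> x \<in> S} = (\<Sum>x\<in>S. degree F x)"
proof -
  have "{(x, y). {x, y} \<in> F \<and> x \<in> S} = (SIGMA x:S. {y. {x, y} \<in> F})" by auto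
  then show ?thesis
    using finite_neighbors[OF F(2)] \<open>finite S\<close>
    by (simp add: card_SigmaI degree_eq_card_neighbors[OF F(1)])
qed

lemma finite_Union_edges:
  assumes "\<forall>e\<in>F. card e = 2" "finite F" shows "finite (\<Union> F)"
  using assms by (intro finite_Union) (auto intro: card_ge_0_finite)

lemma handshake:
  assumes F: "\<forall>e\<in>F. card e = 2" "finite F"
  shows "(\<Sum>x\<in>\<Union> F. degree F x) = 2 * card F"
proof -
  have "(\<Sum>x\<in>\<Union> F. degree F x) = (\<Sum>x\<in>\<Union> F. \<Sum>e\<in>F. if x \<in> e then 1 else 0)"
    unfolding degree_def using F(2) by (intro sum.cong refl) (simp add: sum.If_cases Int_def)
  also have "\<dots> = (\<Sum>e\<in>F. \<Sum>x\<in>\<Union> F. if x \<in> e then 1 else 0)"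
    by (rule sum.swap)
  also have "\<dots> = (\<Sum>e\<in>F. 2)"
  proof (rule sum.cong[OF refl])
    fix e assume "e \<in> F"
    then have "\<Union> F \<inter> {x. x \<in> e} = e" by auto
    then show "(\<Sum>x\<in>\<Union> F. if x \<in> e then 1 else 0) = (2 :: nat)"
      using F(1) \<open>e \<in> F\<close> finite_Union_edges[OF F] by (simp add: sum.If_cases)
  qed
  finally show ?thesis by simp
qed

lemma card_2_eq: "card N = 2 \<Longrightarrow> a \<in> N \<Longrightarrow> b \<in> N \<Longrightarrow> a \<noteq> b \<Longrightarrow> N = {a, b}"
  by (auto simp: card_2_iff)

lemma other_neighbor:
  assumes F: "\<forall>e\<in>F. card e = 2" and d: "2 \<le> degree F x" and y: "{x, y} \<in> F"
  obtains z where "{x, z} \<in> F" "z \<noteq> y"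
proof -
  have "2 \<le> card {y. {x, y} \<in> F}" using d by (simp add: degree_eq_card_neighbors[OF F])
  then have "{y. {x, y} \<in> F} \<noteq> {y}" by auto
  then show thesis using that y by blast
qed

lemma nb_walk_append:
  assumes F: "\<forall>e\<in>F. card e = 2" and w: "nb_walk F v (Suc n)" and d: "2 \<le> degree F (v (Suc n))"
  obtains z where "nb_walk F (v(Suc (Suc n) := z)) (Suc (Suc n))"
proof -
  have "{v (Suc n), v n} \<in> F" using w by (auto simp: nb_walk_def insert_commute)
  then obtain z where "{v (Suc n), z} \<in> F" "z \<noteq> v n"
    using other_neighbor[OF F d] by blast
  then have "nb_walk F (v(Suc (Suc n) := z)) (Suc (Suc n))"
    using w by (auto simp: nb_walk_def less_Suc_eq)
  then show thesis by (rule that)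
qed

lemma nb_walk_prepend:
  assumes F: "\<forall>e\<in>F. card e = 2" and w: "nb_walk F v (Suc n)" and d: "2 \<le> degree F (v 0)"
  obtains t where "nb_walk F (case_nat t v) (Suc (Suc n))"
proof -
  have "{v 0, v 1} \<in> F" using w by (auto simp: nb_walk_def)
  then obtain t where t: "{v 0, t} \<in> F" "t \<noteq> v 1"
    using other_neighbor[OF F d] by blast
  have "nb_walk F (case_nat t v) (Suc (Suc n))"
    unfolding nb_walk_def
  proof (intro conjI allI impI)
    fix i
    show "{case_nat t v i, case_nat t v (Suc i)} \<in> F" if "i < Suc (Suc n)"
      using that t w by (cases i) (auto simp: nb_walk_def insert_commute)
    show "case_nat t v i \<noteq> case_nat t v (Suc (Suc i))" if "Suc i < Suc (Suc n)"
      using that t w by (cases i) (auto simp: nb_walk_def)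
  qed
  then show thesis by (rule that)
qed

text \<open>Each dart with head of degree 2 is reached by walking along a thread from a vertex of degree
  3. Without long threads, at most 7 darts are reached from each dart leaving such a vertex.\<close>

lemma sparse_core_bound:
  assumes F: "\<forall>e\<in>F. card e = 2" "finite F" and deg: "\<forall>x\<in>\<Union> F. degree F x \<in> {2, 3}"
    and no: "\<not> has_thread F"
  shows "2 * card {x \<in> \<Union> F. degree F x = 2} \<le> 21 * card {x \<in> \<Union> F. degree F x = 3}"
proof -
  let ?V2 = "{x \<in> \<Union> F. degree F x = 2}" and ?V3 = "{x \<in> \<Union> F. degree F x = 3}"
  define D2 where "D2 = {(y, x). {x, y} \<in> F \<and> x \<in> ?V2}"
  define D3 where "D3 = {(x, y). {x, y} \<in> F \<and> x \<in> ?V3}"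
  \<comment> \<open>One step along the walk, forced if the head of the dart has degree 2. At other
    heads any choice will do, since the iterated images of \<open>D3\<close> are only
    counted.\<close>
  define nxt where "nxt = (\<lambda>(x, y). (y, SOME z. {y, z} \<in> F \<and> z \<noteq> x))"
  have fin: "finite ?V2" "finite ?V3"
    by (rule finite_subset[OF _ finite_Union_edges[OF F]], blast)+
  have nxt_walk: "nxt (v i, v (Suc i)) = (v (Suc i), v (Suc (Suc i)))"
    if w: "nb_walk F v n" and i: "Suc i < n" and d: "degree F (v (Suc i)) = 2" for v i n
  proof -
    let ?N = "{y. {v (Suc i), y} \<in> F}"
    have "card ?N = 2" using d degree_eq_card_neighbors[OF F(1)] by metis
    moreover have "v i \<in> ?N" "v (Suc (Suc i)) \<in> ?N" "v i \<noteq> v (Suc (Suc i))"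
      using w i by (auto simp: nb_walk_def insert_commute)
    ultimately have "?N = {v i, v (Suc (Suc i))}" by (intro card_2_eq)
    then have "(SOME z. {v (Suc i), z} \<in> F \<and> z \<noteq> v i) = v (Suc (Suc i))"
      using \<open>v i \<noteq> v (Suc (Suc i))\<close> by (intro some_equality) auto
    then show ?thesis by (simp add: nxt_def)
  qed
  have iter: "(nxt ^^ m) (v 0, v (Suc 0)) = (v m, v (Suc m))"
    if w: "nb_walk F v n" and m: "m < n" and d: "\<forall>i\<in>{1..m}. degree F (v i) = 2" for v m n
    using m d
  proof (induction m)
    case (Suc m)
    then show ?case using nxt_walk[OF w, of m] by simp
  qed simp
  have cover: "d \<in> (\<Union>m<7. (nxt ^^ m) ` D3)" if d: "d \<in> D2" for d
  proof (rule ccontr)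
    assume "d \<notin> (\<Union>m<7. (nxt ^^ m) ` D3)"
    then have nc: "d \<noteq> (nxt ^^ m) s" if "m < 7" "s \<in> D3" for m s
      using that by (auto simp del: funpow.simps)
    \<comment> \<open>The dart \<open>d\<close> is traced backwards. A tail of degree 3 would put
      \<open>d\<close> into the image of \<open>D3\<close> under the corresponding power of
      \<open>nxt\<close>, so each vertex reached has degree 2.\<close>
    have "\<exists>v. nb_walk F v (Suc m) \<and> (\<forall>i\<le>Suc m. degree F (v i) = 2) \<and> d = (v m, v (Suc m))"
      if "m \<le> 6" for m
      using that
    proof (induction m)
      case 0
      obtain y x where yx: "d = (y, x)" "{x, y} \<in> F" "degree F x = 2" using d by (auto simp: D2_def)
      have "degree F y = 2"
      proof (rule ccontr)
        assume "degree F y \<noteq> 2"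
        then have "d \<in> D3" using yx deg unfolding D3_def by (auto simp: insert_commute)
        then show False using nc[of 0 d] by simp
      qed
      then show ?case using yx
        by (intro exI[of _ "case_nat y (\<lambda>_. x)"]) (auto simp: nb_walk_def insert_commute le_Suc_eq)
    next
      case (Suc m)
      then obtain v where v: "nb_walk F v (Suc m)" "\<forall>i\<le>Suc m. degree F (v i) = 2" "d = (v m, v (Suc m))"
        by auto
      obtain t where t: "nb_walk F (case_nat t v) (Suc (Suc m))"
        using nb_walk_prepend[OF F(1) v(1)] v(2) by auto
      then have tF: "{t, v 0} \<in> F" by (auto simp: nb_walk_def)
      have "degree F t = 2"
      proof (rule ccontr)
        assume "degree F t \<noteq> 2"
        then have "(t, v 0) \<in> D3" using tF deg unfolding D3_def by auto
        moreover have d2: "degree F (case_nat t v i) = 2" if "i \<in> {1..Suc m}" for i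
          using that v(2) by (cases i) auto
        have "d = (nxt ^^ Suc m) (t, v 0)"
          using iter[OF t, of "Suc m"] d2 v(3) by simp
        ultimately show False using nc[of "Suc m" "(t, v 0)"] Suc.prems by (simp del: funpow.simps)
      qed
      then show ?case using t v(2,3)
        by (intro exI[of _ "case_nat t v"]) (auto split: nat.splits)
    qed
    \<comment> \<open>The seven excluded powers yield eight vertices of degree 2; one more edge at
      each end makes them the inner vertices of a walk of length 9.\<close>
    from this[of 6] obtain v where v: "nb_walk F v 7" "\<forall>i\<le>7. degree F (v i) = 2"
      by auto
    obtain z where z: "nb_walk F (v(8 := z)) 8"
      using nb_walk_append[OF F(1), of v 6] v by auto
    obtain t where t: "nb_walk F (case_nat t (v(8 := z))) 9"
      using nb_walk_prepend[OF F(1), of "v(8 := z)" 7] z v(2) by auto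
    have "degree F (case_nat t (v(8 := z)) i) = 2" if "i \<in> {1..8}" for i
      using that v(2) by (cases i) auto
    then show False using no t unfolding has_thread_def by blast
  qed
  have swap: "D2 = prod.swap ` {(x, y). {x, y} \<in> F \<and> x \<in> ?V2}" by (auto simp: D2_def)
  have "2 * card ?V2 = (\<Sum>x\<in>?V2. degree F x)" by simp
  also have "\<dots> = card {(x, y). {x, y} \<in> F \<and> x \<in> ?V2}" by (rule card_darts[OF F fin(1), symmetric])
  also have "\<dots> = card D2" unfolding swap by (simp add: card_image)
  also have "\<dots> \<le> card (\<Union>m<7. (nxt ^^ m) ` D3)"
  proof (rule card_mono)
    have "D3 \<subseteq> \<Union> F \<times> \<Union> F" by (auto simp: D3_def)
    then have "finite D3" using finite_Union_edges[OF F] finite_subset by blast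
    then show "finite (\<Union>m<7. (nxt ^^ m) ` D3)" by simp
  qed (use cover in blast)
  also have "\<dots> \<le> (\<Sum>m<7::nat. card ((nxt ^^ m) ` D3))" by (rule card_UN_le) simp
  also have "\<dots> \<le> (\<Sum>m<7::nat. card D3)"
  proof (rule sum_mono)
    have "D3 \<subseteq> \<Union> F \<times> \<Union> F" by (auto simp: D3_def)
    then have "finite D3" using finite_Union_edges[OF F] finite_subset by blast
    then show "card ((nxt ^^ m) ` D3) \<le> card D3" for m by (rule card_image_le)
  qed
  also have "\<dots> = 7 * card D3" by simp
  also have "card D3 = (\<Sum>x\<in>?V3. degree F x)" unfolding D3_def by (rule card_darts[OF F fin(2)])
  also have "\<dots> = 3 * card ?V3" by simp
  finally show ?thesis by simp
qed

lemma mad_ge: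
  assumes "simple_graph V E" "subgraph W F V E" "W \<noteq> {}"
  shows "2 * real (card F) / real (card W) \<le> mad V E"
  unfolding mad_def using assms finite_subgraph_densities[OF assms(1)] by (intro Max_ge) auto

lemma has_thread_if_sparse:
  assumes G: "simple_graph V E" and mad: "mad V E < 2 + 2 / 23"
    and F: "F \<subseteq> E" "F \<noteq> {}" and deg: "\<forall>x\<in>\<Union> F. degree F x \<in> {2, 3}"
  shows "has_thread F"
proof (rule ccontr)
  assume no: "\<not> has_thread F"
  have F2: "\<forall>e\<in>F. card e = 2" "finite F"
    using G F(1) finite_edges[OF G] finite_subset by (auto simp: simple_graph_def)
  let ?V2 = "{x \<in> \<Union> F. degree F x = 2}" and ?V3 = "{x \<in> \<Union> F. degree F x = 3}"
  have finV: "finite (\<Union> F)" by (rule finite_Union_edges[OF F2])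
  have U: "\<Union> F = ?V2 \<union> ?V3" using deg by blast
  have disj: "?V2 \<inter> ?V3 = {}" by auto
  have fin: "finite ?V2" "finite ?V3" by (rule finite_subset[OF _ finV], blast)+
  have cardU: "card (\<Union> F) = card ?V2 + card ?V3"
    by (subst U) (rule card_Un_disjoint[OF fin disj])
  have "2 * card F = (\<Sum>x\<in>\<Union> F. degree F x)" by (rule handshake[OF F2, symmetric])
  also have "\<dots> = (\<Sum>x\<in>?V2 \<union> ?V3. degree F x)" by (rule sum.cong[OF U refl])
  also have "\<dots> = (\<Sum>x\<in>?V2. degree F x) + (\<Sum>x\<in>?V3. degree F x)"
    by (rule sum.union_disjoint[OF fin disj])
  finally have cardF: "2 * card F = 2 * card ?V2 + 3 * card ?V3" by simp
  have bound: "2 * card ?V2 \<le> 21 * card ?V3" by (rule sparse_core_bound[OF F2 deg no])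
  have "\<exists>x. x \<in> \<Union> F" using F(2) F2(1) by (metis UnionI card.empty ex_in_conv zero_neq_numeral)
  then have ne: "\<Union> F \<noteq> {}" by blast
  then have pos: "0 < card (\<Union> F)" using finV by (simp add: card_gt_0_iff)
  have "subgraph (\<Union> F) F V E"
    using G F(1) F2(1) finV unfolding subgraph_def simple_graph_def by blast
  then have "2 * real (card F) / real (card (\<Union> F)) \<le> mad V E"
    by (rule mad_ge[OF G _ ne])
  then have "2 * real (card F) / real (card (\<Union> F)) < 2 + 2 / 23" using mad by (rule le_less_trans)
  then have lt: "2 * real (card F) < (2 + 2 / 23) * real (card (\<Union> F))"
    using pos by (subst (asm) pos_divide_less_eq) auto
  have "2 * real (card F) = 2 * real (card ?V2) + 3 * real (card ?V3)"
    using cardF by linarith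
  moreover have "2 * real (card ?V2) \<le> 21 * real (card ?V3)" using bound by linarith
  \<comment> \<open>With a and b vertices of degree 2 and 3, 23 (2a + 3b) - 48 (a + b) = 21b - 2a
    \<ge> 0.\<close>
  ultimately show False using lt unfolding cardU by (simp add: algebra_simps)
qed

section \<open>Theta curves\<close>

definition jordan_curve :: "complex set \<Rightarrow> bool" where
  "jordan_curve K \<longleftrightarrow> (\<exists>g. simple_path g \<and> pathfinish g = pathstart g \<and> path_image g = K)"

text \<open>The two components are kept as an unordered pair, so that splitting and induction treat
  the bounded and the unbounded one alike.\<close>

definition sides :: "complex set \<Rightarrow> complex set set" where
  "sides K = {inside K, outside K}"

lemma jordan_curve_sides:
  assumes "jordan_curve K"
  shows "open (inside K)" "open (outside K)" "connected (inside K)" "connected (outside K)"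
    "inside K \<noteq> {}" "outside K \<noteq> {}" "bounded (inside K)" "\<not> bounded (outside K)"
    "inside K \<inter> outside K = {}" "inside K \<union> outside K = - K"
    "frontier (inside K) = K" "frontier (outside K) = K"
  using assms Jordan_inside_outside unfolding jordan_curve_def by blast+

lemma side_facts:
  assumes "jordan_curve K" "R \<in> sides K"
  shows "open R" "connected R" "R \<noteq> {}" "R \<inter> K = {}" "closure R \<subseteq> R \<union> K"
proof -
  note J = jordan_curve_sides[OF assms(1)]
  show "open R" "connected R" "R \<noteq> {}" using assms(2) J by (auto simp: sides_def)
  have "inside K \<inter> K = {}" "outside K \<inter> K = {}" using J(10) by blast+
  then show "R \<inter> K = {}" using assms(2) unfolding sides_def by blast
  have "frontier R = K" using assms(2) J by (auto simp: sides_def)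
  then show "closure R \<subseteq> R \<union> K" using closure_Un_frontier[of R] by auto
qed

lemma connected_in_side:
  assumes "jordan_curve K" "R \<in> sides K" "connected S" "S \<inter> K = {}" "S \<inter> R \<noteq> {}"
  shows "S \<subseteq> R"
proof -
  note J = jordan_curve_sides[OF assms(1)]
  have "S \<subseteq> inside K \<union> outside K" using assms(4) J(10) by auto
  then have "inside K \<inter> S = {} \<or> outside K \<inter> S = {}"
    using J assms(3) by (intro connectedD) auto
  then show ?thesis using assms(2,5) \<open>S \<subseteq> inside K \<union> outside K\<close> unfolding sides_def by blast
qed

section \<open>Exchanging the sides of a curve by inversion\<close>

lemma jordan_curve_inversion:
  assumes "jordan_curve K" "w \<notin> K"
  shows "jordan_curve ((\<lambda>z. inverse (z - w)) ` K)"
proof -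
  obtain g where g: "simple_path g" "pathfinish g = pathstart g" "path_image g = K"
    using assms(1) unfolding jordan_curve_def by blast
  have "simple_path ((\<lambda>z. inverse (z - w)) \<circ> g)"
    using assms(2) g by (intro simple_path_continuous_image)
      (auto intro!: continuous_intros simp: inj_on_def)
  then show ?thesis
    unfolding jordan_curve_def using g
    by (intro exI[of _ "(\<lambda>z. inverse (z - w)) \<circ> g"])
      (auto simp: path_image_compose pathfinish_compose pathstart_compose)
qed

text \<open>Inversion at \<open>w\<close> sends points near \<open>w\<close> to infinity, so the
  side \<open>P\<close> containing \<open>w\<close> goes to the outside and the other side
  \<open>Q\<close> to the inside. This makes any chosen side a bounded one.\<close>

lemma inversion_side:
  assumes K: "jordan_curve K" and w: "w \<in> P" "sides K = {P, Q}"
  shows "{z. z \<noteq> w \<and> inverse (z - w) \<in> inside ((\<lambda>z. inverse (z - w)) ` K)} = Q"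
proof -
  define f where "f = (\<lambda>z. inverse (z - w))"
  have P: "P \<in> sides K" and Q: "Q \<in> sides K" using w by auto
  note J = jordan_curve_sides[OF K]
  have PQ: "P \<inter> Q = {}" "P \<union> Q = - K"
  proof -
    have "P = inside K \<and> Q = outside K \<or> P = outside K \<and> Q = inside K"
      using w(2) unfolding sides_def by (metis doubleton_eq_iff)
    then show "P \<inter> Q = {}" "P \<union> Q = - K"
      using J(9,10) by (metis Int_commute, metis Un_commute)
  qed
  have wK: "w \<notin> K" using w(1) PQ by blast
  have K': "jordan_curve (f ` K)" unfolding f_def by (rule jordan_curve_inversion[OF K wK])
  note J' = jordan_curve_sides[OF K']
  have inj: "f x = f y \<Longrightarrow> x = y" for x y by (simp add: f_def)
  have cont: "continuous_on (- {w}) f"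
    unfolding f_def by (auto intro!: continuous_intros)
  have out: "f ` (P - {w}) \<subseteq> outside (f ` K)"
  proof -
    have conn: "connected (f ` (P - {w}))"
    proof (rule connected_continuous_image)
      show "continuous_on (P - {w}) f" using cont by (rule continuous_on_subset) auto
      show "connected (P - {w})"
        using side_facts[OF K P] by (intro connected_open_delete) auto
    qed
    have disj: "f ` (P - {w}) \<inter> f ` K = {}" using PQ inj by blast
    have "\<not> f ` (P - {w}) \<subseteq> inside (f ` K)"
    proof
      assume "f ` (P - {w}) \<subseteq> inside (f ` K)"
      then have "bounded (f ` (P - {w}))" using J'(7) bounded_subset by blast
      then obtain M where M: "0 < M" "\<forall>z\<in>P - {w}. norm (f z) \<le> M"
        unfolding bounded_pos by auto
      obtain e where e: "0 < e" "ball w e \<subseteq> P"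
        using side_facts(1)[OF K P] w(1) open_contains_ball by blast
      \<comment> \<open>Small enough for w + d to stay in \<open>P\<close> and for its image, of
        norm 1 / d, to exceed the bound \<open>M\<close>.\<close>
      define d where "d = min (e / 2) (1 / (M + 1))"
      have d: "0 < d" "d < e" "d \<le> 1 / (M + 1)" using e M by (auto simp: d_def)
      have "w + of_real d \<in> P - {w}" using d e(2) by (auto simp: dist_norm subset_iff)
      then have "norm (f (w + of_real d)) \<le> M" using M by blast
      moreover have "norm (f (w + of_real d)) = 1 / d"
        using d by (simp add: f_def norm_inverse norm_divide inverse_eq_divide)
      moreover have "M + 1 \<le> 1 / d" using d M by (simp add: field_simps)
      ultimately show False by simp
    qed
    then have "f ` (P - {w}) \<inter> outside (f ` K) \<noteq> {}" using disj J'(10) by blast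
    then show ?thesis
      using connected_in_side[OF K' _ conn disj] by (simp add: sides_def)
  qed
  \<comment> \<open>The value 0 corresponds to the point at infinity and has no preimage apart from
    \<open>w\<close>; an open set contains another point.\<close>
  have "inside (f ` K) \<noteq> {0}" using J'(1) not_open_singleton by metis
  then obtain y where y: "y \<in> inside (f ` K)" "y \<noteq> 0" using J'(5) by auto
  define z where "z = w + inverse y"
  have z: "f z = y" "z \<noteq> w" using y by (auto simp: f_def z_def)
  have "f z \<notin> f ` K" using y(1) z(1) J'(10) by blast
  then have "z \<notin> K" by blast
  moreover have "z \<notin> P" using out z y J'(9) by blast
  ultimately have "z \<in> Q" using PQ by blast
  have "f ` Q \<subseteq> inside (f ` K)"
  proof (rule connected_in_side[OF K'])
    show "connected (f ` Q)"
      using side_facts[OF K Q] PQ w(1) by (intro connected_continuous_image continuous_on_subset[OF cont]) auto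
    show "f ` Q \<inter> f ` K = {}" using PQ inj by blast
    show "f ` Q \<inter> inside (f ` K) \<noteq> {}" using \<open>z \<in> Q\<close> y z by blast
  qed (simp add: sides_def)
  then have "{z. z \<noteq> w \<and> f z \<in> inside (f ` K)} = Q"
  proof (intro equalityI subsetI)
    fix z assume z: "z \<in> {z. z \<noteq> w \<and> f z \<in> inside (f ` K)}"
    then have "f z \<notin> f ` K" "f z \<notin> outside (f ` K)" using J'(9,10) by blast+
    then have "z \<notin> K" "z \<notin> P" using out z by blast+
    then show "z \<in> Q" using PQ by blast
  next
    fix z assume "z \<in> Q"
    moreover have "z \<noteq> w" using \<open>z \<in> Q\<close> w(1) PQ by blast
    ultimately show "z \<in> {z. z \<noteq> w \<and> f z \<in> inside (f ` K)}"
      using \<open>f ` Q \<subseteq> inside (f ` K)\<close> by blast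
  qed
  then show ?thesis by (simp add: f_def)
qed

section \<open>Splitting either side of a curve by an arc\<close>

locale theta_curve =
  fixes c1 c2 c :: "real \<Rightarrow> complex" and a b :: complex
  assumes arcs: "arc c1" "arc c2" "arc c"
    and ends: "pathstart c1 = a" "pathfinish c1 = b" "pathstart c2 = a" "pathfinish c2 = b"
      "pathstart c = a" "pathfinish c = b"
    and meet: "path_image c1 \<inter> path_image c2 = {a, b}" "path_image c1 \<inter> path_image c = {a, b}"
      "path_image c2 \<inter> path_image c = {a, b}"

lemma jordan_curve_two_arcs:
  assumes "arc c1" "arc c2" "pathstart c1 = a" "pathfinish c1 = b" "pathstart c2 = a" "pathfinish c2 = b"
    "path_image c1 \<inter> path_image c2 = {a, b}"
  shows "jordan_curve (path_image c1 \<union> path_image c2)"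
  unfolding jordan_curve_def
  using assms by (intro exI[of _ "c1 +++ reversepath c2"])
    (auto simp: path_image_join arc_reversepath intro!: simple_path_join_loop)

context theta_curve
begin

lemma ends_neq: "a \<noteq> b"
  using arcs(1) ends arc_distinct_ends by metis

lemma split_inside:
  assumes "path_image c - {a, b} \<subseteq> inside (path_image c1 \<union> path_image c2)"
  shows "inside (path_image c1 \<union> path_image c) \<inter> inside (path_image c2 \<union> path_image c) = {} \<and>
    inside (path_image c1 \<union> path_image c) \<union> inside (path_image c2 \<union> path_image c) \<union> (path_image c - {a, b})
      = inside (path_image c1 \<union> path_image c2)"
proof -
  have "path_image c - {a, b} \<noteq> {}"
    using nonempty_simple_path_endless[OF arc_imp_simple_path[OF arcs(3)]] ends by auto
  then have "path_image c \<inter> inside (path_image c1 \<union> path_image c2) \<noteq> {}" using assms by blast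
  then show ?thesis
    using split_inside_simple_closed_curve[OF arc_imp_simple_path[OF arcs(1)] ends(1,2)
        arc_imp_simple_path[OF arcs(2)] ends(3,4) arc_imp_simple_path[OF arcs(3)] ends(5,6)
        ends_neq meet] by metis
qed

lemma jordan: "jordan_curve (path_image c1 \<union> path_image c2)"
  "jordan_curve (path_image c1 \<union> path_image c)" "jordan_curve (path_image c2 \<union> path_image c)"
  by (rule jordan_curve_two_arcs[OF _ _ _ _ _ _ meet(1)] jordan_curve_two_arcs[OF _ _ _ _ _ _ meet(2)]
      jordan_curve_two_arcs[OF _ _ _ _ _ _ meet(3)]; simp add: arcs ends)+

text \<open>For the inside this is \<open>split_inside\<close>. For the outside, inversion at a
  point \<open>w\<close> of the inside turns the outside into the inside of the image curve, the arc
  splits it there, and the two parts are pulled back.\<close>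

lemma split_side:
  assumes R: "R \<in> sides (path_image c1 \<union> path_image c2)" and sub: "path_image c - {a, b} \<subseteq> R"
  shows "\<exists>R1\<in>sides (path_image c1 \<union> path_image c). \<exists>R2\<in>sides (path_image c2 \<union> path_image c).
    R1 \<inter> R2 = {} \<and> R1 \<union> R2 \<union> (path_image c - {a, b}) = R"
proof (cases "R = inside (path_image c1 \<union> path_image c2)")
  case True
  then show ?thesis
    using split_inside sub
    by (intro bexI[of _ "inside (path_image c1 \<union> path_image c)"]
        bexI[of _ "inside (path_image c2 \<union> path_image c)"]) (auto simp: sides_def)
next
  case False
  let ?C = "path_image c1 \<union> path_image c2" and ?C1 = "path_image c1 \<union> path_image c"
    and ?C2 = "path_image c2 \<union> path_image c"
  have Rout: "R = outside ?C" using False R by (simp add: sides_def)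
  note J = jordan_curve_sides[OF jordan(1)]
  obtain w where w: "w \<in> inside ?C" using J(5) by blast
  have wC: "w \<notin> ?C" using w J(10) by blast
  have wc: "w \<notin> path_image c"
  proof
    assume "w \<in> path_image c"
    moreover have "a \<in> ?C" "b \<in> ?C" using meet(1) by blast+
    ultimately have "w \<in> R" using sub wC by blast
    then show False using w Rout J(9) by blast
  qed
  define f where "f = (\<lambda>z. inverse (z - w))"
  have cont: "continuous_on (- {w}) f"
    unfolding f_def by (auto intro!: continuous_intros)
  have inj: "inj f" by (auto simp: f_def inj_on_def)
  have arc_f: "arc (f \<circ> g)" if "arc g" "w \<notin> path_image g" for g
    using that unfolding arc_def
    by (auto intro!: path_continuous_image continuous_on_subset[OF cont] comp_inj_on inj_on_subset[OF inj])
  interpret f: theta_curve "f \<circ> c1" "f \<circ> c2" "f \<circ> c" "f a" "f b"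
  proof
    show "arc (f \<circ> c1)" "arc (f \<circ> c2)" "arc (f \<circ> c)" using arc_f arcs wC wc by auto
    show "pathstart (f \<circ> c1) = f a" "pathfinish (f \<circ> c1) = f b" "pathstart (f \<circ> c2) = f a"
      "pathfinish (f \<circ> c2) = f b" "pathstart (f \<circ> c) = f a" "pathfinish (f \<circ> c) = f b"
      by (simp_all add: pathstart_compose pathfinish_compose ends)
    show "path_image (f \<circ> c1) \<inter> path_image (f \<circ> c2) = {f a, f b}"
      "path_image (f \<circ> c1) \<inter> path_image (f \<circ> c) = {f a, f b}"
      "path_image (f \<circ> c2) \<inter> path_image (f \<circ> c) = {f a, f b}"
      unfolding path_image_compose image_Int[OF inj, symmetric] meet by simp_all
  qed
  \<comment> \<open>Because \<open>inverse 0 = 0\<close>, \<open>f\<close> is injective on the whole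
    plane and sends \<open>w\<close> to 0; without the condition z \<noteq> w, \<open>w\<close>
    would be counted as a preimage of 0.\<close>
  define pre where "pre S = {z. z \<noteq> w \<and> f z \<in> S}" for S
  have pre_inside: "pre (inside (f ` K)) = Q" if "jordan_curve K" "w \<in> P" "sides K = {P, Q}" for K P Q
    using inversion_side[OF that] by (simp add: pre_def f_def)
  have pre_side: "pre (inside (f ` K)) \<in> sides K" if "jordan_curve K" "w \<notin> K" for K
  proof -
    have "w \<in> inside K \<or> w \<in> outside K" using that jordan_curve_sides(10)[OF that(1)] by blast
    then show ?thesis
      using pre_inside[OF that(1), of "inside K" "outside K"] pre_inside[OF that(1), of "outside K" "inside K"]
      by (auto simp: sides_def)
  qed
  have preR: "pre (inside (f ` ?C)) = R"
    unfolding Rout by (rule pre_inside[OF jordan(1) w]) (simp add: sides_def)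
  have pre_image: "pre (f ` S) = S" if "w \<notin> S" for S
    using that inj by (auto simp: pre_def inj_eq)
  have fC: "path_image (f \<circ> g) \<union> path_image (f \<circ> h) = f ` (path_image g \<union> path_image h)" for g h
    by (simp add: path_image_compose image_Un)
  have fc: "path_image (f \<circ> c) - {f a, f b} = f ` (path_image c - {a, b})"
    using inj by (auto simp: path_image_compose inj_eq)
  have "path_image (f \<circ> c) - {f a, f b} \<subseteq> inside (f ` ?C)"
    unfolding fc using sub wc preR by (auto simp: pre_def)
  then have split: "inside (f ` ?C1) \<inter> inside (f ` ?C2) = {}"
    "inside (f ` ?C1) \<union> inside (f ` ?C2) \<union> f ` (path_image c - {a, b}) = inside (f ` ?C)"
    using f.split_inside unfolding fC fc by auto
  have "pre (inside (f ` ?C1)) \<inter> pre (inside (f ` ?C2)) = {}"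
    using split(1) by (auto simp: pre_def)
  moreover have "pre (inside (f ` ?C1)) \<union> pre (inside (f ` ?C2)) \<union> (path_image c - {a, b}) = R"
  proof -
    have "pre (inside (f ` ?C)) = pre (inside (f ` ?C1)) \<union> pre (inside (f ` ?C2)) \<union> pre (f ` (path_image c - {a, b}))"
      unfolding split(2)[symmetric] by (auto simp: pre_def)
    moreover have "pre (f ` (path_image c - {a, b})) = path_image c - {a, b}"
      using wc by (intro pre_image) auto
    ultimately show ?thesis using preR by simp
  qed
  moreover have "pre (inside (f ` ?C1)) \<in> sides ?C1" "pre (inside (f ` ?C2)) \<in> sides ?C2"
    using wC wc by (intro pre_side jordan; blast)+
  ultimately show ?thesis by blast
qed

end

section \<open>Cycles in plane graphs\<close>

fun path_edges :: "'a list \<Rightarrow> 'a set set" where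
  "path_edges (x # y # xs) = insert {x, y} (path_edges (y # xs))"
| "path_edges _ = {}"

lemma path_edges_append: "path_edges (xs @ x # ys) = path_edges (xs @ [x]) \<union> path_edges (x # ys)"
  by (induction xs rule: path_edges.induct; cases ys) auto

lemma path_edges_snoc: "xs \<noteq> [] \<Longrightarrow> path_edges (xs @ [y]) = insert {last xs, y} (path_edges xs)"
  by (induction xs rule: path_edges.induct) auto

lemma path_edges_rev: "path_edges (rev xs) = path_edges xs"
proof (induction xs rule: path_edges.induct)
  case (1 x y xs)
  then show ?case by (simp add: path_edges_snoc insert_commute flip: append_assoc)
qed auto

lemma path_edges_subset: "e \<in> path_edges xs \<Longrightarrow> e \<subseteq> set xs"
  by (induction xs rule: path_edges.induct) auto

lemma Union_path_edges: "2 \<le> length xs \<Longrightarrow> \<Union> (path_edges xs) = set xs"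
proof (induction xs rule: path_edges.induct)
  case (1 x y xs)
  then show ?case by (cases xs) auto
qed auto

lemma path_edges_nth: "path_edges xs = {{xs ! i, xs ! Suc i} | i. Suc i < length xs}"
proof (induction xs rule: path_edges.induct)
  case (1 x y xs)
  have "{{(x # y # xs) ! i, (x # y # xs) ! Suc i} | i. Suc i < length (x # y # xs)}
      = insert {x, y} {{(y # xs) ! i, (y # xs) ! Suc i} | i. Suc i < length (y # xs)}"
    (is "?L = ?R")
  proof (intro equalityI subsetI)
    fix e assume "e \<in> ?L"
    then obtain i where "e = {(x # y # xs) ! i, (x # y # xs) ! Suc i}" "Suc i < length (x # y # xs)"
      by blast
    then show "e \<in> ?R" by (cases i) auto
  next
    fix e assume "e \<in> ?R"
    then consider "e = {x, y}"
      | i where "e = {(y # xs) ! i, (y # xs) ! Suc i}" "Suc i < length (y # xs)" by blast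
    then show "e \<in> ?L"
    proof cases
      case 1
      then show ?thesis by (intro CollectI exI[of _ 0]) simp
    next
      case 2
      then show ?thesis by (intro CollectI exI[of _ "Suc i"]) simp
    qed
  qed
  then show ?case using 1 by simp
qed auto

definition cycle_edges :: "'a list \<Rightarrow> 'a set set" where
  "cycle_edges vs = path_edges (vs @ [hd vs])"

lemma is_cycle_iff: "is_cycle E vs \<longleftrightarrow> 3 \<le> length vs \<and> distinct vs \<and> cycle_edges vs \<subseteq> E"
proof (cases "vs = []")
  case False
  have idx: "(vs @ [hd vs]) ! i = vs ! i \<and> (vs @ [hd vs]) ! Suc i = vs ! (Suc i mod length vs)"
    if "i < length vs" for i
  proof (cases "Suc i = length vs")
    case True
    then show ?thesis using False that by (simp add: nth_append hd_conv_nth)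
  next
    case neq: False
    then show ?thesis using that by (simp add: nth_append)
  qed
  have "cycle_edges vs = {{vs ! i, vs ! (Suc i mod length vs)} | i. i < length vs}"
    unfolding cycle_edges_def path_edges_nth using idx by (intro Collect_cong ex_cong1) auto
  then show ?thesis by (auto simp: is_cycle_def)
qed (simp add: is_cycle_def)

lemma cycle_edges_two_paths:
  "cycle_edges (a # xs @ b # ys) = path_edges (a # xs @ [b]) \<union> path_edges (a # rev ys @ [b])"
proof -
  have "path_edges (b # ys @ [a]) = path_edges (a # rev ys @ [b])"
    using path_edges_rev[of "b # ys @ [a]"] by simp
  then show ?thesis
    using path_edges_append[of "a # xs" b "ys @ [a]"] by (simp add: cycle_edges_def)
qed

lemma cycle_edges_rotate: "cycle_edges (us @ ws) = cycle_edges (ws @ us)"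
proof (cases "us = [] \<or> ws = []")
  case False
  then obtain a us' b ws' where "us = a # us'" "ws = b # ws'" by (meson neq_Nil_conv)
  then show ?thesis
    using path_edges_append[of us b "ws' @ [a]"] path_edges_append[of ws a "us' @ [b]"]
    by (auto simp: cycle_edges_def)
qed auto

text \<open>Rotates the cycle to start at \<open>a\<close>, which exhibits its two arcs between
  \<open>a\<close> and \<open>b\<close>, ready to be combined with an ear into a theta.\<close>

lemma cycle_decomposition:
  assumes "is_cycle E vs" "a \<in> set vs" "b \<in> set vs" "a \<noteq> b"
  obtains xs ys where "is_cycle E (a # xs @ b # ys)" "set (a # xs @ b # ys) = set vs"
    "cycle_edges (a # xs @ b # ys) = cycle_edges vs"
proof -
  obtain us ws where vs: "vs = us @ a # ws" using assms(2) by (auto simp: in_set_conv_decomp)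
  then have "b \<in> set (ws @ us)" using assms by auto
  then obtain xs ys where xy: "ws @ us = xs @ b # ys" by (meson in_set_conv_decomp)
  have "cycle_edges (a # xs @ b # ys) = cycle_edges vs"
    using cycle_edges_rotate[of us "a # ws"] unfolding vs by (simp add: xy)
  moreover have "set (a # xs @ b # ys) = set vs" unfolding xy[symmetric] vs by auto
  moreover have "distinct (a # xs @ b # ys)" "length (a # xs @ b # ys) = length vs"
    unfolding xy[symmetric] using assms(1) vs arg_cong[OF xy, of length] by (auto simp: is_cycle_def)
  ultimately show thesis
    using assms(1) by (intro that) (auto simp: is_cycle_iff)
qed

lemma card_cycle_edges_at:
  assumes "is_cycle E vs" "v \<in> set vs"
  shows "card {e \<in> cycle_edges vs. v \<in> e} = 2"
proof -
  obtain us ws where vs: "vs = us @ v # ws" using assms(2) by (auto simp: in_set_conv_decomp)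
  have len: "3 \<le> length (v # ws @ us)" and dist: "distinct (v # ws @ us)"
    using assms(1) unfolding vs by (auto simp: is_cycle_def)
  obtain x r where r: "ws @ us = x # r" using len by (cases "ws @ us") auto
  then obtain q y where q: "r = q @ [y]" using len by (cases r rule: rev_cases) auto
  have "cycle_edges vs = cycle_edges (v # x # q @ [y])"
    using cycle_edges_rotate[of us "v # ws"] r q unfolding vs by simp
  also have "\<dots> = {{v, x}, {y, v}} \<union> path_edges (x # q @ [y])"
    using path_edges_append[of "x # q" y "[v]"] by (auto simp: cycle_edges_def)
  finally have eq: "cycle_edges vs = {{v, x}, {y, v}} \<union> path_edges (x # q @ [y])" .
  have "v \<notin> set (x # q @ [y])" "x \<noteq> y" using dist unfolding r q by auto
  then have "{e \<in> cycle_edges vs. v \<in> e} = {{v, x}, {y, v}}"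
    unfolding eq using path_edges_subset[of _ "x # q @ [y]"] by blast
  then show ?thesis using \<open>x \<noteq> y\<close> by (auto simp: card_insert_if doubleton_eq_iff)
qed

lemma path_edge_between_ends:
  assumes "distinct (a # xs @ [b])" "{a, b} \<in> path_edges (a # xs @ [b])"
  shows "xs = []"
proof (cases xs)
  case (Cons x xs')
  then have "{a, b} \<noteq> {a, x}" using assms(1) by (auto simp: doubleton_eq_iff)
  then have "{a, b} \<in> path_edges (x # xs' @ [b])" using assms(2) Cons by simp
  then have "a \<in> set (x # xs' @ [b])" using path_edges_subset by blast
  then show ?thesis using assms(1) Cons by auto
qed simp

text \<open>The paths share only their ends, so a common edge would be the edge from
  \<open>a\<close> to \<open>b\<close>, and then both paths would consist of it alone.\<close>

lemma path_edges_disjoint: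
  assumes "distinct (a # b # xs @ ys)" "xs \<noteq> [] \<or> ys \<noteq> []"
    and card2: "\<forall>e\<in>path_edges (a # xs @ [b]). card e = 2"
  shows "path_edges (a # xs @ [b]) \<inter> path_edges (a # ys @ [b]) = {}"
proof (rule equals0I)
  fix e assume e: "e \<in> path_edges (a # xs @ [b]) \<inter> path_edges (a # ys @ [b])"
  then have "e \<subseteq> set (a # xs @ [b]) \<inter> set (a # ys @ [b])" using path_edges_subset by blast
  also have "\<dots> = {a, b}" using assms(1) by auto
  finally have "e \<subseteq> {a, b}" .
  moreover have "card e = card {a, b}" using e card2 assms(1) by auto
  ultimately have "e = {a, b}" by (simp add: card_subset_eq)
  then have "xs = []" "ys = []"
    using e assms(1) path_edge_between_ends[of a xs b] path_edge_between_ends[of a ys b] by auto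
  then show False using assms(2) by simp
qed

section \<open>Drawings of paths, cycles and thetas\<close>

locale plane_graph =
  fixes H :: "'a set set" and p :: "'a \<Rightarrow> complex" and \<gamma> :: "'a set \<Rightarrow> real \<Rightarrow> complex"
  assumes fin: "finite H" and card2: "\<forall>e\<in>H. card e = 2"
    and drawing: "planar_drawing (\<Union> H) H p \<gamma>"
begin

definition img :: "'a set set \<Rightarrow> complex set" where
  "img A = (\<Union>e\<in>A. path_image (\<gamma> e))"

definition open_edge :: "'a set \<Rightarrow> complex set" where
  "open_edge e = path_image (\<gamma> e) - p ` e"

lemma p_eq: "x \<in> \<Union> H \<Longrightarrow> y \<in> \<Union> H \<Longrightarrow> p x = p y \<longleftrightarrow> x = y"
proof -
  have "inj_on p (\<Union> H)" using drawing unfolding planar_drawing_def by (elim conjE)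
  then show "x \<in> \<Union> H \<Longrightarrow> y \<in> \<Union> H \<Longrightarrow> p x = p y \<longleftrightarrow> x = y" by (rule inj_on_eq_iff)
qed

lemma edge_arc:
  assumes "e \<in> H"
  shows "arc (\<gamma> e)" "{pathstart (\<gamma> e), pathfinish (\<gamma> e)} = p ` e"
    "path_image (\<gamma> e) \<inter> p ` \<Union> H = p ` e"
proof -
  have "\<forall>e\<in>H. arc (\<gamma> e) \<and> {pathstart (\<gamma> e), pathfinish (\<gamma> e)} = p ` e \<and>
      path_image (\<gamma> e) \<inter> p ` \<Union> H = p ` e"
    using drawing unfolding planar_drawing_def by (elim conjE)
  with assms show "arc (\<gamma> e)" "{pathstart (\<gamma> e), pathfinish (\<gamma> e)} = p ` e"
    "path_image (\<gamma> e) \<inter> p ` \<Union> H = p ` e"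
    by (simp_all del: UN_simps Union_iff)
qed

lemma edges_meet: "e \<in> H \<Longrightarrow> f \<in> H \<Longrightarrow> e \<noteq> f \<Longrightarrow> path_image (\<gamma> e) \<inter> path_image (\<gamma> f) = p ` (e \<inter> f)"
proof -
  have D: "\<forall>e\<in>H. \<forall>f\<in>H. e \<noteq> f \<longrightarrow> path_image (\<gamma> e) \<inter> path_image (\<gamma> f) = p ` (e \<inter> f)"
    using drawing unfolding planar_drawing_def by (elim conjE)
  show "e \<in> H \<Longrightarrow> f \<in> H \<Longrightarrow> e \<noteq> f \<Longrightarrow>
      path_image (\<gamma> e) \<inter> path_image (\<gamma> f) = p ` (e \<inter> f)"
    by (rule D[rule_format])
qed

lemma img_Un: "img (A \<union> B) = img A \<union> img B"
  by (auto simp: img_def)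

lemma vertex_in_img:
  assumes "A \<subseteq> H" "v \<in> \<Union> H"
  shows "p v \<in> img A \<longleftrightarrow> v \<in> \<Union> A"
proof
  assume "p v \<in> img A"
  then obtain e where e: "e \<in> A" "p v \<in> path_image (\<gamma> e)" by (auto simp: img_def)
  then have "p v \<in> p ` e" using edge_arc(3)[of e] assms by blast
  then obtain x where "x \<in> e" "p v = p x" by blast
  then show "v \<in> \<Union> A" using p_eq[of v x] e(1) assms by blast
next
  assume "v \<in> \<Union> A"
  then obtain e where e: "e \<in> A" "v \<in> e" by blast
  then have "p v \<in> path_image (\<gamma> e)" using edge_arc(3)[of e] assms(1) by blast
  then show "p v \<in> img A" using e by (auto simp: img_def)
qed

lemma img_Int:
  assumes "A \<subseteq> H" "B \<subseteq> H" "A \<inter> B = {}"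
  shows "img A \<inter> img B = p ` (\<Union> A \<inter> \<Union> B)"
proof (intro equalityI subsetI)
  fix z assume "z \<in> img A \<inter> img B"
  then obtain e f where ef: "e \<in> A" "f \<in> B" "z \<in> path_image (\<gamma> e) \<inter> path_image (\<gamma> f)"
    by (auto simp: img_def)
  then have "z \<in> p ` (e \<inter> f)" using edges_meet[of e f] assms by blast
  then show "z \<in> p ` (\<Union> A \<inter> \<Union> B)" using ef by blast
next
  fix z assume "z \<in> p ` (\<Union> A \<inter> \<Union> B)"
  then obtain v where v: "v \<in> \<Union> A" "v \<in> \<Union> B" "z = p v" by blast
  then have "v \<in> \<Union> H" using assms by blast
  then show "z \<in> img A \<inter> img B" using v vertex_in_img assms by blast
qed

lemma open_edge_subset_img: "e \<in> A \<Longrightarrow> open_edge e \<subseteq> img A"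
  by (auto simp: open_edge_def img_def)

lemma open_edge_disjoint:
  assumes "e \<in> H" "A \<subseteq> H" "e \<notin> A"
  shows "open_edge e \<inter> img A = {}"
proof (rule equals0I)
  fix z assume "z \<in> open_edge e \<inter> img A"
  then obtain f where f: "f \<in> A" "z \<in> path_image (\<gamma> e) \<inter> path_image (\<gamma> f)" "z \<notin> p ` e"
    by (auto simp: img_def open_edge_def)
  then have "z \<in> p ` (e \<inter> f)" using edges_meet[of e f] assms by blast
  then show False using f by blast
qed

lemma open_edge_eq: "e \<in> H \<Longrightarrow> open_edge e = path_image (\<gamma> e) - {pathstart (\<gamma> e), pathfinish (\<gamma> e)}"
  by (simp only: open_edge_def edge_arc(2))

lemma connected_open_edge: "e \<in> H \<Longrightarrow> connected (open_edge e)"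
  by (simp add: open_edge_eq connected_simple_path_endless arc_imp_simple_path edge_arc(1))

lemma open_edge_nonempty: "e \<in> H \<Longrightarrow> open_edge e \<noteq> {}"
  using nonempty_simple_path_endless[OF arc_imp_simple_path[OF edge_arc(1)]] by (simp only: open_edge_eq not_False_eq_True)

text \<open>A connected set with more than one point has no isolated points, and removing the two
  ends of the arc does not change its limit points. This links the side containing an open edge with
  the position of its ends.\<close>

lemma open_edge_closure:
  assumes "e \<in> H" "v \<in> e"
  shows "p v \<in> closure (open_edge e)"
proof -
  have sp: "simple_path (\<gamma> e)" using edge_arc(1)[OF assms(1)] by (rule arc_imp_simple_path)
  have "p v islimpt path_image (\<gamma> e)"
  proof (rule connected_imp_perfect)
    show "connected (path_image (\<gamma> e))" using sp by (simp add: simple_path_imp_path connected_path_image)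
    show "p v \<in> path_image (\<gamma> e)" using edge_arc(3)[OF assms(1)] assms(2) by blast
    have "pathstart (\<gamma> e) \<noteq> pathfinish (\<gamma> e)" using arc_distinct_ends[OF edge_arc(1)[OF assms(1)]] by simp
    then show "path_image (\<gamma> e) \<noteq> {x}" for x
      using pathstart_in_path_image[of "\<gamma> e"] pathfinish_in_path_image[of "\<gamma> e"] by (metis singletonD)
  qed
  then have "p v islimpt (path_image (\<gamma> e) - p ` e)"
  proof -
    have "path_image (\<gamma> e) \<subseteq> (path_image (\<gamma> e) - p ` e) \<union> p ` e" by blast
    then have "p v islimpt ((path_image (\<gamma> e) - p ` e) \<union> p ` e)"
      using \<open>p v islimpt path_image (\<gamma> e)\<close> islimpt_subset by blast
    moreover have "finite (p ` e)" using edge_arc(2)[OF assms(1)] by (metis finite.emptyI finite.insertI)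
    ultimately show ?thesis by (metis islimpt_Un_finite sup_commute)
  qed
  then show ?thesis unfolding open_edge_def closure_def by blast
qed

lemma edge_arc_from:
  assumes "{x, y} \<in> H"
  shows "\<exists>g. arc g \<and> pathstart g = p x \<and> pathfinish g = p y \<and> path_image g = path_image (\<gamma> {x, y})"
proof -
  have "{pathstart (\<gamma> {x, y}), pathfinish (\<gamma> {x, y})} = {p x, p y}"
    using edge_arc(2)[OF assms] by simp
  then consider "pathstart (\<gamma> {x, y}) = p x" "pathfinish (\<gamma> {x, y}) = p y"
    | "pathstart (\<gamma> {x, y}) = p y" "pathfinish (\<gamma> {x, y}) = p x"
    by (auto simp: doubleton_eq_iff)
  then show ?thesis
  proof cases
    case 1
    then show ?thesis using edge_arc(1)[OF assms] by blast
  next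
    case 2
    then show ?thesis using edge_arc(1)[OF assms]
      by (intro exI[of _ "reversepath (\<gamma> {x, y})"]) (simp add: arc_reversepath)
  qed
qed

lemma path_arc:
  assumes "distinct xs" "2 \<le> length xs" "path_edges xs \<subseteq> H"
  shows "\<exists>g. arc g \<and> pathstart g = p (hd xs) \<and> pathfinish g = p (last xs) \<and>
    path_image g = img (path_edges xs)"
  using assms
proof (induction xs rule: path_edges.induct)
  case (1 x y xs)
  then have xy: "{x, y} \<in> H" by simp
  obtain g where g: "arc g" "pathstart g = p x" "pathfinish g = p y" "path_image g = img {{x, y}}"
    using edge_arc_from[OF xy] by (auto simp: img_def)
  show ?case
  proof (cases xs)
    case Nil
    then show ?thesis using g by auto
  next
    case (Cons z zs)
    then obtain h where h: "arc h" "pathstart h = p y" "pathfinish h = p (last (y # xs))"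
        "path_image h = img (path_edges (y # xs))"
      using 1 by auto
    have U: "\<Union> (path_edges (y # xs)) = set (y # xs)" using Cons by (intro Union_path_edges) simp
    then have nin: "{x, y} \<notin> path_edges (y # xs)" using 1(2) by auto
    have "path_image g \<inter> path_image h = p ` ({x, y} \<inter> set (y # xs))"
      unfolding g(4) h(4) U[symmetric] using 1(4) nin xy by (subst img_Int) auto
    also have "\<dots> \<subseteq> {p y}" using 1(2) by auto
    finally have "arc (g +++ h)" using g h by (intro arc_join) auto
    then show ?thesis
      using g h Cons by (intro exI[of _ "g +++ h"]) (auto simp: path_image_join img_def)
  qed
qed auto

lemma Union_path_edges_ends: "\<Union> (path_edges (a # xs @ [b])) = insert a (insert b (set xs))"
  by (subst Union_path_edges) auto

lemma paths_meet:
  assumes "distinct (a # b # xs @ ys)" "xs \<noteq> [] \<or> ys \<noteq> []"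
    and "path_edges (a # xs @ [b]) \<subseteq> H" "path_edges (a # ys @ [b]) \<subseteq> H"
  shows "img (path_edges (a # xs @ [b])) \<inter> img (path_edges (a # ys @ [b])) = {p a, p b}"
proof -
  have "path_edges (a # xs @ [b]) \<inter> path_edges (a # ys @ [b]) = {}"
    using assms card2 by (intro path_edges_disjoint) auto
  then have "img (path_edges (a # xs @ [b])) \<inter> img (path_edges (a # ys @ [b]))
      = p ` (insert a (insert b (set xs)) \<inter> insert a (insert b (set ys)))"
    using img_Int[OF assms(3,4)] by (simp add: Union_path_edges_ends)
  also have "insert a (insert b (set xs)) \<inter> insert a (insert b (set ys)) = {a, b}"
    using assms(1) by auto
  finally show ?thesis by simp
qed

lemma jordan_curve_cycle:
  assumes "is_cycle H vs"
  shows "jordan_curve (img (cycle_edges vs))"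
proof -
  have "3 \<le> length vs" "distinct vs" using assms by (auto simp: is_cycle_def)
  then obtain a b ys where vs: "vs = a # [] @ b # ys" "ys \<noteq> []"
    by (cases vs; cases "tl vs"; cases "tl (tl vs)") auto
  let ?c1 = "path_edges (a # [] @ [b])" and ?c2 = "path_edges (a # rev ys @ [b])"
  have ce: "cycle_edges vs = ?c1 \<union> ?c2" unfolding vs by (rule cycle_edges_two_paths)
  then have sub: "?c1 \<subseteq> H" "?c2 \<subseteq> H" using assms by (auto simp: is_cycle_iff)
  obtain c1 where c1: "arc c1" "pathstart c1 = p a" "pathfinish c1 = p b" "path_image c1 = img ?c1"
    using path_arc[of "a # [] @ [b]"] sub \<open>distinct vs\<close> vs by auto
  obtain c2 where c2: "arc c2" "pathstart c2 = p a" "pathfinish c2 = p b" "path_image c2 = img ?c2"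
    using path_arc[of "a # rev ys @ [b]"] sub \<open>distinct vs\<close> vs by auto
  have "jordan_curve (path_image c1 \<union> path_image c2)"
    using c1 c2 paths_meet[OF _ _ sub] \<open>distinct vs\<close> vs by (intro jordan_curve_two_arcs) auto
  then show ?thesis unfolding ce img_Un c1(4) c2(4) .
qed

text \<open>One open edge of the third path inside \<open>R\<close> suffices: without its ends the
  path is connected and misses the curve, so it lies in \<open>R\<close> entirely, and
  \<open>split_side\<close> applies.\<close>

lemma theta_split:
  assumes dist: "distinct (a # b # xs @ ys @ zs)"
    and ne: "xs \<noteq> [] \<or> ys \<noteq> []" "xs \<noteq> [] \<or> zs \<noteq> []" "ys \<noteq> [] \<or> zs \<noteq> []"
    and sub: "path_edges (a # xs @ [b]) \<subseteq> H" "path_edges (a # ys @ [b]) \<subseteq> H" "path_edges (a # zs @ [b]) \<subseteq> H"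
    and R: "R \<in> sides (img (path_edges (a # xs @ [b]) \<union> path_edges (a # ys @ [b])))"
    and e: "e \<in> path_edges (a # zs @ [b])" "open_edge e \<subseteq> R"
  shows "\<exists>R1\<in>sides (img (path_edges (a # xs @ [b]) \<union> path_edges (a # zs @ [b]))).
    \<exists>R2\<in>sides (img (path_edges (a # ys @ [b]) \<union> path_edges (a # zs @ [b]))).
    R1 \<inter> R2 = {} \<and> R1 \<union> R2 \<union> (img (path_edges (a # zs @ [b])) - {p a, p b}) = R"
proof -
  let ?A1 = "path_edges (a # xs @ [b])" and ?A2 = "path_edges (a # ys @ [b])" and ?P = "path_edges (a # zs @ [b])"
  obtain c1 where c1: "arc c1" "pathstart c1 = p a" "pathfinish c1 = p b" "path_image c1 = img ?A1"
    using path_arc[of "a # xs @ [b]"] sub dist by auto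
  obtain c2 where c2: "arc c2" "pathstart c2 = p a" "pathfinish c2 = p b" "path_image c2 = img ?A2"
    using path_arc[of "a # ys @ [b]"] sub dist by auto
  obtain c where c: "arc c" "pathstart c = p a" "pathfinish c = p b" "path_image c = img ?P"
    using path_arc[of "a # zs @ [b]"] sub dist by auto
  have img_meet: "img ?A1 \<inter> img ?A2 = {p a, p b}" "img ?A1 \<inter> img ?P = {p a, p b}" "img ?A2 \<inter> img ?P = {p a, p b}"
    using dist by (intro paths_meet ne sub; auto)+
  interpret theta_curve c1 c2 c "p a" "p b"
    by unfold_locales (simp_all only: c1 c2 c img_meet)
  have Rs: "R \<in> sides (path_image c1 \<union> path_image c2)"
    using R unfolding c1(4) c2(4) img_Un .
  have "path_image c - {p a, p b} \<subseteq> R"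
  proof (rule connected_in_side[OF jordan(1) Rs])
    show "connected (path_image c - {p a, p b})"
      using connected_simple_path_endless[OF arc_imp_simple_path[OF c(1)]] c by simp
    show "(path_image c - {p a, p b}) \<inter> (path_image c1 \<union> path_image c2) = {}"
      unfolding c(4) c1(4) c2(4) using img_meet by blast
    have eH: "e \<in> H" using e sub by blast
    have ab: "a \<in> \<Union> H" "b \<in> \<Union> H"
      using sub(1) Union_path_edges_ends[of a xs b] by blast+
    have "p a \<notin> open_edge e \<and> p b \<notin> open_edge e"
      using edge_arc(3)[OF eH] ab unfolding open_edge_def by blast
    then have "open_edge e \<subseteq> path_image c - {p a, p b}"
      using open_edge_subset_img[OF e(1)] unfolding c(4) by blast
    then show "(path_image c - {p a, p b}) \<inter> R \<noteq> {}"
      using e(2) open_edge_nonempty[OF eH] by blast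
  qed
  from split_side[OF Rs this] show ?thesis unfolding c(4) c1(4) c2(4) img_Un .
qed

end

section \<open>Turning numbers of cycles\<close>

context plane_graph
begin

definition inward :: "complex set \<Rightarrow> 'a \<Rightarrow> bool" where
  "inward R v \<longleftrightarrow> (\<exists>e\<in>H. v \<in> e \<and> open_edge e \<subseteq> R)"

lemma not_open_edge_subset:
  assumes "e \<in> A" "A \<subseteq> H" "img A \<inter> R = {}"
  shows "\<not> open_edge e \<subseteq> R"
  using open_edge_subset_img[OF assms(1)] open_edge_nonempty[of e] assms by blast

lemma not_inward:
  assumes "{e \<in> H. v \<in> e} \<subseteq> A" "A \<subseteq> H" "img A \<inter> R = {}"
  shows "\<not> inward R v"
  unfolding inward_def using not_open_edge_subset[OF _ assms(2,3)] assms(1) by blast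

lemma vertex_in_H: "A \<subseteq> H \<Longrightarrow> v \<in> \<Union> A \<Longrightarrow> v \<in> \<Union> H"
  by blast

text \<open>An edge pointing from \<open>v\<close> into \<open>R\<close> misses the ear, so it lies
  in one part. It cannot be \<open>R2\<close>: then \<open>p v\<close> would be in the closure of
  \<open>R2\<close>, but \<open>v\<close> is on neither path bounding \<open>R2\<close>, and
  \<open>p v\<close> is not in \<open>R\<close>.\<close>

lemma inward_transfer:
  assumes sub: "A1 \<subseteq> H" "A2 \<subseteq> H" "P \<subseteq> H"
    and j: "jordan_curve (img (A1 \<union> P))" "jordan_curve (img (A2 \<union> P))"
    and R1: "R1 \<in> sides (img (A1 \<union> P))" and R2: "R2 \<in> sides (img (A2 \<union> P))"
    and R: "R1 \<union> R2 \<union> S = R" "S \<subseteq> img P" "R \<inter> img (A1 \<union> A2) = {}"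
    and v: "v \<in> \<Union> A1" "v \<notin> \<Union> A2" "v \<notin> \<Union> P"
  shows "inward R v \<longleftrightarrow> inward R1 v"
proof
  assume "inward R1 v"
  then show "inward R v" unfolding inward_def using R(1) by blast
next
  assume "inward R v"
  then obtain e where e: "e \<in> H" "v \<in> e" "open_edge e \<subseteq> R" unfolding inward_def by blast
  have vH: "v \<in> \<Union> H" by (rule vertex_in_H[OF sub(1) v(1)])
  have "e \<notin> P" using e(2) v(3) by blast
  then have dP: "open_edge e \<inter> img P = {}" using open_edge_disjoint[OF e(1) sub(3)] by blast
  have dA: "open_edge e \<inter> img A1 = {}" "open_edge e \<inter> img A2 = {}"
    using e(3) R(3) unfolding img_Un by blast+
  have conn: "connected (open_edge e)" by (rule connected_open_edge[OF e(1)])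
  have "open_edge e \<inter> R2 = {}"
  proof (rule ccontr)
    assume "open_edge e \<inter> R2 \<noteq> {}"
    then have "open_edge e \<subseteq> R2"
      using dP dA by (intro connected_in_side[OF j(2) R2 conn]) (auto simp: img_Un)
    then have "p v \<in> closure R2" using open_edge_closure[OF e(1,2)] closure_mono by blast
    then have "p v \<in> R2 \<union> img (A2 \<union> P)" using side_facts(5)[OF j(2) R2] by blast
    moreover have "p v \<notin> img (A2 \<union> P)"
      using vertex_in_img[of "A2 \<union> P" v] sub v vH by auto
    moreover have "p v \<in> img A1" using vertex_in_img[OF sub(1) vH] v(1) by blast
    then have "p v \<notin> R2" using R(1,3) unfolding img_Un by blast
    ultimately show False by blast
  qed
  moreover have "open_edge e \<inter> S = {}" using dP R(2) by blast
  ultimately have "open_edge e \<subseteq> R1" using e(3) R(1) by blast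
  then show "inward R1 v" unfolding inward_def using e by blast
qed

text \<open>The third edge \<open>e0\<close> at an inner vertex of the ear starts inside
  \<open>R\<close> and crosses neither the curve nor the ear, so it lies in exactly one of the two
  parts. Such vertices contribute +1 and -1, hence nothing in total.\<close>

lemma inward_on_ear:
  assumes sub: "A1 \<subseteq> H" "A2 \<subseteq> H" "P \<subseteq> H"
    and j: "jordan_curve (img (A1 \<union> A2))" "jordan_curve (img (A1 \<union> P))" "jordan_curve (img (A2 \<union> P))"
    and R0: "R \<in> sides (img (A1 \<union> A2))"
    and R1: "R1 \<in> sides (img (A1 \<union> P))" and R2: "R2 \<in> sides (img (A2 \<union> P))"
    and R: "R1 \<union> R2 \<union> S = R" "S \<subseteq> img P" "R1 \<inter> R2 = {}"
    and v: "v \<notin> \<Union> A1" "v \<notin> \<Union> A2" "p v \<in> R"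
    and e: "{e \<in> H. v \<in> e} = insert e0 {e \<in> P. v \<in> e}" "e0 \<notin> P"
  shows "inward R1 v \<longleftrightarrow> \<not> inward R2 v"
proof -
  have e0: "e0 \<in> H" "v \<in> e0" using e(1) by blast+
  have "e0 \<notin> A1" "e0 \<notin> A2" using e0 v by blast+
  then have d: "open_edge e0 \<inter> img A1 = {}" "open_edge e0 \<inter> img A2 = {}" "open_edge e0 \<inter> img P = {}"
    using open_edge_disjoint[OF e0(1)] sub e(2) by blast+
  have conn: "connected (open_edge e0)" by (rule connected_open_edge[OF e0(1)])
  have "R \<inter> open_edge e0 \<noteq> {}"
    using open_edge_closure[OF e0] v(3) side_facts(1)[OF j(1) R0]
    by (meson closure_iff_nhds_not_empty disjoint_iff open_Int_closure_eq_empty)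
  then have "open_edge e0 \<subseteq> R"
    using d by (intro connected_in_side[OF j(1) R0 conn]) (auto simp: img_Un)
  then have in12: "open_edge e0 \<subseteq> R1 \<union> R2" using R(1,2) d(3) by blast
  have dis: "R1 \<inter> img P = {}" "R2 \<inter> img P = {}"
    using side_facts(4)[OF j(2) R1] side_facts(4)[OF j(3) R2] unfolding img_Un by blast+
  have iff: "inward R' v \<longleftrightarrow> open_edge e0 \<subseteq> R'" if "R' \<inter> img P = {}" for R'
  proof
    assume "inward R' v"
    then obtain f where f: "f \<in> H" "v \<in> f" "open_edge f \<subseteq> R'" unfolding inward_def by blast
    have "f \<notin> P" using not_open_edge_subset[OF _ sub(3), of f R'] f that by blast
    then have "f = e0" using e(1) f by blast
    then show "open_edge e0 \<subseteq> R'" using f by simp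
  next
    assume "open_edge e0 \<subseteq> R'"
    then show "inward R' v" unfolding inward_def using e0 by blast
  qed
  have ne: "open_edge e0 \<noteq> {}" by (rule open_edge_nonempty[OF e0(1)])
  show ?thesis
  proof (cases "open_edge e0 \<inter> R1 = {}")
    case True
    then have "open_edge e0 \<subseteq> R2" using in12 by blast
    then show ?thesis using iff dis True ne by blast
  next
    case False
    then have "open_edge e0 \<subseteq> R1"
      using d by (intro connected_in_side[OF j(2) R1 conn]) (auto simp: img_Un)
    then have "\<not> open_edge e0 \<subseteq> R2" using ne R(3) by blast
    then show ?thesis using iff dis \<open>open_edge e0 \<subseteq> R1\<close> by blast
  qed
qed

end

section \<open>Total turning in bridgeless graphs\<close>

lemma sum_two_paths:
  fixes h :: "'a \<Rightarrow> int"
  assumes "distinct (a # b # xs @ ys)" "a \<in> B" "b \<in> B"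
  shows "(\<Sum>v\<in>set (a # xs @ b # ys) \<inter> B. h v) = h a + h b + (\<Sum>v\<in>set xs \<inter> B. h v) + (\<Sum>v\<in>set ys \<inter> B. h v)"
proof -
  have "set (a # xs @ b # ys) \<inter> B = insert a (insert b ((set xs \<inter> B) \<union> (set ys \<inter> B)))"
    using assms(2,3) by auto
  moreover have "(\<Sum>v\<in>insert a (insert b ((set xs \<inter> B) \<union> (set ys \<inter> B))). h v)
      = h a + (h b + (\<Sum>v\<in>(set xs \<inter> B) \<union> (set ys \<inter> B). h v))"
    using assms(1) by (subst sum.insert; (subst sum.insert)?) auto
  moreover have "(\<Sum>v\<in>(set xs \<inter> B) \<union> (set ys \<inter> B). h v)
      = (\<Sum>v\<in>set xs \<inter> B. h v) + (\<Sum>v\<in>set ys \<inter> B. h v)"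
    using assms(1) by (intro sum.union_disjoint) auto
  ultimately show ?thesis by simp
qed

text \<open>\<open>X\<close> marks vertices of degree 2 that count as branch vertices; in the
  application they had degree 3 before a boundary edge was cut off. They point to neither side of a
  cycle, and this defect is what \<open>card X\<close> measures. The cut condition
  \<open>bridgeless\<close> includes connectedness.\<close>

locale plane_bridgeless = plane_graph +
  fixes X :: "'a set"
  assumes deg: "\<And>v. v \<in> \<Union> H \<Longrightarrow> degree H v \<in> {2, 3}"
    and bridgeless: "\<And>T. T \<subseteq> \<Union> H \<Longrightarrow> T \<noteq> {} \<Longrightarrow> T \<noteq> \<Union> H \<Longrightarrow>
      2 \<le> card {e \<in> H. e \<inter> T \<noteq> {} \<and> \<not> e \<subseteq> T}"
    and X: "\<And>v. v \<in> X \<Longrightarrow> v \<in> \<Union> H \<and> degree H v = 2"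
    and long: "\<And>vs. is_cycle H vs \<Longrightarrow> 6 \<le> card {v \<in> set vs. v \<in> X \<or> degree H v = 3}"
begin

definition B :: "'a set" where
  "B = X \<union> {v. degree H v = 3}"

text \<open>Combinatorial curvature of the boundary as seen from \<open>R\<close>: a third edge on
  the far side counts +1, one entering \<open>R\<close> counts -1. A vertex of \<open>X\<close> on a
  cycle counts +1 from both sides.\<close>

definition turn :: "complex set \<Rightarrow> 'a \<Rightarrow> int" where
  "turn R v = (if inward R v then -1 else 1)"

lemma cycle_sub: "is_cycle H vs \<Longrightarrow> cycle_edges vs \<subseteq> H"
  by (simp add: is_cycle_iff)

lemma cycle_vertices:
  assumes "is_cycle H vs" shows "\<Union> (cycle_edges vs) = set vs"
proof -
  have "3 \<le> length vs" using assms by (simp add: is_cycle_def)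
  then have "vs \<noteq> []" by auto
  then show ?thesis
    unfolding cycle_edges_def using \<open>3 \<le> length vs\<close> by (subst Union_path_edges) (auto simp: hd_in_set)
qed

lemma edges_at_cycle_vertex:
  assumes c: "is_cycle H vs" and v: "v \<in> set vs" and e: "e \<in> H" "v \<in> e" "e \<notin> cycle_edges vs"
  shows "degree H v = 3" "{f \<in> H. v \<in> f} = insert e {f \<in> cycle_edges vs. v \<in> f}"
proof -
  let ?C = "{f \<in> cycle_edges vs. v \<in> f}"
  have fC: "finite ?C" using cycle_sub[OF c] fin finite_subset by fastforce
  have card: "card (insert e ?C) = 3"
    using fC e card_cycle_edges_at[OF c v] by simp
  have sub: "insert e ?C \<subseteq> {f \<in> H. v \<in> f}" using e cycle_sub[OF c] by blast
  have fH: "finite {f \<in> H. v \<in> f}" using fin by simp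
  have "3 \<le> degree H v" unfolding degree_def card[symmetric] by (rule card_mono[OF fH sub])
  moreover have "degree H v \<in> {2, 3}" using e(1,2) by (intro deg) blast
  ultimately show d3: "degree H v = 3" by auto
  show "{f \<in> H. v \<in> f} = insert e ?C"
    using card_seteq[OF fH sub] card d3 by (simp add: degree_def)
qed

lemma edges_at_cycle_vertex_subset:
  assumes "is_cycle H vs" "v \<in> set vs" "e \<in> H" "v \<in> e" "e \<notin> cycle_edges vs"
  shows "{f \<in> H. v \<in> f} \<subseteq> cycle_edges vs \<union> {e}"
  unfolding edges_at_cycle_vertex(2)[OF assms] by auto

lemma X_on_cycle:
  assumes c: "is_cycle H vs" and v: "v \<in> set vs" "v \<in> X"
  shows "{f \<in> H. v \<in> f} \<subseteq> cycle_edges vs"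
  using edges_at_cycle_vertex(1)[OF c v(1)] X[OF v(2)] by fastforce

lemma deg3_on_cycle:
  assumes c: "is_cycle H vs" and v: "v \<in> set vs" "degree H v = 3"
  obtains e where "e \<in> H" "v \<in> e" "e \<notin> cycle_edges vs"
proof -
  have "\<not> {f \<in> H. v \<in> f} \<subseteq> {f \<in> cycle_edges vs. v \<in> f}"
  proof
    assume "{f \<in> H. v \<in> f} \<subseteq> {f \<in> cycle_edges vs. v \<in> f}"
    then have "{f \<in> H. v \<in> f} = {f \<in> cycle_edges vs. v \<in> f}" using cycle_sub[OF c] by blast
    then show False using card_cycle_edges_at[OF c v(1)] v(2) by (simp add: degree_def)
  qed
  then show thesis using that by blast
qed

text \<open>If the inward edge \<open>e\<close> does not end on the cycle, let \<open>T\<close> be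
  the set reachable from its other end off the cycle. As \<open>e\<close> is no bridge, a second
  edge \<open>f\<close> leaves \<open>T\<close>, and by maximality of \<open>T\<close> it ends on
  the cycle. It does not end in \<open>a\<close>, whose only edge off the cycle is \<open>e\<close>.
  Only the first edge has to lie in \<open>R\<close>; \<open>theta_split\<close> takes care of the
  others.\<close>

lemma ear_exists:
  assumes c: "is_cycle H vs" and R: "img (cycle_edges vs) \<inter> R = {}" and a: "a \<in> set vs" "inward R a"
  obtains b zs e where "b \<in> set vs" "b \<noteq> a" "distinct zs" "set zs \<inter> set vs = {}"
    "path_edges (a # zs @ [b]) \<subseteq> H" "e \<in> path_edges (a # zs @ [b])" "open_edge e \<subseteq> R"
proof -
  obtain e where e: "e \<in> H" "a \<in> e" "open_edge e \<subseteq> R" using a(2) unfolding inward_def by blast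
  have eC: "e \<notin> cycle_edges vs"
    using not_open_edge_subset[OF _ cycle_sub[OF c], of e R] R e(3) by blast
  have edges_a: "{f \<in> H. a \<in> f} = insert e {f \<in> cycle_edges vs. a \<in> f}"
    by (rule edges_at_cycle_vertex(2)[OF c a(1) e(1,2) eC])
  obtain u where u: "e = {a, u}" "u \<noteq> a" using two_edges_at[of e a] card2 e by blast
  show thesis
  proof (cases "u \<in> set vs")
    case True
    then show thesis using that[of u "[]" e] u e by auto
  next
    case False
    define T where "T = {t. \<exists>q. distinct q \<and> q \<noteq> [] \<and> hd q = u \<and> last q = t \<and>
      path_edges q \<subseteq> H \<and> set q \<inter> set vs = {}}"
    have uT: "u \<in> T" unfolding T_def using False by (intro CollectI exI[of _ "[u]"]) auto
    have Tvs: "T \<inter> set vs = {}" unfolding T_def by (auto simp: disjoint_iff)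
    have TH: "T \<subseteq> \<Union> H"
    proof
      fix t assume "t \<in> T"
      then obtain q where q: "q \<noteq> []" "hd q = u" "last q = t" "path_edges q \<subseteq> H"
        unfolding T_def by blast
      show "t \<in> \<Union> H"
      proof (cases "2 \<le> length q")
        case True
        then have "t \<in> \<Union> (path_edges q)" unfolding Union_path_edges[OF True] using q by auto
        then show ?thesis using q(4) by blast
      next
        case False
        then have "length q = 1" using q(1) by (cases q; cases "tl q") auto
        then have "t = u" using q by (auto simp: length_Suc_conv)
        then show ?thesis using u e by blast
      qed
    qed
    have "a \<in> \<Union> H" using e by blast
    then have "T \<noteq> \<Union> H" using Tvs a(1) by blast
    then have "2 \<le> card {f \<in> H. f \<inter> T \<noteq> {} \<and> \<not> f \<subseteq> T}" using bridgeless[OF TH] uT by blast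
    then have "\<not> {f \<in> H. f \<inter> T \<noteq> {} \<and> \<not> f \<subseteq> T} \<subseteq> {e}"
      using card_mono[of "{e}" "{f \<in> H. f \<inter> T \<noteq> {} \<and> \<not> f \<subseteq> T}"] by auto
    then obtain f where f: "f \<in> H" "f \<inter> T \<noteq> {}" "\<not> f \<subseteq> T" "f \<noteq> e" by blast
    then obtain t where t: "t \<in> f" "t \<in> T" by blast
    obtain b where b: "f = {t, b}" "b \<noteq> t" using two_edges_at[of f t] card2 f(1) t(1) by blast
    have bT: "b \<notin> T" using f(3) b t by blast
    obtain q where q: "distinct q" "q \<noteq> []" "hd q = u" "last q = t" "path_edges q \<subseteq> H" "set q \<inter> set vs = {}"
      using t(2) unfolding T_def by blast
    have bvs: "b \<in> set vs"
    proof (rule ccontr)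
      assume nb: "b \<notin> set vs"
      show False
      proof (cases "b \<in> set q")
        case True
        then obtain q1 q2 where q12: "q = q1 @ b # q2" by (meson in_set_conv_decomp)
        have "hd (q1 @ [b]) = u" using q(3) q12 by (cases q1) auto
        moreover have "path_edges (q1 @ [b]) \<subseteq> H" using q(5) path_edges_append[of q1 b q2] unfolding q12 by blast
        ultimately have "b \<in> T" unfolding T_def using q q12
          by (intro CollectI exI[of _ "q1 @ [b]"]) auto
        then show False using bT by simp
      next
        case False
        have "path_edges (q @ [b]) \<subseteq> H"
          using q(2,4,5) f(1) b(1) by (simp add: path_edges_snoc)
        then have "b \<in> T" unfolding T_def using q False nb
          by (intro CollectI exI[of _ "q @ [b]"]) (auto simp: hd_append)
        then show False using bT by simp
      qed
    qed
    have "b \<noteq> a"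
    proof
      assume "b = a"
      then have "f \<in> {f \<in> H. a \<in> f}" using f(1) b(1) by simp
      then have "f \<in> cycle_edges vs" unfolding edges_a using f(4) by simp
      then have "t \<in> set vs" using cycle_vertices[OF c] t(1) by blast
      then show False using Tvs t(2) by blast
    qed
    obtain q' where q': "q = u # q'" using q(2,3) by (cases q) auto
    have pe: "path_edges (a # q @ [b]) = insert e (insert f (path_edges q))"
      using path_edges_snoc[OF q(2), of b] q(4) b(1) u(1) q' by simp
    show thesis
    proof (rule that[OF bvs \<open>b \<noteq> a\<close> q(1,6)])
      show "path_edges (a # q @ [b]) \<subseteq> H" unfolding pe using e f q by blast
      show "e \<in> path_edges (a # q @ [b])" unfolding pe by blast
      show "open_edge e \<subseteq> R" by (rule e(3))
    qed
  qed
qed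

text \<open>The discrete Gauss-Bonnet argument: a side of a cycle in a cubic plane graph with all faces of
  length at least 6 has at least 6 more outward than inward edges. An ear through the side splits
  it into two sides, and both ends of the ear turn outward in each part.\<close>

lemma total_turn:
  assumes "is_cycle H vs" "R \<in> sides (img (cycle_edges vs))"
  shows "6 \<le> (\<Sum>v\<in>set vs \<inter> B. turn R v) + 2 * int (card {x \<in> X. p x \<in> R})"
  using assms
proof (induction "card {e \<in> H. open_edge e \<subseteq> R}" arbitrary: vs R rule: less_induct)
  case less
  note c = less.prems(1) and R = less.prems(2)
  have jC: "jordan_curve (img (cycle_edges vs))" by (rule jordan_curve_cycle[OF c])
  have Rdis: "R \<inter> img (cycle_edges vs) = {}" by (rule side_facts(4)[OF jC R])
  have finX: "finite X"
  proof (rule finite_subset)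
    show "X \<subseteq> \<Union> H" using X by blast
    show "finite (\<Union> H)" by (rule finite_Union_edges[OF card2 fin])
  qed
  show ?case
  proof (cases "\<exists>a\<in>set vs. inward R a")
    case False
    then have "(\<Sum>v\<in>set vs \<inter> B. turn R v) = (\<Sum>v\<in>set vs \<inter> B. 1)"
      by (intro sum.cong) (auto simp: turn_def)
    also have "\<dots> = int (card {v \<in> set vs. v \<in> X \<or> degree H v = 3})"
      by (simp add: B_def Int_def)
    \<comment> \<open>Without inward edges every branch vertex of the cycle counts +1, and
      \<open>long\<close> provides six of them.\<close>
    finally show ?thesis using long[OF c] by simp
  next
    case True
    then obtain a where a: "a \<in> set vs" "inward R a" by blast
    have "img (cycle_edges vs) \<inter> R = {}" using Rdis by blast
    then obtain b zs e where ear: "b \<in> set vs" "b \<noteq> a" "distinct zs" "set zs \<inter> set vs = {}"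
        "path_edges (a # zs @ [b]) \<subseteq> H" "e \<in> path_edges (a # zs @ [b])" "open_edge e \<subseteq> R"
      using ear_exists[OF c _ a] by blast
    obtain xs ys' where dec: "is_cycle H (a # xs @ b # ys')" "set (a # xs @ b # ys') = set vs"
        "cycle_edges (a # xs @ b # ys') = cycle_edges vs"
      using cycle_decomposition[OF c a(1) ear(1) ear(2)[symmetric]] .
    define ys where "ys = rev ys'"
    define A1 where "A1 = path_edges (a # xs @ [b])"
    define A2 where "A2 = path_edges (a # ys @ [b])"
    define P where "P = path_edges (a # zs @ [b])"
    have C: "cycle_edges vs = A1 \<union> A2"
      using dec(3) cycle_edges_two_paths[of a xs b ys'] by (simp add: A1_def A2_def ys_def)
    have sub: "A1 \<subseteq> H" "A2 \<subseteq> H" "P \<subseteq> H" using cycle_sub[OF c] ear(5) unfolding C P_def by auto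
    have set_vs: "set vs = insert a (insert b (set xs \<union> set ys))" using dec(2) by (auto simp: ys_def)
    have dist: "distinct (a # b # xs @ ys @ zs)"
      using dec(1) ear(3,4) set_vs by (auto simp: is_cycle_def ys_def)
    have len: "3 \<le> length (a # xs @ b # ys')" using dec(1) by (simp add: is_cycle_def)
    have eC: "e \<notin> A1 \<union> A2"
      using not_open_edge_subset[OF _ cycle_sub[OF c], of e R] Rdis ear(7) unfolding C by blast
    \<comment> \<open>If the ear and one of the arcs were both single edges, they would coincide,
      but \<open>e\<close> lies on the ear and not on the cycle.\<close>
    have ne: "xs \<noteq> [] \<or> ys \<noteq> []" "xs \<noteq> [] \<or> zs \<noteq> []" "ys \<noteq> [] \<or> zs \<noteq> []"
      using len ear(6) eC by (auto simp: ys_def A1_def A2_def)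
    have UA: "\<Union> A1 = insert a (insert b (set xs))" "\<Union> A2 = insert a (insert b (set ys))"
      "\<Union> P = insert a (insert b (set zs))"
      unfolding A1_def A2_def P_def by (rule Union_path_edges_ends)+
    have RC: "R \<in> sides (img (A1 \<union> A2))" using R unfolding C .
    obtain R1 R2 where R1: "R1 \<in> sides (img (A1 \<union> P))" and R2: "R2 \<in> sides (img (A2 \<union> P))"
        and R12: "R1 \<inter> R2 = {}" and Req: "R1 \<union> R2 \<union> (img P - {p a, p b}) = R"
      using theta_split[OF dist ne sub[unfolded A1_def A2_def P_def] RC[unfolded A1_def A2_def] ear(6,7)]
      unfolding A1_def[symmetric] A2_def[symmetric] P_def[symmetric] by blast
    define vs1 where "vs1 = a # xs @ b # rev zs"
    define vs2 where "vs2 = a # ys @ b # rev zs"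
    have C1: "cycle_edges vs1 = A1 \<union> P" and C2: "cycle_edges vs2 = A2 \<union> P"
      by (simp_all add: vs1_def vs2_def A1_def A2_def P_def cycle_edges_two_paths)
    have "3 \<le> length vs1" "3 \<le> length vs2" using ne by (auto simp: vs1_def vs2_def Suc_le_eq)
    then have cyc1: "is_cycle H vs1" and cyc2: "is_cycle H vs2"
      unfolding is_cycle_iff C1 C2 using sub dist by (auto simp: vs1_def vs2_def)
    have j: "jordan_curve (img (A1 \<union> A2))" "jordan_curve (img (A1 \<union> P))" "jordan_curve (img (A2 \<union> P))"
      using jC jordan_curve_cycle[OF cyc1] jordan_curve_cycle[OF cyc2] unfolding C C1 C2 by blast+
    have dis1: "R1 \<inter> img (A1 \<union> P) = {}" and dis2: "R2 \<inter> img (A2 \<union> P) = {}"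
      using side_facts(4)[OF j(2) R1] side_facts(4)[OF j(3) R2] by blast+
    have Rdis': "R \<inter> img (A1 \<union> A2) = {}" using Rdis unfolding C .
    have nonin: "img (A1 \<union> A2 \<union> P) \<inter> R1 = {}" "img (A1 \<union> A2 \<union> P) \<inter> R2 = {}"
      using Rdis' dis1 dis2 Req unfolding img_Un by blast+
    have subP: "A1 \<union> A2 \<union> P \<subseteq> H" using sub by blast
    have PH: "P \<inter> (A1 \<union> A2) = {}"
    proof -
      have "path_edges (a # zs @ [b]) \<inter> path_edges (a # xs @ [b]) = {}"
        "path_edges (a # zs @ [b]) \<inter> path_edges (a # ys @ [b]) = {}"
        using dist ne sub(3) card2 by (intro path_edges_disjoint; auto simp: P_def)+
      then show ?thesis unfolding P_def A1_def A2_def by blast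
    qed
    have abH: "a \<in> \<Union> H" "b \<in> \<Union> H" by (rule vertex_in_H[OF sub(3)], simp add: UA(3))+
    have Pin: "open_edge f \<subseteq> R" if "f \<in> P" for f
    proof -
      have fH: "f \<in> H" using that sub by blast
      have "p a \<notin> open_edge f" "p b \<notin> open_edge f"
        using edge_arc(3)[OF fH] abH unfolding open_edge_def by blast+
      then show ?thesis using open_edge_subset_img[OF that] Req by blast
    qed
    \<comment> \<open>The third edge at an end of the ear belongs to the ear. It points into
      \<open>R\<close>, but lies on the boundary of both parts and so enters neither of
      them.\<close>
    have end_facts: "v \<in> B \<and> turn R v = -1 \<and> turn R1 v = 1 \<and> turn R2 v = 1" if "v = a \<or> v = b" for v
    proof -
      have "v \<in> \<Union> P" using that unfolding UA by auto
      then obtain f where f: "f \<in> P" "v \<in> f" by blast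
      have vvs: "v \<in> set vs" using that a ear(1) by blast
      have fH: "f \<in> H" using f sub by blast
      have fC: "f \<notin> cycle_edges vs" unfolding C using f PH by blast
      have "degree H v = 3" by (rule edges_at_cycle_vertex(1)[OF c vvs fH f(2) fC])
      then have "v \<in> B" by (simp add: B_def)
      moreover have "inward R v" unfolding inward_def using fH f(2) Pin[OF f(1)] by blast
      moreover have all: "{f \<in> H. v \<in> f} \<subseteq> A1 \<union> A2 \<union> P"
        by (rule order_trans[OF edges_at_cycle_vertex_subset[OF c vvs fH f(2) fC]]) (simp add: C f(1))
      have "\<not> inward R1 v" "\<not> inward R2 v"
        by (rule not_inward[OF all subP nonin(1)], rule not_inward[OF all subP nonin(2)])
      ultimately show ?thesis by (simp add: turn_def)
    qed
    have S: "img P - {p a, p b} \<subseteq> img P" by blast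
    have turn_xs: "turn R1 v = turn R v" if "v \<in> set xs" for v
    proof -
      have "v \<in> \<Union> A1" "v \<notin> \<Union> A2" "v \<notin> \<Union> P" unfolding UA using that dist by auto
      then have "inward R v \<longleftrightarrow> inward R1 v"
        by (rule inward_transfer[OF sub j(2,3) R1 R2 Req S Rdis'])
      then show ?thesis by (simp add: turn_def)
    qed
    have turn_ys: "turn R2 v = turn R v" if "v \<in> set ys" for v
    proof -
      have v: "v \<in> \<Union> A2" "v \<notin> \<Union> A1" "v \<notin> \<Union> P" unfolding UA using that dist by auto
      have "R2 \<union> R1 \<union> (img P - {p a, p b}) = R" "R \<inter> img (A2 \<union> A1) = {}"
        using Req Rdis' by (simp_all add: Un_commute)
      then have "inward R v \<longleftrightarrow> inward R2 v"
        by (intro inward_transfer[OF sub(2,1,3) j(3,2) R2 R1 _ S _ v])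
      then show ?thesis by (simp add: turn_def)
    qed
    have zs_in: "v \<in> \<Union> H \<and> p v \<in> R" if "v \<in> set zs" for v
    proof -
      have vP: "v \<in> \<Union> P" unfolding UA using that by simp
      have vH: "v \<in> \<Union> H" by (rule vertex_in_H[OF sub(3) vP])
      have "v \<noteq> a" "v \<noteq> b" using that dist by auto
      then have "p v \<noteq> p a" "p v \<noteq> p b" using p_eq[OF vH] abH by blast+
      moreover have "p v \<in> img P" using vertex_in_img[OF sub(3) vH] vP by blast
      ultimately show ?thesis using vH Req by blast
    qed
    have turn_zs: "turn R1 v + turn R2 v = (if v \<in> X then 2 else 0)" if "v \<in> set zs" "v \<in> B" for v
    proof -
      have vvs1: "v \<in> set vs1" using that by (simp add: vs1_def)
      have nA: "v \<notin> \<Union> A1" "v \<notin> \<Union> A2" unfolding UA using that dist by auto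
      show ?thesis
      proof (cases "v \<in> X")
        case True
        have all: "{f \<in> H. v \<in> f} \<subseteq> A1 \<union> A2 \<union> P"
          by (rule order_trans[OF X_on_cycle[OF cyc1 vvs1 True]]) (auto simp: C1)
        have "\<not> inward R1 v" "\<not> inward R2 v"
          by (rule not_inward[OF all subP nonin(1)], rule not_inward[OF all subP nonin(2)])
        then show ?thesis using True by (simp add: turn_def)
      next
        case False
        then have d3: "degree H v = 3" using that(2) by (simp add: B_def)
        obtain e0 where e0: "e0 \<in> H" "v \<in> e0" "e0 \<notin> cycle_edges vs1"
          using deg3_on_cycle[OF cyc1 vvs1 d3] .
        have "{f \<in> H. v \<in> f} = insert e0 {f \<in> cycle_edges vs1. v \<in> f}"
          by (rule edges_at_cycle_vertex(2)[OF cyc1 vvs1 e0])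
        also have "{f \<in> cycle_edges vs1. v \<in> f} = {f \<in> P. v \<in> f}"
          unfolding C1 using nA(1) by auto
        finally have at: "{f \<in> H. v \<in> f} = insert e0 {f \<in> P. v \<in> f}" .
        have "e0 \<notin> P" using e0(3) unfolding C1 by blast
        then have "inward R1 v \<longleftrightarrow> \<not> inward R2 v"
          using zs_in[OF that(1)] by (intro inward_on_ear[OF sub j RC R1 R2 Req S R12 nA _ at]) simp_all
        moreover have "v \<notin> X" using False .
        ultimately show ?thesis by (simp add: turn_def)
      qed
    qed
    have "e \<in> P" using ear(6) by (simp add: P_def)
    have less: "card {f \<in> H. open_edge f \<subseteq> R'} < card {f \<in> H. open_edge f \<subseteq> R}"
      if "R' \<subseteq> R" "img (A1 \<union> A2 \<union> P) \<inter> R' = {}" for R'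
    proof (rule psubset_card_mono)
      show "finite {f \<in> H. open_edge f \<subseteq> R}" using fin by simp
      have "\<not> open_edge e \<subseteq> R'" using \<open>e \<in> P\<close> by (intro not_open_edge_subset[OF _ subP that(2)]) blast
      then show "{f \<in> H. open_edge f \<subseteq> R'} \<subset> {f \<in> H. open_edge f \<subseteq> R}"
        using that(1) ear(7) \<open>e \<in> P\<close> sub by blast
    qed
    have IH1: "6 \<le> (\<Sum>v\<in>set vs1 \<inter> B. turn R1 v) + 2 * int (card {x \<in> X. p x \<in> R1})"
      using Req by (intro less.hyps less nonin cyc1) (auto simp: C1 R1)
    have IH2: "6 \<le> (\<Sum>v\<in>set vs2 \<inter> B. turn R2 v) + 2 * int (card {x \<in> X. p x \<in> R2})"
      using Req by (intro less.hyps less nonin cyc2) (auto simp: C2 R2)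
    have ab: "a \<in> B" "b \<in> B" using end_facts by blast+
    have s0: "(\<Sum>v\<in>set vs \<inter> B. turn R v) = - 2 + (\<Sum>v\<in>set xs \<inter> B. turn R v) + (\<Sum>v\<in>set ys \<inter> B. turn R v)"
    proof -
      have "set vs = set (a # xs @ b # ys)" using set_vs by auto
      then show ?thesis using sum_two_paths[of a b xs ys B "turn R"] dist ab end_facts by auto
    qed
    have s1: "(\<Sum>v\<in>set vs1 \<inter> B. turn R1 v) = 2 + (\<Sum>v\<in>set xs \<inter> B. turn R v) + (\<Sum>v\<in>set zs \<inter> B. turn R1 v)"
    proof -
      have "(\<Sum>v\<in>set xs \<inter> B. turn R1 v) = (\<Sum>v\<in>set xs \<inter> B. turn R v)"
        using turn_xs by (intro sum.cong) auto
      then show ?thesis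
        using sum_two_paths[of a b xs "rev zs" B "turn R1"] dist ab end_facts unfolding vs1_def by auto
    qed
    have s2: "(\<Sum>v\<in>set vs2 \<inter> B. turn R2 v) = 2 + (\<Sum>v\<in>set ys \<inter> B. turn R v) + (\<Sum>v\<in>set zs \<inter> B. turn R2 v)"
    proof -
      have "(\<Sum>v\<in>set ys \<inter> B. turn R2 v) = (\<Sum>v\<in>set ys \<inter> B. turn R v)"
        using turn_ys by (intro sum.cong) auto
      then show ?thesis
        using sum_two_paths[of a b ys "rev zs" B "turn R2"] dist ab end_facts unfolding vs2_def by auto
    qed
    have "(\<Sum>v\<in>set zs \<inter> B. turn R1 v) + (\<Sum>v\<in>set zs \<inter> B. turn R2 v)
        = (\<Sum>v\<in>set zs \<inter> B. if v \<in> X then 2 else 0)"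
      unfolding sum.distrib[symmetric] using turn_zs by (intro sum.cong) auto
    also have "\<dots> = 2 * int (card (set zs \<inter> B \<inter> X))"
      by (simp add: sum.If_cases Int_def conj_ac)
    also have "set zs \<inter> B \<inter> X = X \<inter> set zs" by (auto simp: B_def)
    finally have s3: "(\<Sum>v\<in>set zs \<inter> B. turn R1 v) + (\<Sum>v\<in>set zs \<inter> B. turn R2 v) = 2 * int (card (X \<inter> set zs))" .
    have "{x \<in> X. p x \<in> R} = {x \<in> X. p x \<in> R1} \<union> {x \<in> X. p x \<in> R2} \<union> (X \<inter> set zs)"
    proof (intro equalityI subsetI)
      fix x assume x: "x \<in> {x \<in> X. p x \<in> R}"
      then have xH: "x \<in> \<Union> H" using X by blast
      have "x \<in> set zs" if "p x \<in> img P - {p a, p b}"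
      proof -
        have "x \<in> \<Union> P" using that vertex_in_img[OF sub(3) xH] by blast
        moreover have "x \<noteq> a" "x \<noteq> b" using that by auto
        ultimately show ?thesis unfolding UA by blast
      qed
      then show "x \<in> {x \<in> X. p x \<in> R1} \<union> {x \<in> X. p x \<in> R2} \<union> (X \<inter> set zs)"
        using x Req by blast
    next
      fix x assume "x \<in> {x \<in> X. p x \<in> R1} \<union> {x \<in> X. p x \<in> R2} \<union> (X \<inter> set zs)"
      then show "x \<in> {x \<in> X. p x \<in> R}" using Req zs_in by blast
    qed
    moreover have "X \<inter> set zs \<inter> ({x \<in> X. p x \<in> R1} \<union> {x \<in> X. p x \<in> R2}) = {}"
    proof (rule equals0I)
      fix x assume x: "x \<in> X \<inter> set zs \<inter> ({x \<in> X. p x \<in> R1} \<union> {x \<in> X. p x \<in> R2})"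
      then have "x \<in> \<Union> P" unfolding UA by blast
      then have "p x \<in> img P" using vertex_in_img[OF sub(3)] X x by blast
      then show False using x nonin unfolding img_Un by blast
    qed
    moreover have "{x \<in> X. p x \<in> R1} \<inter> {x \<in> X. p x \<in> R2} = {}" using R12 by blast
    ultimately have "card {x \<in> X. p x \<in> R} = card {x \<in> X. p x \<in> R1} + card {x \<in> X. p x \<in> R2} + card (X \<inter> set zs)"
      using finX by (simp add: card_Un_disjoint Int_commute)
    \<comment> \<open>At the two ends of the ear -2 becomes 2 + 2, so the turns of the parts add up
      to that of \<open>R\<close> plus 6, plus 2 for each marked vertex on the ear. The bound for
      \<open>R\<close> is therefore 6 + 6 - 6 = 6: the constant 6 reproduces itself.\<close>
    then show ?thesis using IH1 IH2 s0 s1 s2 s3 by linarith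
  qed
qed

text \<open>Adding the bounds of \<open>total_turn\<close> for both sides gives at least 12. The
  third edge at a vertex of degree 3 lies on one side, so its turns cancel or sum to less; each
  marked vertex contributes 2, whether it is inside, outside or on the cycle. Hence 12 \<le> 2 *
  \<open>card X\<close>.\<close>

lemma cycle_imp_card_X:
  assumes c: "is_cycle H vs"
  shows "6 \<le> card X"
proof -
  let ?K = "img (cycle_edges vs)"
  have j: "jordan_curve ?K" by (rule jordan_curve_cycle[OF c])
  note J = jordan_curve_sides[OF j]
  have finX: "finite X"
  proof (rule finite_subset)
    show "X \<subseteq> \<Union> H" using X by blast
    show "finite (\<Union> H)" by (rule finite_Union_edges[OF card2 fin])
  qed
  have "turn (inside ?K) v + turn (outside ?K) v \<le> (if v \<in> X then 2 else 0)" if v: "v \<in> set vs \<inter> B" for v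
  proof (cases "v \<in> X")
    case True
    then show ?thesis by (simp add: turn_def)
  next
    case False
    then have "degree H v = 3" using v by (simp add: B_def)
    then obtain e where e: "e \<in> H" "v \<in> e" "e \<notin> cycle_edges vs"
      using deg3_on_cycle[OF c, of v] v by blast
    have dis: "open_edge e \<inter> ?K = {}" by (rule open_edge_disjoint[OF e(1) cycle_sub[OF c] e(3)])
    then have "open_edge e \<inter> inside ?K \<noteq> {} \<or> open_edge e \<inter> outside ?K \<noteq> {}"
      using open_edge_nonempty[OF e(1)] J(10) by blast
    then have "open_edge e \<subseteq> inside ?K \<or> open_edge e \<subseteq> outside ?K"
      using connected_in_side[OF j _ connected_open_edge[OF e(1)] dis] by (auto simp: sides_def)
    then have "inward (inside ?K) v \<or> inward (outside ?K) v" unfolding inward_def using e by blast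
    then show ?thesis using False by (auto simp: turn_def)
  qed
  then have "(\<Sum>v\<in>set vs \<inter> B. turn (inside ?K) v + turn (outside ?K) v)
      \<le> (\<Sum>v\<in>set vs \<inter> B. if v \<in> X then 2 else 0)"
    by (rule sum_mono)
  also have "\<dots> = 2 * int (card (set vs \<inter> B \<inter> X))"
    by (simp add: sum.If_cases Int_def conj_ac)
  also have "set vs \<inter> B \<inter> X = X \<inter> set vs" by (auto simp: B_def)
  finally have sum: "(\<Sum>v\<in>set vs \<inter> B. turn (inside ?K) v) + (\<Sum>v\<in>set vs \<inter> B. turn (outside ?K) v)
      \<le> 2 * int (card (X \<inter> set vs))"
    by (simp add: sum.distrib)
  have on: "p x \<in> ?K" if "x \<in> set vs" for x
  proof -
    have "x \<in> \<Union> (cycle_edges vs)" using cycle_vertices[OF c] that by blast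
    then show ?thesis using vertex_in_img[OF cycle_sub[OF c]] vertex_in_H[OF cycle_sub[OF c]] by blast
  qed
  have dis: "{x \<in> X. p x \<in> inside ?K} \<inter> {x \<in> X. p x \<in> outside ?K} = {}" using J(9) by blast
  have nin: "({x \<in> X. p x \<in> inside ?K} \<union> {x \<in> X. p x \<in> outside ?K}) \<inter> (X \<inter> set vs) = {}"
    using on J(10) by blast
  have "card ({x \<in> X. p x \<in> inside ?K} \<union> {x \<in> X. p x \<in> outside ?K} \<union> (X \<inter> set vs)) \<le> card X"
    using finX by (intro card_mono) auto
  also have "card ({x \<in> X. p x \<in> inside ?K} \<union> {x \<in> X. p x \<in> outside ?K} \<union> (X \<inter> set vs))
      = card {x \<in> X. p x \<in> inside ?K} + card {x \<in> X. p x \<in> outside ?K} + card (X \<inter> set vs)"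
    using finX nin dis by (simp add: card_Un_disjoint)
  finally have card: "card {x \<in> X. p x \<in> inside ?K} + card {x \<in> X. p x \<in> outside ?K} + card (X \<inter> set vs) \<le> card X" .
  have "6 \<le> (\<Sum>v\<in>set vs \<inter> B. turn (inside ?K) v) + 2 * int (card {x \<in> X. p x \<in> inside ?K})"
    "6 \<le> (\<Sum>v\<in>set vs \<inter> B. turn (outside ?K) v) + 2 * int (card {x \<in> X. p x \<in> outside ?K})"
    using total_turn[OF c] by (simp_all add: sides_def)
  then show ?thesis using sum card by linarith
qed

end

section \<open>Planar graphs of large girth contain long threads\<close>

lemma planar_drawing_restrict:
  assumes d: "planar_drawing V E p \<gamma>" and H: "H \<subseteq> E" "\<Union> H \<subseteq> V"
  shows "planar_drawing (\<Union> H) H p \<gamma>"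
  unfolding planar_drawing_def
proof (intro conjI ballI impI)
  have inj: "inj_on p V"
    and edge: "\<And>e. e \<in> E \<Longrightarrow> arc (\<gamma> e) \<and> {pathstart (\<gamma> e), pathfinish (\<gamma> e)} = p ` e \<and>
      path_image (\<gamma> e) \<inter> p ` V = p ` e"
    and meet: "\<And>e f. e \<in> E \<Longrightarrow> f \<in> E \<Longrightarrow> e \<noteq> f \<Longrightarrow>
      path_image (\<gamma> e) \<inter> path_image (\<gamma> f) = p ` (e \<inter> f)"
    using d unfolding planar_drawing_def by simp_all
  show "inj_on p (\<Union> H)" using inj H(2) by (rule inj_on_subset)
  fix e assume e: "e \<in> H"
  then have eE: "e \<in> E" using H by blast
  show "arc (\<gamma> e)" "{pathstart (\<gamma> e), pathfinish (\<gamma> e)} = p ` e" using edge[OF eE] by simp_all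
  have im: "path_image (\<gamma> e) \<inter> p ` V = p ` e" using edge[OF eE] by simp
  show "path_image (\<gamma> e) \<inter> p ` \<Union> H = p ` e"
  proof
    show "path_image (\<gamma> e) \<inter> p ` \<Union> H \<subseteq> p ` e" using im H(2) by blast
    show "p ` e \<subseteq> path_image (\<gamma> e) \<inter> p ` \<Union> H" using im e by blast
  qed
  fix f assume "f \<in> H" "e \<noteq> f"
  then show "path_image (\<gamma> e) \<inter> path_image (\<gamma> f) = p ` (e \<inter> f)"
    using meet[OF eE] H(1) by blast
qed

text \<open>With minimum degree 2 a walk without immediate reversal can be continued until it has
  more steps than there are vertices, and a repetition yields a cycle.\<close>

lemma cycle_exists:
  assumes F: "\<forall>e\<in>F. card e = 2" "finite F" "F \<noteq> {}" and deg: "\<forall>x\<in>\<Union> F. 2 \<le> degree F x"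
  shows "\<exists>vs. is_cycle F vs"
proof -
  have walk: "\<exists>v. nb_walk F v (Suc n)" for n
  proof (induction n)
    case 0
    obtain e where e: "e \<in> F" using F(3) by blast
    then obtain x y where "e = {x, y}" using F(1) by (meson card_2_iff)
    then show ?case using e
      by (intro exI[of _ "case_nat x (\<lambda>_. y)"]) (simp add: nb_walk_def)
  next
    case (Suc n)
    then obtain v where v: "nb_walk F v (Suc n)" by blast
    then have "{v n, v (Suc n)} \<in> F" by (simp add: nb_walk_def)
    then have "2 \<le> degree F (v (Suc n))" using deg by blast
    then show ?case using nb_walk_append[OF F(1) v] by metis
  qed
  define n where "n = card (\<Union> F)"
  obtain v where v: "nb_walk F v (Suc n)" using walk by blast
  have "v ` {..n} \<subseteq> \<Union> F" using v by (auto simp: nb_walk_def less_Suc_eq_le)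
  then have "card (v ` {..n}) \<le> n"
    unfolding n_def using finite_Union_edges[OF F(1,2)] by (intro card_mono)
  then have "\<not> inj_on v {..n}" by (intro pigeonhole) simp
  then obtain i j where ij: "i \<in> {..n}" "j \<in> {..n}" "v i = v j" "i < j"
    by (metis linorder_inj_onI')
  then show ?thesis using nb_walk_cycle[OF F(1) v, of i j] by auto
qed

text \<open>Every window of 8 consecutive vertices contains one of degree 3. Beginning at a vertex
  of degree 3 and taking one from each of the next five windows keeps all six positions within a
  range of 40 steps, less than the cycle length, so they are distinct vertices.\<close>

lemma long_cycle_branch_vertices:
  assumes deg: "\<forall>x\<in>\<Union> F. degree F x \<in> {2, 3}" and no: "\<not> has_thread F"
    and c: "is_cycle F vs" and len: "41 \<le> length vs"
  shows "6 \<le> card {v \<in> set vs. degree F v = 3}"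
proof -
  define n where "n = length vs"
  define w where "w i = vs ! (i mod n)" for i
  have n: "41 \<le> n" using len by (simp add: n_def)
  have dist: "distinct vs" using c by (simp add: is_cycle_def)
  have modn: "i mod n < length vs" for i
    unfolding n_def using len by (intro mod_less_divisor) linarith
  have edge: "{w i, w (Suc i)} \<in> F" for i
  proof -
    have "{vs ! (i mod n), vs ! (Suc (i mod n) mod length vs)} \<in> F"
      using c modn[of i] unfolding is_cycle_def by blast
    then show ?thesis unfolding w_def n_def by (simp add: mod_Suc_eq)
  qed
  have inj: "i = j" if "w i = w j" "i < j + n" "j < i + n" for i j
  proof -
    have "i mod n = j mod n"
      using that(1) modn[of i] modn[of j] unfolding w_def by (simp add: nth_eq_iff_index_eq[OF dist])
    moreover have "i = j" if "i mod n = j mod n" "i \<le> j" "j < i + n" for i j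
    proof -
      have "n dvd j - i" using that mod_eq_dvd_iff_nat[of i j n] by simp
      moreover have "j - i < n" using that by linarith
      ultimately have "j - i = 0" by (meson dvd_imp_le not_less zero_less_iff_neq_zero)
      then show ?thesis using that(2) by simp
    qed
    ultimately show ?thesis using that by (metis nat_le_linear)
  qed
  have w_in: "w i \<in> set vs" for i unfolding w_def by (rule nth_mem[OF modn])
  have window: "\<exists>j. i < j \<and> j \<le> i + 8 \<and> degree F (w j) = 3" for i
  proof (rule ccontr)
    assume none: "\<not> ?thesis"
    have "nb_walk F (\<lambda>k. w (i + k)) 9"
      unfolding nb_walk_def
    proof (intro conjI allI impI)
      show "{w (i + k), w (i + Suc k)} \<in> F" for k using edge[of "i + k"] by simp
      show "w (i + k) \<noteq> w (i + Suc (Suc k))" for k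
        using inj[of "i + k" "i + Suc (Suc k)"] n by auto
    qed
    moreover have "degree F (w (i + k)) = 2" if "k \<in> {1..8}" for k
    proof -
      have "w (i + k) \<in> \<Union> F" using edge[of "i + k"] by blast
      then have "degree F (w (i + k)) \<in> {2, 3}" using deg by blast
      moreover have "degree F (w (i + k)) \<noteq> 3" using none that by auto
      ultimately show ?thesis by simp
    qed
    ultimately show False using no unfolding has_thread_def by blast
  qed
  obtain j where j: "degree F (w j) = 3" using window[of 0] by blast
  obtain g where g: "\<And>t. j + 8 * t < g t \<and> g t \<le> j + 8 * t + 8 \<and> degree F (w (g t)) = 3"
  proof -
    have "\<forall>t. \<exists>k. j + 8 * t < k \<and> k \<le> j + 8 * t + 8 \<and> degree F (w k) = 3"
      using window by blast
    from choice[OF this] show thesis using that by blast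
  qed
  define J where "J = insert j (g ` {..<5})"
  have less: "g s < g t" if "s < t" for s t
    using g[of s] g[of t] that by linarith
  have "inj_on g {..<5}"
  proof (rule linorder_inj_onI)
    show "g s \<noteq> g t" if "s < t" for s t using less[OF that] by simp
  qed auto
  moreover have "j < g t" for t using g[of t] by linarith
  then have "j \<notin> g ` {..<5}" by (auto simp: less_le)
  ultimately have cardJ: "card J = 6" by (simp add: J_def card_image)
  have range: "j \<le> i \<and> i \<le> j + 40" if "i \<in> J" for i
  proof -
    have "j \<le> g t \<and> g t \<le> j + 40" if "t < 5" for t using g[of t] that by linarith
    then show ?thesis using that by (auto simp: J_def)
  qed
  have "inj_on w J"
  proof (rule inj_onI)
    fix s t assume "s \<in> J" "t \<in> J" "w s = w t"
    then show "s = t" using inj[of s t] range[of s] range[of t] n by linarith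
  qed
  then have "6 = card (w ` J)" using cardJ by (simp add: card_image)
  also have "\<dots> \<le> card {v \<in> set vs. degree F v = 3}"
    using w_in j g by (intro card_mono) (auto simp: J_def)
  finally show ?thesis .
qed

text \<open>A vertex set with at most one boundary edge, minimal with this property, induces a bridgeless
  graph. At most one of its vertices loses an edge.\<close>

lemma has_thread_if_planar:
  assumes G: "simple_graph V E" and pl: "planar V E"
    and girth: "\<And>vs. is_cycle E vs \<Longrightarrow> 41 \<le> length vs"
    and F: "F \<subseteq> E" "F \<noteq> {}" and deg: "\<forall>x\<in>\<Union> F. degree F x \<in> {2, 3}"
  shows "has_thread F"
proof (rule ccontr)
  assume no: "\<not> has_thread F"
  have F2: "\<forall>e\<in>F. card e = 2" "finite F"
    using G F(1) finite_edges[OF G] finite_subset by (auto simp: simple_graph_def)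
  have finU: "finite (\<Union> F)" by (rule finite_Union_edges[OF F2])
  define bd where "bd S = {e \<in> F. e \<inter> S \<noteq> {} \<and> \<not> e \<subseteq> S}" for S
  have fin_bd: "finite (bd S)" for S using F2(2) by (simp add: bd_def)
  define P where "P S \<longleftrightarrow> S \<noteq> {} \<and> S \<subseteq> \<Union> F \<and> card (bd S) \<le> 1" for S
  have "bd (\<Union> F) = {}" by (auto simp: bd_def)
  moreover have "\<Union> F \<noteq> {}"
  proof -
    obtain e where e: "e \<in> F" using F(2) by blast
    then have "e \<noteq> {}" using F2(1) by auto
    then show ?thesis using e by blast
  qed
  ultimately have "P (\<Union> F)" by (simp add: P_def)
  then obtain S where S: "P S" "\<And>T. P T \<Longrightarrow> card S \<le> card T"
    using ex_has_least_nat[of P "\<Union> F" card] by blast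
  have SU: "S \<subseteq> \<Union> F" "S \<noteq> {}" and bdS: "card (bd S) \<le> 1" using S(1) by (auto simp: P_def)
  have finS: "finite S" using SU(1) finU by (rule finite_subset)
  have min: "2 \<le> card (bd T)" if "T \<subset> S" "T \<noteq> {}" for T
  proof (rule ccontr)
    assume "\<not> ?thesis"
    then have "P T" using that SU(1) by (auto simp: P_def)
    then show False using S(2)[of T] psubset_card_mono[OF finS that(1)] by linarith
  qed
  have bd_unique: "e = f" if "e \<in> bd S" "f \<in> bd S" for e f
    using that bdS fin_bd[of S] by (metis One_nat_def card_le_Suc0_iff_eq)
  define H where "H = {e \<in> F. e \<subseteq> S}"
  have HF: "H \<subseteq> F" by (auto simp: H_def)
  have finH: "finite H" using HF F2(2) by (rule finite_subset)
  have cardH: "\<forall>e\<in>H. card e = 2" using F2(1) HF by blast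
  \<comment> \<open>If \<open>v\<close> had degree 2, it would have just one edge \<open>f\<close>
    besides the boundary edge \<open>e\<close>, and \<open>S - {v}\<close> would be a smaller set
    whose only possible boundary edge is \<open>f\<close>.\<close>
  have boundary_deg: "degree F v = 3" if v: "v \<in> S" "e \<in> bd S" "v \<in> e" for v e
  proof (rule ccontr)
    assume n3: "degree F v \<noteq> 3"
    have "degree F v \<in> {2, 3}" using v(1) SU(1) deg by blast
    then have d2: "degree F v = 2" using n3 by simp
    have eF: "e \<in> F" "\<not> e \<subseteq> S" using v(2) by (auto simp: bd_def)
    have eN: "e \<in> {f \<in> F. v \<in> f}" using eF v(3) by simp
    have "card ({f \<in> F. v \<in> f} - {e}) = 1"
      using d2 eN F2(2) by (simp add: degree_def card_Diff_singleton)
    then obtain f where f': "{f \<in> F. v \<in> f} - {e} = {f}" by (rule card_1_singletonE)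
    have f: "{f \<in> F. v \<in> f} = {e, f}" "f \<noteq> e"
      using insert_Diff[OF eN] unfolding f' by (simp, use f' in blast)
    have "f \<in> {f \<in> F. v \<in> f}" unfolding f(1) by simp
    then have fF: "f \<in> F" "v \<in> f" by auto
    have "S \<noteq> {v}"
    proof
      assume Sv: "S = {v}"
      have "\<not> f \<subseteq> {v}" using F2(1) fF(1) card_mono[of "{v}" f] by auto
      then have "f \<in> bd S" using fF Sv by (auto simp: bd_def)
      then show False using bd_unique[OF v(2)] f(2) by blast
    qed
    then have T: "S - {v} \<subset> S" "S - {v} \<noteq> {}" using v(1) by auto
    have "bd (S - {v}) \<subseteq> {f}"
    proof
      fix g assume g: "g \<in> bd (S - {v})"
      have gF: "g \<in> F" using g by (simp add: bd_def)
      show "g \<in> {f}"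
      proof (cases "v \<in> g")
        case True
        then have "g \<in> {f \<in> F. v \<in> f}" using gF by simp
        then have "g = e \<or> g = f" unfolding f(1) by simp
        moreover have "g \<noteq> e"
        proof
          assume "g = e"
          obtain y where y: "e = {v, y}" using two_edges_at[of e v] F2(1) eF(1) v(3) by blast
          then have "y \<notin> S" using eF(2) v(1) by blast
          then have "e \<inter> (S - {v}) = {}" using y by blast
          then show False using g \<open>g = e\<close> by (simp add: bd_def)
        qed
        ultimately show ?thesis by simp
      next
        case False
        then have "g \<in> bd S" using g by (auto simp: bd_def)
        then show ?thesis using bd_unique[OF v(2)] v(3) False by blast
      qed
    qed
    then have "card (bd (S - {v})) \<le> 1" using card_mono[of "{f}"] by fastforce
    then show False using min[OF T] by linarith
  qed
  define X where "X = {v \<in> S. \<exists>e\<in>bd S. v \<in> e}"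
  have degH: "degree F v = degree H v + (if v \<in> X then 1 else 0)" if v: "v \<in> S" for v
  proof -
    have eq: "{e \<in> F. v \<in> e} = {e \<in> H. v \<in> e} \<union> {e \<in> bd S. v \<in> e}"
      using v by (auto simp: H_def bd_def)
    have "{e \<in> H. v \<in> e} \<inter> {e \<in> bd S. v \<in> e} = {}" by (auto simp: H_def bd_def)
    then have "degree F v = degree H v + card {e \<in> bd S. v \<in> e}"
      unfolding degree_def eq using finH fin_bd by (intro card_Un_disjoint) auto
    moreover have "card {e \<in> bd S. v \<in> e} = (if v \<in> X then 1 else 0)"
    proof (cases "v \<in> X")
      case True
      then obtain e where e: "e \<in> bd S" "v \<in> e" by (auto simp: X_def)
      then have "{e \<in> bd S. v \<in> e} = {e}" using bd_unique by blast
      then show ?thesis using True by simp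
    next
      case False
      then have "{e \<in> bd S. v \<in> e} = {}" using v by (auto simp: X_def)
      then show ?thesis using False by (simp only: card.empty if_False)
    qed
    ultimately show ?thesis by simp
  qed
  have X3: "degree F v = 3" if "v \<in> X" for v using that boundary_deg by (auto simp: X_def)
  have degS: "degree H v \<in> {2, 3}" if v: "v \<in> S" for v
  proof -
    have "degree F v \<in> {2, 3}" using v SU(1) deg by blast
    then show ?thesis using degH[OF v] X3[of v] by (cases "v \<in> X") auto
  qed
  have UH: "\<Union> H = S"
  proof
    show "\<Union> H \<subseteq> S" by (auto simp: H_def)
    show "S \<subseteq> \<Union> H"
    proof
      fix v assume "v \<in> S"
      then have "degree H v \<noteq> 0" using degS by fastforce
      then have "{e \<in> H. v \<in> e} \<noteq> {}" unfolding degree_def by (metis card.empty)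
      then show "v \<in> \<Union> H" by blast
    qed
  qed
  have "H \<noteq> {}" using UH SU(2) by auto
  have cardX: "card X \<le> 1"
  proof -
    have "x = y" if xy: "x \<in> X" "y \<in> X" for x y
    proof -
      obtain e where e: "e \<in> bd S" "x \<in> e" using xy(1) by (auto simp: X_def)
      obtain f where f: "f \<in> bd S" "y \<in> f" using xy(2) by (auto simp: X_def)
      have "y \<in> e" using bd_unique[OF e(1) f(1)] f(2) by simp
      have eF: "e \<in> F" "\<not> e \<subseteq> S" using e(1) by (auto simp: bd_def)
      obtain z where "e = {x, z}" using two_edges_at[of e x] F2(1) eF(1) e(2) by blast
      then show ?thesis using \<open>y \<in> e\<close> eF(2) xy by (auto simp: X_def)
    qed
    then show ?thesis using finS by (simp add: X_def card_le_Suc0_iff_eq)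
  qed
  obtain p \<gamma> where drawE: "planar_drawing V E p \<gamma>" using pl unfolding planar_def by blast
  have HV: "\<Union> H \<subseteq> V" using HF F(1) G by (auto simp: simple_graph_def)
  have draw: "planar_drawing (\<Union> H) H p \<gamma>"
    by (rule planar_drawing_restrict[OF drawE _ HV]) (use HF F(1) in blast)
  interpret plane_bridgeless H p \<gamma> X
  proof
    show "finite H" "\<forall>e\<in>H. card e = 2" "planar_drawing (\<Union> H) H p \<gamma>"
      by (fact finH cardH draw)+
    show "degree H v \<in> {2, 3}" if "v \<in> \<Union> H" for v using that degS unfolding UH by blast
    show "v \<in> \<Union> H \<and> degree H v = 2" if "v \<in> X" for v
    proof -
      have "v \<in> S" using that by (simp add: X_def)
      then show ?thesis using degH[of v] X3[OF that] that unfolding UH by simp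
    qed
    show "6 \<le> card {v \<in> set vs. v \<in> X \<or> degree H v = 3}" if "is_cycle H vs" for vs
    proof -
      have cF: "is_cycle F vs" using that HF by (rule is_cycle_mono)
      have "41 \<le> length vs" by (rule girth[OF is_cycle_mono[OF cF F(1)]])
      then have "6 \<le> card {v \<in> set vs. degree F v = 3}"
        by (rule long_cycle_branch_vertices[OF deg no cF])
      also have "\<dots> \<le> card {v \<in> set vs. v \<in> X \<or> degree H v = 3}"
      proof (rule card_mono)
        have vS: "v \<in> S" if v: "v \<in> set vs" for v
        proof -
          obtain i where i: "i < length vs" "v = vs ! i" using v by (auto simp: in_set_conv_nth)
          then have "{v, vs ! (Suc i mod length vs)} \<in> H"
            using \<open>is_cycle H vs\<close> unfolding is_cycle_def by blast
          then show ?thesis unfolding UH[symmetric] by blast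
        qed
        \<comment> \<open>A vertex of degree 3 in \<open>F\<close> keeps it in \<open>H\<close>
          unless it is the end of the boundary edge, and then it is marked.\<close>
        show "{v \<in> set vs. degree F v = 3} \<subseteq> {v \<in> set vs. v \<in> X \<or> degree H v = 3}"
          using degH vS by (auto split: if_splits)
      qed simp
      finally show ?thesis .
    qed
    \<comment> \<open>By minimality of \<open>S\<close>, both \<open>T\<close> and
      \<open>S - T\<close> have at least two boundary edges in \<open>F\<close>. If at most one edge
      of \<open>H\<close> separated them, each would have a boundary edge leaving \<open>S\<close>,
      which gives two different vertices in \<open>X\<close>.\<close>
    show "2 \<le> card {e \<in> H. e \<inter> T \<noteq> {} \<and> \<not> e \<subseteq> T}" if "T \<subseteq> \<Union> H" "T \<noteq> {}" "T \<noteq> \<Union> H" for T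
    proof (rule ccontr)
      let ?D = "{e \<in> H. e \<inter> T \<noteq> {} \<and> \<not> e \<subseteq> T}"
      assume "\<not> 2 \<le> card ?D"
      then have D: "card ?D \<le> 1" by simp
      have finD: "finite ?D" using finH by simp
      have T: "T \<subset> S" "S - T \<subset> S" "S - T \<noteq> {}" using that unfolding UH by auto
      have "\<not> bd T \<subseteq> ?D" using min[OF T(1) that(2)] card_mono[OF finD, of "bd T"] D by linarith
      then obtain e where e: "e \<in> bd T" "e \<notin> ?D" by blast
      have "\<not> bd (S - T) \<subseteq> ?D" using min[OF T(2,3)] card_mono[OF finD, of "bd (S - T)"] D by linarith
      then obtain f where f: "f \<in> bd (S - T)" "f \<notin> ?D" by blast
      have eb: "e \<in> bd S" "e \<inter> T \<noteq> {}" using e T(1) by (auto simp: bd_def H_def)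
      have fb: "f \<in> bd S" "f \<inter> (S - T) \<noteq> {}" using f by (auto simp: bd_def H_def)
      obtain x where x: "x \<in> e" "x \<in> T" using eb(2) by blast
      obtain y where y: "y \<in> f" "y \<in> S" "y \<notin> T" using fb(2) by blast
      have "x \<in> X" "y \<in> X" using x y eb fb T(1) by (auto simp: X_def)
      moreover have "x \<noteq> y" using x y by blast
      ultimately have "2 \<le> card X"
        using finS card_mono[of X "{x, y}"] by (simp add: X_def)
      then show False using cardX by simp
    qed
  qed
  have "\<forall>x\<in>\<Union> H. 2 \<le> degree H x"
  proof
    fix x assume "x \<in> \<Union> H"
    then have "degree H x \<in> {2, 3}" unfolding UH by (rule degS)
    then show "2 \<le> degree H x" by auto
  qed
  then have "\<exists>vs. is_cycle H vs" by (rule cycle_exists[OF cardH finH \<open>H \<noteq> {}\<close>])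
  then have "6 \<le> card X" using cycle_imp_card_X by blast
  then show False using cardX by simp
qed

lemma girth_le_length:
  assumes "enat n \<le> girth E" "is_cycle E vs"
  shows "n \<le> length vs"
proof -
  have "girth E \<le> enat (length vs)" unfolding girth_def using assms(2) by (intro INF_lower) simp
  then have "enat n \<le> enat (length vs)" using assms(1) by (rule order_trans[rotated])
  then show ?thesis by simp
qed

lemma degree_le_max_degree:
  assumes "simple_graph V E"
  shows "degree E x \<le> max_degree V E"
proof (cases "x \<in> V")
  case True
  then show ?thesis unfolding max_degree_def using assms by (intro Max_ge) (auto simp: simple_graph_def)
next
  case False
  then have "{e \<in> E. x \<in> e} = {}" using assms by (auto simp: simple_graph_def)
  then show ?thesis by (simp only: degree_def card.empty zero_le)
qed

lemma index_le_5_if_threads: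
  assumes G: "simple_graph V E" "max_degree V E \<le> 3"
    and girth: "\<And>vs. is_cycle E vs \<Longrightarrow> 9 \<le> length vs"
    and threads: "\<And>F. F \<subseteq> E \<Longrightarrow> F \<noteq> {} \<Longrightarrow> \<forall>x\<in>\<Union> F. degree F x \<in> {2, 3} \<Longrightarrow> has_thread F"
  shows "strong_list_chromatic_index E \<le> 5"
proof -
  have fin: "finite E" by (rule finite_edges[OF G(1)])
  have "strong_list_colorable E L" if "\<forall>e\<in>E. infinite (L e) \<or> 5 \<le> card (L e)" for L
  proof (rule strong_list_colorable_if_threads[OF _ fin _ girth threads that])
    show "\<forall>e\<in>E. card e = 2" using G(1) by (simp add: simple_graph_def)
    show "\<forall>x. degree E x \<le> 3" using degree_le_max_degree[OF G(1)] G(2) le_trans by blast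
  qed
  then have "strongly_edge_choosable E 5"
    unfolding strongly_edge_choosable_def strong_list_colorable_def by blast
  then show ?thesis by (simp add: strong_list_chromatic_index_le_iff[OF fin])
qed

theorem theorem1p10:
  fixes V :: "'a set" and E :: "'a set set"
  assumes "simple_graph V E" and "max_degree V E \<le> 3"
  shows "(9 \<le> girth E \<and> mad V E < 2 + 2 / 23 \<longrightarrow> strong_list_chromatic_index E \<le> 5) \<and>
         (planar V E \<and> 41 \<le> girth E \<longrightarrow> strong_list_chromatic_index E \<le> 5)"
proof (intro conjI impI)
  assume A: "9 \<le> girth E \<and> mad V E < 2 + 2 / 23"
  have "enat 9 \<le> girth E" using A by (simp add: numeral_eq_enat)
  then show "strong_list_chromatic_index E \<le> 5"
    using A by (intro index_le_5_if_threads[OF assms] girth_le_length has_thread_if_sparse[OF assms(1)]) auto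
next
  assume A: "planar V E \<and> 41 \<le> girth E"
  have g: "enat 41 \<le> girth E" using A by (simp add: numeral_eq_enat)
  have len: "41 \<le> length vs" if "is_cycle E vs" for vs by (rule girth_le_length[OF g that])
  show "strong_list_chromatic_index E \<le> 5"
  proof (rule index_le_5_if_threads[OF assms])
    show "9 \<le> length vs" if "is_cycle E vs" for vs using len[OF that] by simp
    show "has_thread F" if "F \<subseteq> E" "F \<noteq> {}" "\<forall>x\<in>\<Union> F. degree F x \<in> {2, 3}" for F
      using A by (intro has_thread_if_planar[OF assms(1) _ len that]) blast
  qed
qed

end
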